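(* Let $\mathfrak{n}=\mathfrak{h}_3\oplus\mathbb{R}$ with orthonormal basis $e_1,e_2,e_3,e_4$ and only non-trivial bracket $[e_1,e_2]=e_3$, let $N=H_3\times\mathbb{R}$ be the simply connected Lie group with Lie algebra $\mathfrak n$, endowed with the corresponding left-invariant metric, and let $\omega^F=a\,e^{13}+b\,e^{23}+c\,e^{14}+\rho\,e^{12}$ ($a,b,c,\rho\in\mathbb{R}$) be any invariant closed 2-form of this form, assumed to have rank $2$ (so that $bc=0$). For a lattice $\Lambda\subset\mathfrak{n}$ as specified below, let $\Gamma=\exp(\Lambda)$, a lattice of $N$, and consider the magnetic flow on $M_\Gamma=\Gamma\backslash N$ for the induced metric and Lorentz force. (1) If $b=0$ and $\Lambda=\mathrm{Span}_{\mathbb{Z}}(2e_1,e_2,e_3,e_4)$, the magnetic flow is completely integrable by analytical first integrals $f_2,f_3,f_4$ either if $a\neq0$, or if $a=0$ at any energy level $\mathrm{E}<|\rho|$. If $a=0$, one has complete integrability by differentiable (but not all analytical) first integrals at energy levels $\mathrm{E}\geq|\rho|$. (2) If $c=0$ and $b\neq0$, and $\Lambda=\mathrm{Span}_{\mathbb{Z}}(2e_1,\frac1b e_2,\frac1b e_3,e_4)$ when $a=0$, respectively $\Lambda=\mathrm{Span}_{\mathbb{Z}}(\frac2a e_1,\frac1b e_2,\frac1{ab}e_3,e_4)$ when $a\ne0$, the magnetic flow is completely integrable by analytical first integrals $g_2,g_3,g_4$ at any energy level. In particular, this is true for the magnetic field represented by the exact 2-form $\rho\,de^3$.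
   Context: $\{e^i\}$ is the dual basis of $\{e_i\}$, and $e^{rs}=e^r\wedge e^s$. The Lorentz force $F$ is the left-invariant skew-symmetric endomorphism with $\omega^F(X,Y)=\langle FX,Y\rangle$; $\omega^F$ is the magnetic field. A magnetic geodesic is a curve with $\nabla_{\gamma'}\gamma'=F\gamma'$; a first integral of the magnetic flow is a differentiable function on the tangent bundle which is constant along $\gamma'$ for every magnetic geodesic $\gamma$. $\Gamma$ acts on $N$ by left translations, and the metric and $F$ descend to the compact manifold $M_\Gamma$. Energy: $\mathrm{E}$ is the energy function $\mathrm{E}(v)=\frac12\langle v,v\rangle$, which is a first integral; energy levels are its level sets. Poisson bracket: let $\eta_v(U)=\langle v,\pi_*U\rangle$ be the tautological 1-form on the tangent bundle with projection $\pi$, let $\Omega^F=-d\eta+\pi^*\omega^F$, define $X_\phi$ by $\Omega^F(X_\phi,U)=U(\phi)$ for all $U$, and $\{\phi_1,\phi_2\}^F=\Omega^F(X_{\phi_1},X_{\phi_2})$. Complete integrability: the magnetic flow on a Riemannian manifold $M$ of dimension $n$ is completely integrable if there are $n-1$ first integrals $\Psi_1,\dots,\Psi_{n-1}:TM\to\mathbb{R}$ with $\{\Psi_i,\Psi_j\}^F=0$ for all $i,j$ and such that the gradients of $\mathrm{E},\Psi_1,\dots,\Psi_{n-1}$ are linearly independent on a dense subset of $TM$. The functions: every tangent vector of $N$ is $pV:=(L_p)_*V$ with $p\in N$, $V\in\mathfrak n$, where $L_p$ is left translation by $p$. For $p=\exp(W)$, $W\in\mathfrak n$, and $j=1,\dots,4$,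 put $$I_j(pV)=\langle V,e_j-[W,e_j]\rangle+\langle F(e_j),W\rangle-\tfrac12\sum_{i,k=1}^2\langle e_i,W\rangle\langle e_k,W\rangle\langle F[e_i,e_j],e_k\rangle .$$ If $b=0$: $f_2=I_2-\frac1{2a}(I_3+\rho)^2$ if $a\ne0$, and $f_2=e^{-1/(I_3+\rho)^2}\sin\left(\frac{\pi I_2}{I_3+\rho}\right)$ if $a=0$ (understood as $0$ where $I_3+\rho=0$); $f_3=\sin(\frac{\pi}{a}I_3)$ if $a\neq0$, $f_3=I_3$ if $a=0$; $f_4=\sin(\frac{\pi}{c}I_4)$ if $c\ne0$, $f_4=I_4$ if $c=0$. If $c=0$, $b\ne0$: $g_2=bI_1-aI_2+\frac12(I_3+\rho)^2$, $g_3=\sin(2\pi I_3)$, $g_4=I_4$. These functions on $TN$ are $\Gamma$-invariant and are regarded as functions on $TM_\Gamma$.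
   Formalization: In (1) with a=0 the thresholds E<|ρ| and E≥|ρ| are false as written (e.g. ρ=1, E=0.9) and are replaced by sqrt(2E)<|ρ| and sqrt(2E)≥|ρ|; the same holds for ρ de^3. Only energy levels E>0 are considered, since the gradient of E vanishes at E=0. *)

theory Defs
  imports "HOL-Analysis.Analysis"
begin

section \<open>Calculus on a Euclidean space\<close>

primrec Ck :: "nat \<Rightarrow> ('a::real_normed_vector \<Rightarrow> real) \<Rightarrow> bool" where
  "Ck 0 f \<longleftrightarrow> continuous_on UNIV f"
| "Ck (Suc k) f \<longleftrightarrow> (\<forall>x. f differentiable (at x)) \<and> (\<forall>v. Ck k (\<lambda>x. frechet_derivative f (at x) v))"

definition smooth :: "('a::real_normed_vector \<Rightarrow> real) \<Rightarrow> bool" where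
  "smooth f \<longleftrightarrow> (\<forall>k. Ck k f)"

text \<open>On an open set \<open>S\<close> this is ordinary real analyticity. On an analytic submanifold \<open>S\<close>
  (such as an energy level) it is analyticity of the restriction of \<open>f\<close> to \<open>S\<close>: near each point
  of \<open>S\<close>, \<open>f\<close> agrees on \<open>S\<close> with a convergent power series of the ambient space. The functions
  \<open>\<alpha>\<close> are the multi-indices, and summability is unconditional, hence absolute.\<close>

definition real_analytic_on :: "('a::euclidean_space \<Rightarrow> real) \<Rightarrow> 'a set \<Rightarrow> bool" where
  "real_analytic_on f S \<longleftrightarrow>
     (\<forall>x\<in>S. \<exists>r>0. \<exists>coef. \<forall>y\<in>ball x r.
        (\<lambda>\<alpha>. coef \<alpha> * (\<Prod>b\<in>Basis. ((y - x) \<bullet> b) ^ \<alpha> b)) summable_on (Basis \<rightarrow>\<^sub>E (UNIV :: nat set)) \<and>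
        (y \<in> S \<longrightarrow>
          f y = (\<Sum>\<^sub>\<infinity>\<alpha>\<in>Basis \<rightarrow>\<^sub>E UNIV. coef \<alpha> * (\<Prod>b\<in>Basis. ((y - x) \<bullet> b) ^ \<alpha> b))))"

text \<open>The gradient for the Euclidean metric of the coordinates; linear independence of gradients
  does not depend on the metric used to form them.\<close>

definition grad :: "('a::euclidean_space \<Rightarrow> real) \<Rightarrow> 'a \<Rightarrow> 'a" where
  "grad f x = (\<Sum>b\<in>Basis. frechet_derivative f (at x) b *\<^sub>R b)"

definition indep_family :: "'a::real_vector list \<Rightarrow> bool" where
  "indep_family vs \<longleftrightarrow>
     (\<forall>k :: nat \<Rightarrow> real. (\<Sum>i<length vs. k i *\<^sub>R vs ! i) = 0 \<longrightarrow> (\<forall>i<length vs. k i = 0))"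

text \<open>Exterior derivative of a 1-form, evaluated on two constant vector fields (whose Lie bracket
  vanishes).\<close>

definition ext_deriv :: "('a::real_normed_vector \<Rightarrow> 'a \<Rightarrow> real) \<Rightarrow> 'a \<Rightarrow> 'a \<Rightarrow> 'a \<Rightarrow> real" where
  "ext_deriv \<theta> x A B =
     frechet_derivative (\<lambda>y. \<theta> y B) (at x) A - frechet_derivative (\<lambda>y. \<theta> y A) (at x) B"


section \<open>The Lie algebra and the Lie group\<close>

abbreviation basis4 :: "4 \<Rightarrow> real^4" where
  "basis4 i \<equiv> axis i 1"

definition bracket :: "real^4 \<Rightarrow> real^4 \<Rightarrow> real^4" where
  "bracket X Y = (X$1 * Y$2 - X$2 * Y$1) *\<^sub>R basis4 3"

text \<open>The simply connected group \<open>N\<close> is realised on its Lie algebra through the exponential map: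
  a vector \<open>W\<close> also denotes the group element \<open>exp(W)\<close>, and the multiplication is given by the
  Baker-Campbell-Hausdorff formula (all higher brackets vanish). In these coordinates \<open>exp\<close> is the
  identity, the neutral element is \<open>0\<close>, and the image of a lattice under \<open>exp\<close> is the lattice
  itself.\<close>

definition nmul :: "real^4 \<Rightarrow> real^4 \<Rightarrow> real^4" where
  "nmul p q = p + q + (1/2) *\<^sub>R bracket p q"

definition ninv :: "real^4 \<Rightarrow> real^4" where
  "ninv p = - p"

text \<open>A tangent vector of \<open>N\<close> is a pair of a foot point and a coordinate velocity. The tangent
  map of the left translation by \<open>p\<close>; in particular \<open>ltrans p (0, V)\<close> is the vector \<open>pV\<close>.\<close>

type_synonym tvec = "(real^4) \<times> (real^4)"

definition ltrans :: "real^4 \<Rightarrow> tvec \<Rightarrow> tvec" where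
  "ltrans p x = (nmul p (fst x), frechet_derivative (nmul p) (at (fst x)) (snd x))"

text \<open>The element \<open>V\<close> of the Lie algebra with \<open>(p, u) = pV\<close>.\<close>

definition to_alg :: "real^4 \<Rightarrow> real^4 \<Rightarrow> real^4" where
  "to_alg p u = snd (ltrans (ninv p) (p, u))"

definition metric :: "real^4 \<Rightarrow> real^4 \<Rightarrow> real^4 \<Rightarrow> real" where
  "metric p u v = to_alg p u \<bullet> to_alg p v"

definition energy :: "tvec \<Rightarrow> real" where
  "energy x = 1/2 * metric (fst x) (snd x) (snd x)"


section \<open>Left-invariant forms, Lorentz force, magnetic geodesics\<close>

text \<open>A left-invariant form is given by its values on the Lie algebra.\<close>

definition wedge :: "4 \<Rightarrow> 4 \<Rightarrow> real^4 \<Rightarrow> real^4 \<Rightarrow> real" where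
  "wedge r s X Y = X$r * Y$s - X$s * Y$r"

definition inv_d :: "(real^4 \<Rightarrow> real) \<Rightarrow> real^4 \<Rightarrow> real^4 \<Rightarrow> real" where
  "inv_d \<theta> X Y = - \<theta> (bracket X Y)"

definition inv_closed :: "(real^4 \<Rightarrow> real^4 \<Rightarrow> real) \<Rightarrow> bool" where
  "inv_closed \<omega> \<longleftrightarrow>
     (\<forall>X Y Z. - \<omega> (bracket X Y) Z - \<omega> (bracket Y Z) X - \<omega> (bracket Z X) Y = 0)"

definition form_rank :: "(real^4 \<Rightarrow> real^4 \<Rightarrow> real) \<Rightarrow> nat" where
  "form_rank \<omega> = rank (\<chi> i j. \<omega> (basis4 i) (basis4 j))"

definition mag_form :: "real \<Rightarrow> real \<Rightarrow> real \<Rightarrow> real \<Rightarrow> real^4 \<Rightarrow> real^4 \<Rightarrow> real" where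
  "mag_form a b c \<rho> X Y =
     a * wedge 1 3 X Y + b * wedge 2 3 X Y + c * wedge 1 4 X Y + \<rho> * wedge 1 2 X Y"

definition form_at :: "(real^4 \<Rightarrow> real^4 \<Rightarrow> real) \<Rightarrow> real^4 \<Rightarrow> real^4 \<Rightarrow> real^4 \<Rightarrow> real" where
  "form_at \<omega> p u v = \<omega> (to_alg p u) (to_alg p v)"

definition lorentz :: "(real^4 \<Rightarrow> real^4 \<Rightarrow> real) \<Rightarrow> real^4 \<Rightarrow> real^4" where
  "lorentz \<omega> X = (THE Z. \<forall>Y. Z \<bullet> Y = \<omega> X Y)"

definition lorentz_at :: "(real^4 \<Rightarrow> real^4 \<Rightarrow> real) \<Rightarrow> real^4 \<Rightarrow> real^4 \<Rightarrow> real^4" where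
  "lorentz_at \<omega> p u = snd (ltrans p (0, lorentz \<omega> (to_alg p u)))"

text \<open>The Levi-Civita connection in coordinates: \<open>christoffel p k i j\<close> is the symbol with upper
  index \<open>k\<close>.\<close>

definition gram :: "real^4 \<Rightarrow> real^4^4" where
  "gram p = (\<chi> i j. metric p (basis4 i) (basis4 j))"

definition dgram :: "real^4 \<Rightarrow> 4 \<Rightarrow> 4 \<Rightarrow> 4 \<Rightarrow> real" where
  "dgram p k i j = frechet_derivative (\<lambda>q. gram q $ i $ j) (at p) (basis4 k)"

definition christoffel :: "real^4 \<Rightarrow> 4 \<Rightarrow> 4 \<Rightarrow> 4 \<Rightarrow> real" where
  "christoffel p k i j =
     1/2 * (\<Sum>l\<in>UNIV. matrix_inv (gram p) $ k $ l * (dgram p i j l + dgram p j i l - dgram p l i j))"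

definition velocity :: "(real \<Rightarrow> real^4) \<Rightarrow> real \<Rightarrow> real^4" where
  "velocity \<gamma> t = vector_derivative \<gamma> (at t)"

definition cov_accel :: "(real \<Rightarrow> real^4) \<Rightarrow> real \<Rightarrow> real^4" where
  "cov_accel \<gamma> t = vector_derivative (velocity \<gamma>) (at t) +
     (\<chi> k. \<Sum>i\<in>UNIV. \<Sum>j\<in>UNIV. christoffel (\<gamma> t) k i j * velocity \<gamma> t $ i * velocity \<gamma> t $ j)"

definition magnetic_geodesic ::
    "(real^4 \<Rightarrow> real^4 \<Rightarrow> real) \<Rightarrow> real set \<Rightarrow> (real \<Rightarrow> real^4) \<Rightarrow> bool" where
  "magnetic_geodesic \<omega> J \<gamma> \<longleftrightarrow> open J \<and> is_interval J \<and>
     (\<forall>t\<in>J. \<gamma> differentiable (at t) \<and> velocity \<gamma> differentiable (at t) \<and>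
        cov_accel \<gamma> t = lorentz_at \<omega> (\<gamma> t) (velocity \<gamma> t))"


section \<open>The magnetic symplectic form and the Poisson bracket\<close>

definition taut_form :: "tvec \<Rightarrow> tvec \<Rightarrow> real" where
  "taut_form x U = metric (fst x) (snd x) (fst U)"

definition mag_sympl :: "(real^4 \<Rightarrow> real^4 \<Rightarrow> real) \<Rightarrow> tvec \<Rightarrow> tvec \<Rightarrow> tvec \<Rightarrow> real" where
  "mag_sympl \<omega> x A B = - ext_deriv taut_form x A B + form_at \<omega> (fst x) (fst A) (fst B)"

definition ham_field :: "(real^4 \<Rightarrow> real^4 \<Rightarrow> real) \<Rightarrow> (tvec \<Rightarrow> real) \<Rightarrow> tvec \<Rightarrow> tvec" where
  "ham_field \<omega> \<phi> x = (THE X. \<forall>U. mag_sympl \<omega> x X U = frechet_derivative \<phi> (at x) U)"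

definition poisson ::
    "(real^4 \<Rightarrow> real^4 \<Rightarrow> real) \<Rightarrow> (tvec \<Rightarrow> real) \<Rightarrow> (tvec \<Rightarrow> real) \<Rightarrow> tvec \<Rightarrow> real" where
  "poisson \<omega> \<phi> \<psi> x = mag_sympl \<omega> x (ham_field \<omega> \<phi> x) (ham_field \<omega> \<psi> x)"


section \<open>The compact quotient\<close>

definition int_span4 :: "real^4 \<Rightarrow> real^4 \<Rightarrow> real^4 \<Rightarrow> real^4 \<Rightarrow> (real^4) set" where
  "int_span4 u1 u2 u3 u4 =
     {of_int k1 *\<^sub>R u1 + of_int k2 *\<^sub>R u2 + of_int k3 *\<^sub>R u3 + of_int k4 *\<^sub>R u4 | k1 k2 k3 k4 :: int. True}"

text \<open>Discrete cocompact subgroups of \<open>N\<close>.\<close>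

definition lattice_in_N :: "(real^4) set \<Rightarrow> bool" where
  "lattice_in_N \<Gamma> \<longleftrightarrow> 0 \<in> \<Gamma> \<and> (\<forall>p\<in>\<Gamma>. \<forall>q\<in>\<Gamma>. nmul p (ninv q) \<in> \<Gamma>) \<and>
     (\<exists>r>0. \<Gamma> \<inter> ball 0 r = {0}) \<and> (\<exists>K. compact K \<and> (\<Union>p\<in>\<Gamma>. nmul p ` K) = UNIV)"

text \<open>The tangent bundle of \<open>\<Gamma>\<setminus>N\<close> is the quotient of the tangent bundle of \<open>N\<close> by \<open>\<Gamma>\<close>, with
  covering map \<open>covproj \<Gamma>\<close>. Metric, Lorentz force and symplectic form on it are those
  of \<open>N\<close> in the local charts provided by \<open>covproj \<Gamma>\<close>, so smoothness, analyticity, gradients and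
  Poisson brackets of a function \<open>\<Psi>\<close> on the quotient are computed on the lift \<open>\<Psi> \<circ> covproj \<Gamma>\<close>, and
  the magnetic geodesics of \<open>\<Gamma>\<setminus>N\<close> are the projections of those of \<open>N\<close>.\<close>

definition covproj :: "(real^4) set \<Rightarrow> tvec \<Rightarrow> tvec set" where
  "covproj \<Gamma> x = (\<lambda>g. ltrans g x) ` \<Gamma>"

definition TM :: "(real^4) set \<Rightarrow> tvec set set" where
  "TM \<Gamma> = range (covproj \<Gamma>)"

definition TM_topology :: "(real^4) set \<Rightarrow> tvec set topology" where
  "TM_topology \<Gamma> = topology (\<lambda>U. U \<subseteq> TM \<Gamma> \<and> open (covproj \<Gamma> -` U))"

text \<open>A \<open>\<Gamma>\<close>-invariant function on the tangent bundle of \<open>N\<close>, regarded as a function on the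
  quotient.\<close>

definition invariant :: "(real^4) set \<Rightarrow> (tvec \<Rightarrow> real) \<Rightarrow> bool" where
  "invariant \<Gamma> f \<longleftrightarrow> (\<forall>g\<in>\<Gamma>. \<forall>x. f (ltrans g x) = f x)"

definition descend :: "(real^4) set \<Rightarrow> (tvec \<Rightarrow> real) \<Rightarrow> tvec set \<Rightarrow> real" where
  "descend \<Gamma> f Q = the_elem (f ` Q)"

text \<open>Only levels \<open>h > 0\<close> carry an integrability statement: the level \<open>0\<close> is the zero section, on
  which the gradient of the energy vanishes. On the level \<open>h\<close> all vectors have norm \<open>sqrt (2 * h)\<close>;
  for \<open>a = b = 0\<close> the function \<open>I\<^sub>3 + \<rho>\<close> has no zero on the level iff \<open>sqrt (2 * h) < \<bar>\<rho>\<bar>\<close>, and this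
  is the precise range in which the flat factor of \<open>f2\<close> below is analytic.\<close>

definition energy_level :: "(real^4) set \<Rightarrow> real \<Rightarrow> tvec set set" where
  "energy_level \<Gamma> h = {Q \<in> TM \<Gamma>. descend \<Gamma> energy Q = h}"

definition first_integral ::
    "(real^4) set \<Rightarrow> (real^4 \<Rightarrow> real^4 \<Rightarrow> real) \<Rightarrow> (tvec set \<Rightarrow> real) \<Rightarrow> bool" where
  "first_integral \<Gamma> \<omega> \<Psi> \<longleftrightarrow> smooth (\<Psi> \<circ> covproj \<Gamma>) \<and>
     (\<forall>J \<gamma>. magnetic_geodesic \<omega> J \<gamma> \<longrightarrow> (\<lambda>t. \<Psi> (covproj \<Gamma> (\<gamma> t, velocity \<gamma> t))) constant_on J)"

definition analytic_at_level :: "(real^4) set \<Rightarrow> tvec set set \<Rightarrow> (tvec set \<Rightarrow> real) \<Rightarrow> bool" where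
  "analytic_at_level \<Gamma> S \<Psi> \<longleftrightarrow> real_analytic_on (\<Psi> \<circ> covproj \<Gamma>) (covproj \<Gamma> -` S)"

text \<open>Complete integrability by the listed functions, with the independence condition imposed on
  a dense subset of \<open>S\<close>: \<open>S = TM \<Gamma>\<close> is complete integrability of the magnetic flow,
  \<open>S = energy_level \<Gamma> h\<close> complete integrability at the energy level \<open>h\<close>.\<close>

definition completely_integrable_by ::
    "(real^4) set \<Rightarrow> (real^4 \<Rightarrow> real^4 \<Rightarrow> real) \<Rightarrow> tvec set set \<Rightarrow> (tvec set \<Rightarrow> real) list \<Rightarrow> bool" where
  "completely_integrable_by \<Gamma> \<omega> S \<Psi>s \<longleftrightarrow>
     length \<Psi>s = DIM(real^4) - 1 \<and>
     (\<forall>\<Psi>\<in>set \<Psi>s. first_integral \<Gamma> \<omega> \<Psi>) \<and>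
     (\<forall>\<Phi>\<in>set \<Psi>s. \<forall>\<Psi>\<in>set \<Psi>s. \<forall>x. poisson \<omega> (\<Phi> \<circ> covproj \<Gamma>) (\<Psi> \<circ> covproj \<Gamma>) x = 0) \<and>
     S \<subseteq> TM_topology \<Gamma> closure_of
       (S \<inter> covproj \<Gamma> ` {x. indep_family
          (map (\<lambda>\<Psi>. grad (\<Psi> \<circ> covproj \<Gamma>) x) (descend \<Gamma> energy # \<Psi>s))})"


section \<open>The first integrals\<close>

definition I_fun :: "(real^4 \<Rightarrow> real^4 \<Rightarrow> real) \<Rightarrow> 4 \<Rightarrow> tvec \<Rightarrow> real" where
  "I_fun \<omega> j x = (let W = fst x; V = to_alg (fst x) (snd x) in
     V \<bullet> (basis4 j - bracket W (basis4 j)) + lorentz \<omega> (basis4 j) \<bullet> W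
     - 1/2 * (\<Sum>i\<in>{1, 2}. \<Sum>k\<in>{1, 2}.
         (basis4 i \<bullet> W) * (basis4 k \<bullet> W) * (lorentz \<omega> (bracket (basis4 i) (basis4 j)) \<bullet> basis4 k)))"

definition f2 :: "real \<Rightarrow> real \<Rightarrow> real \<Rightarrow> tvec \<Rightarrow> real" where
  "f2 a c \<rho> x = (let I2 = I_fun (mag_form a 0 c \<rho>) 2 x; I3 = I_fun (mag_form a 0 c \<rho>) 3 x in
     if a \<noteq> 0 then I2 - 1 / (2 * a) * (I3 + \<rho>)^2
     else if I3 + \<rho> = 0 then 0
     else exp (- 1 / (I3 + \<rho>)^2) * sin (pi * I2 / (I3 + \<rho>)))"

definition f3 :: "real \<Rightarrow> real \<Rightarrow> real \<Rightarrow> tvec \<Rightarrow> real" where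
  "f3 a c \<rho> x = (let I3 = I_fun (mag_form a 0 c \<rho>) 3 x in if a \<noteq> 0 then sin (pi / a * I3) else I3)"

definition f4 :: "real \<Rightarrow> real \<Rightarrow> real \<Rightarrow> tvec \<Rightarrow> real" where
  "f4 a c \<rho> x = (let I4 = I_fun (mag_form a 0 c \<rho>) 4 x in if c \<noteq> 0 then sin (pi / c * I4) else I4)"

definition g2 :: "real \<Rightarrow> real \<Rightarrow> real \<Rightarrow> tvec \<Rightarrow> real" where
  "g2 a b \<rho> x = b * I_fun (mag_form a b 0 \<rho>) 1 x - a * I_fun (mag_form a b 0 \<rho>) 2 x
     + 1/2 * (I_fun (mag_form a b 0 \<rho>) 3 x + \<rho>)^2"

definition g3 :: "real \<Rightarrow> real \<Rightarrow> real \<Rightarrow> tvec \<Rightarrow> real" where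
  "g3 a b \<rho> x = sin (2 * pi * I_fun (mag_form a b 0 \<rho>) 3 x)"

definition g4 :: "real \<Rightarrow> real \<Rightarrow> real \<Rightarrow> tvec \<Rightarrow> real" where
  "g4 a b \<rho> x = I_fun (mag_form a b 0 \<rho>) 4 x"

end

theory Submission
  imports Defs
begin

text \<open>Write \<open>V = to_alg p u\<close> for the left-trivialised velocity. Substituting the definitions, the position
  coordinates largely cancel: for \<open>b = 0\<close> the integrals \<open>f2\<close>, \<open>f3\<close>, \<open>f4\<close> depend only on \<open>p\<^sub>1\<close> and
  \<open>V\<^sub>2\<close>, \<open>V\<^sub>3\<close>, \<open>V\<^sub>4\<close>, and for \<open>c = 0\<close> the integrals are \<open>g2 = b V\<^sub>1 - a V\<^sub>2 + (V\<^sub>3 + \<rho>)\<^sup>2/2\<close>, a sine of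
  \<open>V\<^sub>3 - a p\<^sub>1 - b p\<^sub>2\<close>, and \<open>V\<^sub>4\<close>. All claims are read off from these formulas in the left-invariant
  frame.

  Conservation: the geodesic equation becomes an ordinary differential equation with quadratic right-hand
  side for \<open>V\<close> (\<open>magnetic_geodesic_derivatives\<close>). Invariance: left translation by \<open>\<Gamma>\<close> fixes \<open>V\<close>
  and shifts \<open>p\<^sub>1\<close>, \<open>p\<^sub>2\<close> by periods of the sines. Involution: in the frame the symplectic form is the
  canonical one plus the twisted form with \<open>\<rho>\<close> replaced by \<open>\<rho> + V\<^sub>3\<close> (\<open>mag_sympl_frame\<close>), so a
  Poisson bracket is an explicit bilinear expression in the partial gradients (\<open>poisson_frame\<close>); for
  \<open>b = 0\<close> it vanishes for all functions of \<open>p\<^sub>1, V\<^sub>2, V\<^sub>3, V\<^sub>4\<close>.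

  Independence: the gradients are independent off the zero sets of a few affine functions of \<open>V\<close> and cosines. Within
  an energy level those sets are avoided by a small rotation of \<open>V\<close>, which keeps the energy, followed
  by a small shift of one position coordinate, which avoids countably many zeros.

  Regularity: the only delicate function is \<open>f2\<close> for \<open>a = 0\<close>, which is
  \<open>exp (-1/s\<^sup>2) sin (\<pi> I\<^sub>2/s)\<close> with \<open>s = V\<^sub>3 + \<rho>\<close>. It is smooth because its derivatives belong to a family
  of functions that all tend to \<open>0\<close> with \<open>s\<close>. If \<open>sqrt (2 h) < \<bar>\<rho>\<bar>\<close> then \<open>s\<close> has no zero on the level \<open>h\<close>
  and analyticity follows from closure properties of convergent power series. Otherwise the level contains
  an analytic curve through \<open>s = 0\<close> along which the sine equals \<open>-1\<close>; the restriction of \<open>f2\<close> to it is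
  flat at one point and nonzero nearby, which no analytic function is (\<open>not_analytic_f2\<close>).\<close>

section \<open>The group in coordinates\<close>

lemma bracket_nth:
  "bracket X Y $ 1 = 0" "bracket X Y $ 2 = 0" "bracket X Y $ 4 = 0"
  "bracket X Y $ 3 = X$1 * Y$2 - X$2 * Y$1"
  by (simp_all add: bracket_def axis_def)

lemma nmul_nth:
  "nmul p q $ 1 = p$1 + q$1" "nmul p q $ 2 = p$2 + q$2" "nmul p q $ 4 = p$4 + q$4"
  "nmul p q $ 3 = p$3 + q$3 + (p$1 * q$2 - p$2 * q$1) / 2"
  by (simp_all add: nmul_def bracket_nth)

lemma bounded_linear_bracket: "bounded_linear (bracket p)"
  unfolding bracket_def
  by (intro bounded_linear_scaleR_const bounded_linear_sub
      bounded_linear_const_mult bounded_linear_vec_nth)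

lemma ltrans_eq: "ltrans p (q, u) = (nmul p q, u + (1/2) *\<^sub>R bracket p u)"
proof -
  have "(nmul p has_derivative (\<lambda>u. u + (1/2) *\<^sub>R bracket p u)) (at q)"
    unfolding nmul_def
    by (auto intro!: derivative_eq_intros bounded_linear_imp_has_derivative
        bounded_linear_bracket)
  then show ?thesis
    by (simp add: ltrans_def frechet_derivative_at[symmetric])
qed

lemma to_alg_nth:
  "to_alg p u $ 1 = u$1" "to_alg p u $ 2 = u$2" "to_alg p u $ 4 = u$4"
  "to_alg p u $ 3 = u$3 - (p$1 * u$2 - p$2 * u$1) / 2"
  by (simp_all add: to_alg_def ninv_def ltrans_eq bracket_nth field_simps)

lemma vec4_eq_iff: "x = y \<longleftrightarrow> x$1 = y$1 \<and> x$2 = y$2 \<and> x$3 = y$3 \<and> x$4 = (y::real^4)$4"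
  by (simp add: vec_eq_iff forall_4)

lemma inner4: "x \<bullet> y = x$1 * y$1 + x$2 * y$2 + x$3 * y$3 + x$4 * (y::real^4)$4"
  by (simp add: inner_vec_def sum_4)

definition of_alg :: "real^4 \<Rightarrow> real^4 \<Rightarrow> real^4" where
  "of_alg p V = V + (1/2) *\<^sub>R bracket p V"

lemma of_alg_nth:
  "of_alg p V $ 1 = V$1" "of_alg p V $ 2 = V$2" "of_alg p V $ 4 = V$4"
  "of_alg p V $ 3 = V$3 + (p$1 * V$2 - p$2 * V$1) / 2"
  by (simp_all add: of_alg_def bracket_nth)

lemma to_alg_of_alg [simp]: "to_alg p (of_alg p V) = V"
  and of_alg_to_alg [simp]: "of_alg p (to_alg p V) = V"
  by (simp_all add: vec4_eq_iff to_alg_nth of_alg_nth)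

lemma to_alg_ltrans: "to_alg (fst (ltrans g x)) (snd (ltrans g x)) = to_alg (fst x) (snd x)"
  by (cases x) (simp add: ltrans_eq vec4_eq_iff to_alg_nth nmul_nth bracket_nth field_simps)

lemma fst_ltrans_nth:
  "fst (ltrans g x) $ 1 = g$1 + fst x $ 1" "fst (ltrans g x) $ 2 = g$2 + fst x $ 2"
  by (cases x; simp add: ltrans_eq nmul_nth)+

lemma energy_ltrans: "energy (ltrans g x) = energy x"
  by (simp add: energy_def metric_def to_alg_ltrans)

lemma energy_of_alg: "energy (p, of_alg p V) = 1/2 * (V \<bullet> V)"
  by (simp add: energy_def metric_def)

section \<open>Lattices and quotients\<close>

lemma int_span4_axis_iff:
  "p \<in> int_span4 (\<alpha> *\<^sub>R basis4 1) (\<beta> *\<^sub>R basis4 2) (\<gamma> *\<^sub>R basis4 3) (basis4 4) \<longleftrightarrow>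
    (\<exists>(k::int) (l::int) (m::int) (n::int). p$1 = k * \<alpha> \<and> p$2 = l * \<beta> \<and> p$3 = m * \<gamma> \<and> p$4 = n)"
  by (auto simp: int_span4_def vec4_eq_iff axis_def)

text \<open>All lattices that occur are of this form. In the group law the third coordinate is displaced by
  integer multiples of \<open>\<alpha>\<beta>/2\<close>, and this must be absorbed by \<open>\<gamma>\<int>\<close>. For cocompactness the first, second
  and fourth coordinates are reduced into a box by rounding, and then the third.\<close>
lemma lattice_axis:
  fixes \<alpha> \<beta> \<gamma> :: real
  assumes ab: "\<alpha> * \<beta> = 2 * \<gamma>" and "\<gamma> \<noteq> 0"
  shows "lattice_in_N (int_span4 (\<alpha> *\<^sub>R basis4 1) (\<beta> *\<^sub>R basis4 2) (\<gamma> *\<^sub>R basis4 3) (basis4 4))"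
    (is "lattice_in_N ?\<Gamma>")
proof -
  have nz: "\<alpha> \<noteq> 0" "\<beta> \<noteq> 0" "\<gamma> \<noteq> 0" using assms by auto
  have 0: "0 \<in> ?\<Gamma>"
    unfolding int_span4_axis_iff by (intro exI[of _ "0::int"]) simp
  have sub: "nmul p (ninv q) \<in> ?\<Gamma>" if "p \<in> ?\<Gamma>" "q \<in> ?\<Gamma>" for p q
  proof -
    from that obtain k l m n k' l' m' n' where
      p: "p$1 = of_int k * \<alpha>" "p$2 = of_int l * \<beta>" "p$3 = of_int m * \<gamma>" "p$4 = of_int n" and
      q: "q$1 = of_int k' * \<alpha>" "q$2 = of_int l' * \<beta>" "q$3 = of_int m' * \<gamma>" "q$4 = of_int n'"
      unfolding int_span4_axis_iff by blast
    have "nmul p (ninv q) $ 3 = of_int m * \<gamma> - of_int m' * \<gamma> - of_int (k * l' - l * k') * (\<alpha> * \<beta>) / 2"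
      by (simp add: nmul_nth ninv_def p q field_simps)
    also have "\<dots> = of_int (m - m' - (k * l' - l * k')) * \<gamma>"
      unfolding ab by (simp add: field_simps)
    finally have 3: "nmul p (ninv q) $ 3 = of_int (m - m' - (k * l' - l * k')) * \<gamma>" .
    show ?thesis
      unfolding int_span4_axis_iff
    proof (intro exI conjI)
      show "nmul p (ninv q) $ 1 = of_int (k - k') * \<alpha>" "nmul p (ninv q) $ 2 = of_int (l - l') * \<beta>"
        "nmul p (ninv q) $ 4 = of_int (n - n')"
        by (simp_all add: nmul_nth ninv_def p q algebra_simps)
    qed (rule 3)
  qed
  have disc: "\<exists>r>0. ?\<Gamma> \<inter> ball 0 r = {0}"
  proof (intro exI conjI)
    define r where "r = Min {\<bar>\<alpha>\<bar>, \<bar>\<beta>\<bar>, \<bar>\<gamma>\<bar>, 1}"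
    show "r > 0" using nz by (simp add: r_def)
    have small: "k = 0" if "\<bar>of_int k * c\<bar> < r" "r \<le> \<bar>c\<bar>" for k :: int and c :: real
    proof (rule ccontr)
      assume "k \<noteq> 0"
      then have "1 * \<bar>c\<bar> \<le> \<bar>of_int k\<bar> * \<bar>c\<bar>" by (intro mult_right_mono) linarith+
      then show False using that by (simp add: abs_mult)
    qed
    have le: "r \<le> \<bar>\<alpha>\<bar>" "r \<le> \<bar>\<beta>\<bar>" "r \<le> \<bar>\<gamma>\<bar>" "r \<le> \<bar>1\<bar>" by (simp_all add: r_def)
    have "p = 0" if p_in: "p \<in> ?\<Gamma>" and p_lt: "norm p < r" for p
    proof -
      obtain k l m n where
        p: "p$1 = of_int k * \<alpha>" "p$2 = of_int l * \<beta>" "p$3 = of_int m * \<gamma>" "p$4 = of_int n * 1"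
        using p_in unfolding int_span4_axis_iff mult_1_right by blast
      have "\<bar>p$i\<bar> < r" for i using component_le_norm_cart[of p i] p_lt by linarith
      then have "k = 0" "l = 0" "m = 0" "n = 0"
        using small[of k \<alpha>] small[of l \<beta>] small[of m \<gamma>] small[of n 1] le p by metis+
      then show ?thesis by (simp add: vec4_eq_iff p)
    qed
    then show "?\<Gamma> \<inter> ball 0 r = {0}" using 0 \<open>r > 0\<close> by auto
  qed
  have cocomp: "\<exists>K. compact K \<and> (\<Union>p\<in>?\<Gamma>. nmul p ` K) = UNIV"
  proof (intro exI conjI)
    define K :: "(real^4) set" where "K = cball 0 (\<bar>\<alpha>\<bar> + \<bar>\<beta>\<bar> + \<bar>\<gamma>\<bar> + 1)"
    show "compact K" by (simp add: K_def)
    have frac: "\<bar>x - of_int \<lfloor>x / c\<rfloor> * c\<bar> \<le> \<bar>c\<bar>" if "c \<noteq> 0" for x c :: real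
    proof -
      have "\<bar>x - of_int \<lfloor>x / c\<rfloor> * c\<bar> = \<bar>x / c - of_int \<lfloor>x / c\<rfloor>\<bar> * \<bar>c\<bar>"
        unfolding abs_mult[symmetric] left_diff_distrib using that by simp
      also have "\<dots> \<le> 1 * \<bar>c\<bar>" by (intro mult_right_mono) linarith+
      finally show ?thesis by simp
    qed
    have "w \<in> (\<Union>p\<in>?\<Gamma>. nmul p ` K)" for w
    proof -
      define k l n where "k = \<lfloor>w$1 / \<alpha>\<rfloor>" and "l = \<lfloor>w$2 / \<beta>\<rfloor>" and "n = \<lfloor>w$4 / 1\<rfloor>"
      \<comment> \<open>the third coordinate of \<open>g\<^sup>-\<^sup>1 w\<close>, apart from the contribution of the third coordinate of \<open>g\<close>\<close>
      define t where "t = w$3 - (k * \<alpha> * w$2 - l * \<beta> * w$1) / 2"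
      define m where "m = \<lfloor>t / \<gamma>\<rfloor>"
      define g :: "real^4" where "g = (\<chi> i. if i = 1 then k * \<alpha> else if i = 2 then l * \<beta> else if i = 3 then m * \<gamma> else n)"
      define q where "q = nmul (ninv g) w"
      have gn: "g$1 = k * \<alpha>" "g$2 = l * \<beta>" "g$3 = m * \<gamma>" "g$4 = n"
        by (simp_all add: g_def)
      have "g \<in> ?\<Gamma>" unfolding int_span4_axis_iff using gn by blast
      moreover have "nmul g q = w"
        by (simp add: q_def vec4_eq_iff nmul_nth ninv_def field_simps)
      moreover have "q \<in> K"
      proof -
        have "\<bar>q$1\<bar> \<le> \<bar>\<alpha>\<bar>" using frac[OF nz(1), of "w$1"]
          by (simp add: q_def nmul_nth ninv_def gn k_def)
        moreover have "\<bar>q$2\<bar> \<le> \<bar>\<beta>\<bar>" using frac[OF nz(2), of "w$2"]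
          by (simp add: q_def nmul_nth ninv_def gn l_def)
        moreover have "q$3 = t - m * \<gamma>"
          by (simp add: q_def nmul_nth ninv_def gn t_def field_simps)
        then have "\<bar>q$3\<bar> \<le> \<bar>\<gamma>\<bar>" using frac[OF nz(3), of t] by (simp add: m_def)
        moreover have "\<bar>q$4\<bar> \<le> 1" using frac[of 1 "w$4"]
          by (simp add: q_def nmul_nth ninv_def gn n_def)
        ultimately have "norm q \<le> \<bar>\<alpha>\<bar> + \<bar>\<beta>\<bar> + \<bar>\<gamma>\<bar> + 1"
          using norm_le_l1_cart[of q] by (simp add: sum_4)
        then show ?thesis by (simp add: K_def)
      qed
      ultimately show ?thesis by blast
    qed
    then show "(\<Union>p\<in>?\<Gamma>. nmul p ` K) = UNIV" by blast
  qed
  show ?thesis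
    unfolding lattice_in_N_def using 0 sub disc cocomp by blast
qed

lemma lattice_in_N_zero: "lattice_in_N \<Gamma> \<Longrightarrow> 0 \<in> \<Gamma>"
  by (simp add: lattice_in_N_def)

lemma ltrans_zero: "ltrans 0 x = x"
  by (cases x) (simp add: ltrans_eq vec4_eq_iff bracket_nth nmul_nth)

lemma descend_covproj:
  assumes "0 \<in> \<Gamma>" "invariant \<Gamma> f"
  shows "descend \<Gamma> f \<circ> covproj \<Gamma> = f"
proof
  fix x
  have "f ` covproj \<Gamma> x = {f x}"
  proof (rule set_eqI, rule iffI)
    fix z assume "z \<in> f ` covproj \<Gamma> x"
    then obtain g where "g \<in> \<Gamma>" "z = f (ltrans g x)" by (auto simp only: covproj_def image_iff)
    then show "z \<in> {f x}" using assms(2) by (simp only: invariant_def) blast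
  next
    fix z assume "z \<in> {f x}"
    then have "z = f (ltrans 0 x)" by (simp add: ltrans_zero)
    then show "z \<in> f ` covproj \<Gamma> x" using assms(1) unfolding covproj_def by blast
  qed
  then show "(descend \<Gamma> f \<circ> covproj \<Gamma>) x = f x" by (simp add: descend_def)
qed

lemma descend_covproj_apply:
  "0 \<in> \<Gamma> \<Longrightarrow> invariant \<Gamma> f \<Longrightarrow> descend \<Gamma> f (covproj \<Gamma> x) = f x"
  using descend_covproj[of \<Gamma> f] by (metis comp_apply)

lemma invariant_energy: "invariant \<Gamma> energy"
  by (simp add: invariant_def energy_ltrans)

lemma covproj_vimage_TM: "covproj \<Gamma> -` TM \<Gamma> = UNIV"
  by (auto simp: TM_def)

lemma covproj_vimage_energy_level:
  "0 \<in> \<Gamma> \<Longrightarrow> covproj \<Gamma> -` energy_level \<Gamma> h = {x. energy x = h}"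
  by (auto simp: energy_level_def descend_covproj_apply invariant_energy TM_def)

lemma openin_TM_topology: "openin (TM_topology \<Gamma>) U \<longleftrightarrow> U \<subseteq> TM \<Gamma> \<and> open (covproj \<Gamma> -` U)"
proof -
  have "istopology (\<lambda>U. U \<subseteq> TM \<Gamma> \<and> open (covproj \<Gamma> -` U))"
    unfolding istopology_def by (auto simp: vimage_Union vimage_Int)
  then show ?thesis by (simp add: TM_topology_def topology_inverse')
qed

lemma topspace_TM_topology: "topspace (TM_topology \<Gamma>) = TM \<Gamma>"
proof
  show "topspace (TM_topology \<Gamma>) \<subseteq> TM \<Gamma>"
    using openin_topspace[of "TM_topology \<Gamma>"] unfolding openin_TM_topology by blast
  have "openin (TM_topology \<Gamma>) (TM \<Gamma>)"
    by (simp add: openin_TM_topology covproj_vimage_TM)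
  then show "TM \<Gamma> \<subseteq> topspace (TM_topology \<Gamma>)" by (rule openin_subset)
qed

text \<open>A neighbourhood in the quotient is tested on its preimage, so density may be checked in the
  covering space.\<close>
lemma dense_in_quotient:
  assumes "S \<subseteq> TM \<Gamma>"
    and dense: "\<And>x U. covproj \<Gamma> x \<in> S \<Longrightarrow> open U \<Longrightarrow> x \<in> U \<Longrightarrow> \<exists>y\<in>U. covproj \<Gamma> y \<in> S \<and> y \<in> G"
  shows "S \<subseteq> TM_topology \<Gamma> closure_of (S \<inter> covproj \<Gamma> ` G)"
proof
  fix Q assume Q: "Q \<in> S"
  then obtain x where x: "Q = covproj \<Gamma> x" using assms(1) by (auto simp: TM_def)
  show "Q \<in> TM_topology \<Gamma> closure_of (S \<inter> covproj \<Gamma> ` G)"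
    unfolding in_closure_of topspace_TM_topology openin_TM_topology
  proof (intro conjI allI impI)
    show "Q \<in> TM \<Gamma>" using Q assms(1) by blast
    fix T assume T: "Q \<in> T \<and> T \<subseteq> TM \<Gamma> \<and> open (covproj \<Gamma> -` T)"
    then obtain y where "y \<in> covproj \<Gamma> -` T" "covproj \<Gamma> y \<in> S" "y \<in> G"
      using dense[of x "covproj \<Gamma> -` T"] Q x by auto
    then show "\<exists>y. y \<in> S \<inter> covproj \<Gamma> ` G \<and> y \<in> T" by blast
  qed
qed

section \<open>Smooth functions\<close>

text \<open>The building block is \<open>exp (-1/s\<^sup>2) s\<^sup>-\<^sup>n sin (q/s + \<theta>)\<close>, continued by \<open>0\<close>. The exponent \<open>n\<close> and the
  phase \<open>\<theta>\<close> are there to make the family closed under differentiation.\<close>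
definition flat :: "nat \<Rightarrow> real \<Rightarrow> real \<Rightarrow> real \<Rightarrow> real" where
  "flat n \<theta> q s = (if s = 0 then 0 else exp (- 1 / s^2) / s^n * sin (q / s + \<theta>))"

text \<open>With \<open>y = 1/\<bar>s\<bar>\<close> this is \<open>y\<^sup>n \<le> n! exp (y\<^sup>2)\<close>: for \<open>y > 1\<close> the left side is at most \<open>(y\<^sup>2)\<^sup>n\<close>, and
  one term of the exponential series suffices.\<close>
lemma exp_inverse_square_le:
  fixes s :: real
  assumes "s \<noteq> 0"
  shows "exp (- 1 / s^2) \<le> fact n * \<bar>s\<bar>^n"
proof -
  define y where "y = 1 / \<bar>s\<bar>"
  have y: "y > 0" "y^2 = 1 / s^2" "\<bar>s\<bar> = 1 / y"
    using assms by (auto simp: y_def power_divide)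
  have "y^n \<le> fact n * exp (y^2)"
  proof (cases "y \<le> 1")
    case True
    then have "y^n \<le> 1 * 1" using y(1) by (simp add: power_le_one)
    also have "\<dots> \<le> fact n * exp (y^2)"
      by (intro mult_mono) (auto simp: fact_ge_1)
    finally show ?thesis .
  next
    case False
    then have "y^n \<le> y^(2*n)" by (intro power_increasing) auto
    also have "\<dots> = fact n * ((y^2)^n / fact n)" by (simp add: power_mult)
    also have "(y^2)^n / fact n \<le> exp (y^2)"
    proof -
      have "(\<Sum>k\<in>{n}. (y^2)^k /\<^sub>R fact k) \<le> (\<Sum>k. (y^2)^k /\<^sub>R fact k)"
        by (rule sum_le_suminf[OF summable_exp_generic]) auto
      then show ?thesis by (simp add: exp_def divide_inverse mult.commute)
    qed
    finally show ?thesis by simp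
  qed
  then have "1 / exp (y^2) \<le> fact n * (1 / y^n)"
    using y(1) by (simp add: field_simps)
  then show ?thesis
    using y by (simp add: exp_minus power_divide inverse_eq_divide)
qed

lemma abs_flat_le: "\<bar>flat n \<theta> q s\<bar> \<le> fact (n + 2) * s^2"
proof (cases "s = 0")
  case False
  have "\<bar>flat n \<theta> q s\<bar> = exp (- 1 / s^2) / \<bar>s\<bar>^n * \<bar>sin (q / s + \<theta>)\<bar>"
    using False by (simp add: flat_def abs_mult power_abs)
  also have "\<dots> \<le> exp (- 1 / s^2) / \<bar>s\<bar>^n * 1"
    by (intro mult_left_mono) auto
  also have "\<dots> = exp (- 1 / s^2) / \<bar>s\<bar>^n" by simp
  also have "\<dots> \<le> (fact (n + 2) * \<bar>s\<bar>^(n + 2)) / \<bar>s\<bar>^n"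
    by (intro divide_right_mono exp_inverse_square_le[OF False]) simp
  also have "\<dots> = fact (n + 2) * s^2"
    using False by (simp add: power_add power2_eq_square)
  finally show ?thesis .
qed (simp add: flat_def)

text \<open>Applied to the flat functions at points where \<open>s\<close> vanishes, where no differentiation rule
  is available.\<close>
lemma has_derivative_quadratic_bound:
  fixes g :: "'a::real_normed_vector \<Rightarrow> real"
  assumes le: "\<And>y. \<bar>g y\<bar> \<le> C * (s y)^2" and s: "(s has_derivative s') (at x)" and "s x = 0"
  shows "(g has_derivative (\<lambda>_. 0)) (at x)"
proof -
  obtain B e where B: "e > 0" "B > 0" "\<And>y. norm (y - x) < e \<Longrightarrow> \<bar>s y\<bar> \<le> B * norm (y - x)"
  proof -
    have bl: "bounded_linear s'" using s by (rule has_derivative_bounded_linear)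
    obtain K where K: "K > 0" "\<And>v. norm (s' v) \<le> norm v * K"
      using bounded_linear.pos_bounded[OF bl] by blast
    obtain d where d: "d > 0" "\<And>y. norm (y - x) < d \<Longrightarrow> norm (s y - s x - s' (y - x)) \<le> 1 * norm (y - x)"
      using s unfolding has_derivative_at_alt by (meson zero_less_one)
    show ?thesis
    proof (rule that[OF d(1)])
      show "K + 1 > 0" using K by simp
      fix y assume "norm (y - x) < d"
      then have "norm (s y) \<le> norm (y - x) + norm (s' (y - x))"
        using d(2)[of y] \<open>s x = 0\<close> norm_triangle_ineq4[of "s y" "s' (y-x)"]
        by (smt (verit) real_norm_def mult_1)
      also have "\<dots> \<le> (K + 1) * norm (y - x)" using K(2)[of "y - x"] by (simp add: algebra_simps)
      finally show "\<bar>s y\<bar> \<le> (K + 1) * norm (y - x)" by simp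
    qed
  qed
  have C: "C * (s y)^2 \<ge> 0" for y using le[of y] by linarith
  have gx: "g x = 0" using le[of x] \<open>s x = 0\<close> by simp
  show ?thesis
    unfolding has_derivative_at_alt
  proof (intro conjI allI impI)
    fix \<epsilon> :: real assume "\<epsilon> > 0"
    define d where "d = min e (\<epsilon> / (\<bar>C\<bar> * B^2 + 1))"
    have pos: "\<bar>C\<bar> * B^2 + 1 > 0" by (simp add: add_nonneg_pos)
    show "\<exists>d>0. \<forall>y. norm (y - x) < d \<longrightarrow> norm (g y - g x - 0) \<le> \<epsilon> * norm (y - x)"
    proof (intro exI conjI allI impI)
      show "d > 0" using B \<open>\<epsilon> > 0\<close> pos by (simp add: d_def)
      fix y assume y: "norm (y - x) < d"
      have "(s y)^2 \<le> (B * norm (y - x))^2"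
        using B(2) B(3)[of y] y by (intro abs_le_square_iff[THEN iffD1]) (auto simp: d_def abs_mult)
      then have "\<bar>g y\<bar> \<le> \<bar>C\<bar> * (B * norm (y - x))^2"
        using le[of y] by (smt (verit) mult_mono' zero_le_power2 mult_right_mono abs_ge_self)
      also have "\<dots> = (\<bar>C\<bar> * B^2) * norm (y - x) * norm (y - x)"
        by (simp add: power2_eq_square algebra_simps)
      also have "\<dots> \<le> \<epsilon> * norm (y - x)"
      proof (rule mult_right_mono)
        have "(\<bar>C\<bar> * B^2) * norm (y - x) \<le> (\<bar>C\<bar> * B^2 + 1) * (\<epsilon> / (\<bar>C\<bar> * B^2 + 1))"
          using y by (intro mult_mono) (auto simp: d_def)
        then show "(\<bar>C\<bar> * B^2) * norm (y - x) \<le> \<epsilon>" using pos by simp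
      qed simp
      finally show "norm (g y - g x - 0) \<le> \<epsilon> * norm (y - x)" using gx by simp
    qed
  qed simp
qed

lemma flat_has_derivative:
  fixes q s :: "'a::real_normed_vector \<Rightarrow> real"
  assumes q: "(q has_derivative q') (at x)" and s: "(s has_derivative s') (at x)"
  shows "((\<lambda>x. flat n \<theta> (q x) (s x)) has_derivative
    (\<lambda>v. flat (n + 1) (\<theta> + pi / 2) (q x) (s x) * q' v
       + 2 * flat (n + 3) \<theta> (q x) (s x) * s' v
       - n * flat (n + 1) \<theta> (q x) (s x) * s' v
       - flat (n + 2) (\<theta> + pi / 2) (q x) (s x) * q x * s' v)) (at x)"
proof (cases "s x = 0")
  case True
  have "((\<lambda>x. flat n \<theta> (q x) (s x)) has_derivative (\<lambda>_. 0)) (at x)"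
    by (rule has_derivative_quadratic_bound[OF _ s True]) (rule abs_flat_le)
  then show ?thesis using True by (simp add: flat_def)
next
  case False
  \<comment> \<open>In terms of \<open>1/s\<close> everything is polynomial apart from \<open>exp\<close> and \<open>sin\<close>.\<close>
  define i where "i y = inverse (s y)" for y
  have i: "(i has_derivative (\<lambda>v. - ((i x)^2 * s' v))) (at x)"
    unfolding i_def[abs_def]
    using False by (auto intro!: derivative_eq_intros s simp: fun_eq_iff power2_eq_square)
  have flat_i: "flat k \<alpha> (q y) (s y) = exp (- ((i y)^2)) * (i y)^k * sin (q y * i y + \<alpha>)"
    if "s y \<noteq> 0" for k \<alpha> y
    using that by (simp add: flat_def i_def power_inverse divide_inverse)
  have phase: "sin (\<alpha> + (\<theta> + pi / 2)) = cos (\<alpha> + \<theta>)" for \<alpha> :: real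
    by (simp add: add.assoc[symmetric] sin_add)
  have "((\<lambda>y. exp (- ((i y)^2)) * (i y)^n * sin (q y * i y + \<theta>)) has_derivative
    (\<lambda>v. (exp (- ((i x)^2)) * (i x)^n) * (cos (q x * i x + \<theta>) * (q' v * i x + q x * (- ((i x)^2 * s' v))))
      + (exp (- ((i x)^2)) * (of_nat n * (i x)^(n - 1) * (- ((i x)^2 * s' v)))
      + exp (- ((i x)^2)) * (- (2 * i x * (- ((i x)^2 * s' v)))) * (i x)^n) * sin (q x * i x + \<theta>))) (at x)"
    by (auto intro!: derivative_eq_intros i q simp: fun_eq_iff algebra_simps)
  then have "((\<lambda>y. exp (- ((i y)^2)) * (i y)^n * sin (q y * i y + \<theta>)) has_derivative
    (\<lambda>v. flat (n + 1) (\<theta> + pi / 2) (q x) (s x) * q' v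
       + 2 * flat (n + 3) \<theta> (q x) (s x) * s' v
       - n * flat (n + 1) \<theta> (q x) (s x) * s' v
       - flat (n + 2) (\<theta> + pi / 2) (q x) (s x) * q x * s' v)) (at x)"
    by (elim has_derivative_eq_rhs; intro ext; unfold flat_i[OF False] phase; cases n)
      (simp_all add: algebra_simps power_add power2_eq_square power3_eq_cube
        power4_eq_xxxx)
  moreover have "\<forall>\<^sub>F y in at x. exp (- ((i y)^2)) * (i y)^n * sin (q y * i y + \<theta>)
      = flat n \<theta> (q y) (s y)"
  proof -
    have "(s \<longlongrightarrow> s x) (at x)"
      using has_derivative_continuous[OF s] by (simp add: continuous_at)
    then have "\<forall>\<^sub>F y in at x. s y \<noteq> 0"
      using False by (rule tendsto_imp_eventually_ne)
    then show ?thesis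
      by eventually_elim (simp add: flat_i)
  qed
  ultimately show ?thesis
    by (rule has_derivative_transform_eventually) (simp_all add: flat_i[OF False])
qed

text \<open>A class of functions that contains every first integral occurring below and is visibly stable
  under directional derivatives; the cosine is a shifted sine.\<close>
inductive elementary :: "('a::real_normed_vector \<Rightarrow> real) \<Rightarrow> bool" where
  const: "elementary (\<lambda>_. c)"
| linear: "bounded_linear f \<Longrightarrow> elementary f"
| add: "elementary f \<Longrightarrow> elementary g \<Longrightarrow> elementary (\<lambda>x. f x + g x)"
| mult: "elementary f \<Longrightarrow> elementary g \<Longrightarrow> elementary (\<lambda>x. f x * g x)"
| sin: "elementary f \<Longrightarrow> elementary (\<lambda>x. sin (f x))"
| flat: "elementary q \<Longrightarrow> elementary s \<Longrightarrow> elementary (\<lambda>x. flat n \<theta> (q x) (s x))"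

lemma elementary_cmult: "elementary f \<Longrightarrow> elementary (\<lambda>x. c * f x)"
  by (rule elementary.mult[OF elementary.const])

lemma elementary_minus: "elementary f \<Longrightarrow> elementary (\<lambda>x. - f x)"
  using elementary_cmult[of f "-1"] by simp

lemma elementary_diff: "elementary f \<Longrightarrow> elementary g \<Longrightarrow> elementary (\<lambda>x. f x - g x)"
  using elementary.add[OF _ elementary_minus, of f g] by simp

lemma elementary_power: "elementary f \<Longrightarrow> elementary (\<lambda>x. f x ^ n)"
  by (induction n) (auto intro: elementary.const elementary.mult)

lemma elementary_cos: "elementary f \<Longrightarrow> elementary (\<lambda>x. cos (f x))"
  using elementary.sin[OF elementary.add[OF _ elementary.const], of f "pi/2"]
  by (simp add: sin_add)

lemmas elementary_intros = elementary.intros(1,3-6) elementary_cmult elementary_minus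
  elementary_diff elementary_power elementary_cos

lemma elementary_derivative:
  assumes "elementary f"
  shows "\<exists>f'. (\<forall>x. (f has_derivative f' x) (at x)) \<and> (\<forall>v. elementary (\<lambda>x. f' x v))"
  using assms
proof induction
  case (const c)
  show ?case by (rule exI[of _ "\<lambda>_ _. 0"]) (auto intro: elementary.const)
next
  case (linear f)
  show ?case
    by (rule exI[of _ "\<lambda>_. f"])
      (auto intro: elementary.const bounded_linear_imp_has_derivative linear)
next
  case (add f g)
  then obtain f' g' where
    "\<forall>x. (f has_derivative f' x) (at x)" "\<forall>v. elementary (\<lambda>x. f' x v)"
    "\<forall>x. (g has_derivative g' x) (at x)" "\<forall>v. elementary (\<lambda>x. g' x v)" by blast
  then show ?case
    by (intro exI[of _ "\<lambda>x v. f' x v + g' x v"])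
      (auto intro!: derivative_eq_intros elementary_intros)
next
  case (mult f g)
  then obtain f' g' where
    "\<forall>x. (f has_derivative f' x) (at x)" "\<forall>v. elementary (\<lambda>x. f' x v)"
    "\<forall>x. (g has_derivative g' x) (at x)" "\<forall>v. elementary (\<lambda>x. g' x v)" by blast
  with mult.hyps show ?case
    by (intro exI[of _ "\<lambda>x v. f x * g' x v + f' x v * g x"])
      (auto intro!: has_derivative_mult elementary.add elementary.mult)
next
  case (sin f)
  then obtain f' where
    "\<forall>x. (f has_derivative f' x) (at x)" "\<forall>v. elementary (\<lambda>x. f' x v)" by blast
  with sin.hyps show ?case
    by (intro exI[of _ "\<lambda>x v. cos (f x) * f' x v"])
      (auto intro!: derivative_eq_intros elementary.mult elementary_cos)
next
  case (flat q s n \<theta>)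
  then obtain q' s' where
    *: "\<forall>x. (q has_derivative q' x) (at x)" "\<forall>v. elementary (\<lambda>x. q' x v)"
    "\<forall>x. (s has_derivative s' x) (at x)" "\<forall>v. elementary (\<lambda>x. s' x v)" by blast
  show ?case
  proof (intro exI conjI allI)
    fix x
    show "((\<lambda>x. flat n \<theta> (q x) (s x)) has_derivative
      (\<lambda>v. flat (n + 1) (\<theta> + pi / 2) (q x) (s x) * q' x v
         + 2 * flat (n + 3) \<theta> (q x) (s x) * s' x v
         - n * flat (n + 1) \<theta> (q x) (s x) * s' x v
         - flat (n + 2) (\<theta> + pi / 2) (q x) (s x) * q x * s' x v)) (at x)"
      using * by (intro flat_has_derivative) auto
  next
    fix v
    show "elementary (\<lambda>x. flat (n + 1) (\<theta> + pi / 2) (q x) (s x) * q' x v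
         + 2 * flat (n + 3) \<theta> (q x) (s x) * s' x v
         - n * flat (n + 1) \<theta> (q x) (s x) * s' x v
         - flat (n + 2) (\<theta> + pi / 2) (q x) (s x) * q x * s' x v)"
      by (intro elementary_diff elementary.add elementary.mult elementary_cmult elementary.const
          elementary.flat flat.hyps *(2)[rule_format] *(4)[rule_format])
  qed
qed

lemma elementary_differentiable: "elementary f \<Longrightarrow> f differentiable (at x)"
  using elementary_derivative[of f] unfolding differentiable_def by blast

lemma smooth_elementary:
  assumes "elementary f" shows "smooth f"
proof -
  have "Ck k f" if "elementary f" for k and f :: "'a \<Rightarrow> real"
    using that
  proof (induction k arbitrary: f)
    case 0
    then show ?case
      by (auto simp: continuous_on_eq_continuous_at intro: differentiable_imp_continuous_within
          elementary_differentiable)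
  next
    case (Suc k)
    obtain f' where f': "\<And>x. (f has_derivative f' x) (at x)" "\<And>v. elementary (\<lambda>x. f' x v)"
      using elementary_derivative[OF Suc.prems] by blast
    have "frechet_derivative f (at x) = f' x" for x
      using frechet_derivative_at[OF f'(1)] by simp
    then show ?case
      using Suc f'(2) by (auto intro: elementary_differentiable)
  qed
  then show ?thesis using assms by (simp add: smooth_def)
qed

section \<open>Magnetic geodesics\<close>

lemmas has_derivative_vec_nth = bounded_linear.has_derivative[OF bounded_linear_vec_nth]

lemma mag_form_nth:
  "mag_form a b c \<rho> X Y = a * (X$1 * Y$3 - X$3 * Y$1) + b * (X$2 * Y$3 - X$3 * Y$2)
     + c * (X$1 * Y$4 - X$4 * Y$1) + \<rho> * (X$1 * Y$2 - X$2 * Y$1)"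
  by (simp add: mag_form_def wedge_def)

lemma lorentz_nth:
  "lorentz (mag_form a b c \<rho>) X $ 1 = - a * X$3 - c * X$4 - \<rho> * X$2"
  "lorentz (mag_form a b c \<rho>) X $ 2 = \<rho> * X$1 - b * X$3"
  "lorentz (mag_form a b c \<rho>) X $ 3 = a * X$1 + b * X$2"
  "lorentz (mag_form a b c \<rho>) X $ 4 = c * X$1"
proof -
  let ?\<omega> = "mag_form a b c \<rho>"
  define Z :: "real^4" where "Z = (\<chi> i. ?\<omega> X (basis4 i))"
  have Z: "Z$1 = - a * X$3 - c * X$4 - \<rho> * X$2" "Z$2 = \<rho> * X$1 - b * X$3"
    "Z$3 = a * X$1 + b * X$2" "Z$4 = c * X$1"
    by (simp_all add: Z_def mag_form_nth axis_def)
  have "lorentz ?\<omega> X = Z"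
    unfolding lorentz_def
  proof (rule the_equality)
    show "\<forall>Y. Z \<bullet> Y = ?\<omega> X Y"
      unfolding inner4 mag_form_nth Z by (simp add: algebra_simps)
    fix Z' assume "\<forall>Y. Z' \<bullet> Y = ?\<omega> X Y"
    then show "Z' = Z"
      by (metis (no_types, lifting) Z_def inner_axis mult_1_right real_inner_1_right vec_eq_iff vec_lambda_beta)
  qed
  with Z show "lorentz ?\<omega> X $ 1 = - a * X$3 - c * X$4 - \<rho> * X$2"
    "lorentz ?\<omega> X $ 2 = \<rho> * X$1 - b * X$3"
    "lorentz ?\<omega> X $ 3 = a * X$1 + b * X$2" "lorentz ?\<omega> X $ 4 = c * X$1" by simp_all
qed

text \<open>The components of the covector \<open>\<alpha>\<close> with \<open>to_alg p u = u + \<alpha>(u) e\<^sub>3\<close>. The metric is the Euclidean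
  one corrected by terms in \<open>\<alpha>\<close>, and \<open>\<alpha>\<close> is linear in \<open>p\<close>; this yields all first derivatives of the
  metric.\<close>
definition drift :: "real^4 \<Rightarrow> 4 \<Rightarrow> real" where
  "drift p i = (if i = 1 then p$2 / 2 else if i = 2 then - p$1 / 2 else 0)"

lemma gram_nth:
  "gram p $ i $ j = (if i = j then 1 else 0) + (if j = 3 then drift p i else 0)
     + (if i = 3 then drift p j else 0) + drift p i * drift p j"
  using exhaust_4[of i] exhaust_4[of j]
  by (auto simp: gram_def metric_def inner4 to_alg_nth drift_def axis_def field_simps)

lemma dgram_nth:
  "dgram p k i j = (if j = 3 then drift (basis4 k) i else 0) + (if i = 3 then drift (basis4 k) j else 0)
     + drift (basis4 k) i * drift p j + drift p i * drift (basis4 k) j"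
proof -
  have d: "((\<lambda>q. drift q i) has_derivative (\<lambda>v. drift v i)) (at p)" for i
  proof -
    have "((\<lambda>q::real^4. q $ 2 / 2) has_derivative (\<lambda>v. v $ 2 / 2)) (at p)"
      "((\<lambda>q::real^4. - q $ 1 / 2) has_derivative (\<lambda>v. - v $ 1 / 2)) (at p)"
      by (auto intro!: derivative_eq_intros has_derivative_vec_nth)
    then show ?thesis
      by (cases "i = 1"; cases "i = 2") (simp_all add: drift_def)
  qed
  have c: "((\<lambda>q. if P then drift q i else 0) has_derivative (\<lambda>v. if P then drift v i else 0)) (at p)"
    for i and P :: bool
    using d[of i] by (cases P) auto
  have "((\<lambda>q. gram q $ i $ j) has_derivative (\<lambda>v. (if j = 3 then drift v i else 0)
      + (if i = 3 then drift v j else 0) + drift v i * drift p j + drift p i * drift v j)) (at p)"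
    unfolding gram_nth
    by (rule has_derivative_eq_rhs, (rule has_derivative_add has_derivative_mult has_derivative_const c d)+)
      (auto simp: fun_eq_iff)
  from frechet_derivative_at[OF this] show ?thesis
    by (simp add: dgram_def fun_eq_iff)
qed

text \<open>The metric is positive definite because \<open>to_alg p\<close> is injective.\<close>
lemma gram_inverse: "gram p ** matrix_inv (gram p) = mat 1"
proof -
  have "x = 0" if "gram p *v x = 0" for x
  proof -
    have "to_alg p x \<bullet> to_alg p x = x \<bullet> (gram p *v x)"
      by (simp add: inner4 to_alg_nth matrix_vector_mult_def sum_4 gram_nth drift_def field_simps)
    then have "to_alg p x = 0" using that by simp
    then have "of_alg p (to_alg p x) = of_alg p 0" by simp
    then show "x = 0" by (simp add: vec4_eq_iff of_alg_nth)
  qed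
  then have "invertible (gram p)"
    by (metis invertible_left_inverse matrix_left_invertible_ker)
  then show ?thesis
    unfolding invertible_def matrix_inv_def
    by (metis (mono_tags, lifting) someI_ex)
qed

text \<open>The Christoffel symbols contain the inverse metric. Multiplied by the metric they become
  polynomials in the coordinates, so the geodesic equation is used with its index lowered.\<close>
lemma gram_christoffel:
  "(\<Sum>k\<in>UNIV. gram p $ m $ k * (\<Sum>i\<in>UNIV. \<Sum>j\<in>UNIV. christoffel p k i j * u$i * u$j)) =
    (\<Sum>i\<in>UNIV. \<Sum>j\<in>UNIV. 1/2 * (dgram p i j m + dgram p j i m - dgram p m i j) * u$i * u$j)"
proof -
  have inv: "(\<Sum>k\<in>UNIV. gram p $ m $ k * matrix_inv (gram p) $ k $ l) = (if m = l then 1 else 0)" for l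
    using arg_cong[OF gram_inverse[of p], of "\<lambda>A. A $ m $ l"]
    by (simp add: matrix_matrix_mult_def mat_def)
  have "(\<Sum>k\<in>UNIV. gram p $ m $ k * christoffel p k i j) =
      1/2 * (dgram p i j m + dgram p j i m - dgram p m i j)" for i j
  proof -
    have "(\<Sum>k\<in>UNIV. gram p $ m $ k * christoffel p k i j) =
        (\<Sum>l\<in>UNIV. \<Sum>k\<in>UNIV. gram p $ m $ k * matrix_inv (gram p) $ k $ l
           * (1/2 * (dgram p i j l + dgram p j i l - dgram p l i j)))"
      by (subst sum.swap) (simp add: christoffel_def sum_distrib_left mult_ac)
    also have "\<dots> = (\<Sum>l\<in>UNIV. (if m = l then 1 else 0) * (1/2 * (dgram p i j l + dgram p j i l - dgram p l i j)))"
      by (simp only: sum_distrib_right[symmetric] inv)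
    finally show ?thesis by (simp add: if_distrib if_distribR cong: if_cong)
  qed
  note * = this
  have "(\<Sum>k\<in>UNIV. gram p $ m $ k * (\<Sum>i\<in>UNIV. \<Sum>j\<in>UNIV. christoffel p k i j * u$i * u$j)) =
    (\<Sum>i\<in>UNIV. \<Sum>j\<in>UNIV. \<Sum>k\<in>UNIV. gram p $ m $ k * christoffel p k i j * u$i * u$j)"
    by (subst sum.swap, subst (2) sum.swap) (simp add: sum_distrib_left mult_ac)
  also have "\<dots> = (\<Sum>i\<in>UNIV. \<Sum>j\<in>UNIV. (\<Sum>k\<in>UNIV. gram p $ m $ k * christoffel p k i j) * u$i * u$j)"
    by (simp only: sum_distrib_right)
  finally show ?thesis unfolding * .
qed

text \<open>\<open>A\<close> stands for the second derivative of the curve. This is the Euler equation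
  \<open>V' = (ad V)\<^sup>T V + F V\<close> on the Lie algebra, where \<open>(ad V)\<^sup>T V = (- V\<^sub>2 V\<^sub>3, V\<^sub>1 V\<^sub>3, 0, 0)\<close>. In the third line the
  left side is the derivative of \<open>V\<^sub>3\<close>, as the terms with products of velocities cancel.\<close>
lemma magnetic_equation_in_frame:
  fixes p u A :: "real^4"
  defines "V \<equiv> to_alg p u"
  assumes eq: "A + (\<chi> k. \<Sum>i\<in>UNIV. \<Sum>j\<in>UNIV. christoffel p k i j * u$i * u$j)
      = lorentz_at (mag_form a b c \<rho>) p u"
  shows "A$1 = - V$2 * V$3 - a * V$3 - c * V$4 - \<rho> * V$2"
    "A$2 = V$1 * V$3 + \<rho> * V$1 - b * V$3"
    "A$3 - (p$1 * A$2 - p$2 * A$1) / 2 = a * V$1 + b * V$2"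
    "A$4 = c * V$1"
proof -
  let ?F = "lorentz (mag_form a b c \<rho>) V"
  have rhs: "lorentz_at (mag_form a b c \<rho>) p u = of_alg p ?F"
    by (simp add: lorentz_at_def ltrans_eq of_alg_def V_def)
  have low: "(\<Sum>k\<in>UNIV. gram p $ m $ k * A $ k) +
      (\<Sum>i\<in>UNIV. \<Sum>j\<in>UNIV. 1/2 * (dgram p i j m + dgram p j i m - dgram p m i j) * u$i * u$j)
     = (\<Sum>k\<in>UNIV. gram p $ m $ k * of_alg p ?F $ k)" for m
    unfolding gram_christoffel[symmetric] sum.distrib[symmetric]
    by (simp add: rhs[symmetric] eq[symmetric] distrib_left)
  have V: "u$1 = V$1" "u$2 = V$2" "u$4 = V$4" "u$3 = V$3 + (p$1 * V$2 - p$2 * V$1) / 2"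
    by (simp_all add: V_def to_alg_nth)
  have 3: "A$3 - (p$1 * A$2 - p$2 * A$1) / 2 = ?F$3"
    using low[of 3]
    by (simp add: sum_4 gram_nth dgram_nth drift_def axis_def of_alg_nth V field_simps)
  have 4: "A$4 = ?F$4"
    using low[of 4]
    by (simp add: sum_4 gram_nth dgram_nth drift_def axis_def of_alg_nth V algebra_simps)
  have A3: "A$3 = ?F$3 + (p$1 * A$2 - p$2 * A$1) / 2" using 3 by simp
  have 1: "A$1 = - V$2 * V$3 + ?F$1"
    using low[of 1]
    by (simp add: sum_4 gram_nth dgram_nth drift_def axis_def of_alg_nth V A3 field_simps)
  have 2: "A$2 = V$1 * V$3 + ?F$2"
    using low[of 2]
    by (simp add: sum_4 gram_nth dgram_nth drift_def axis_def of_alg_nth V A3 field_simps)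
  show "A$1 = - V$2 * V$3 - a * V$3 - c * V$4 - \<rho> * V$2"
    "A$2 = V$1 * V$3 + \<rho> * V$1 - b * V$3"
    "A$3 - (p$1 * A$2 - p$2 * A$1) / 2 = a * V$1 + b * V$2"
    "A$4 = c * V$1"
    using 1 2 3 4 by (simp_all add: lorentz_nth)
qed

lemma magnetic_geodesic_derivatives:
  fixes \<gamma> :: "real \<Rightarrow> real^4"
  defines "V \<equiv> \<lambda>t. to_alg (\<gamma> t) (velocity \<gamma> t)"
  assumes "magnetic_geodesic (mag_form a b c \<rho>) J \<gamma>" "t \<in> J"
  shows "((\<lambda>t. \<gamma> t $ 1) has_real_derivative V t $ 1) (at t)"
    "((\<lambda>t. \<gamma> t $ 2) has_real_derivative V t $ 2) (at t)"
    "((\<lambda>t. V t $ 1) has_real_derivative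
       - V t $ 2 * V t $ 3 - a * V t $ 3 - c * V t $ 4 - \<rho> * V t $ 2) (at t)"
    "((\<lambda>t. V t $ 2) has_real_derivative V t $ 1 * V t $ 3 + \<rho> * V t $ 1 - b * V t $ 3) (at t)"
    "((\<lambda>t. V t $ 3) has_real_derivative a * V t $ 1 + b * V t $ 2) (at t)"
    "((\<lambda>t. V t $ 4) has_real_derivative c * V t $ 1) (at t)"
proof -
  define A where "A = vector_derivative (velocity \<gamma>) (at t)"
  have \<gamma>': "(\<gamma> has_vector_derivative velocity \<gamma> t) (at t)"
    and u': "(velocity \<gamma> has_vector_derivative A) (at t)"
    and eq: "cov_accel \<gamma> t = lorentz_at (mag_form a b c \<rho>) (\<gamma> t) (velocity \<gamma> t)"
    using assms by (auto simp: magnetic_geodesic_def A_def velocity_def vector_derivative_works)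
  have d: "((\<lambda>t. \<gamma> t $ i) has_real_derivative velocity \<gamma> t $ i) (at t)"
    "((\<lambda>t. velocity \<gamma> t $ i) has_real_derivative A $ i) (at t)" for i
    using bounded_linear.has_vector_derivative[OF bounded_linear_vec_nth[of i] \<gamma>']
      bounded_linear.has_vector_derivative[OF bounded_linear_vec_nth[of i] u']
    by (simp_all add: has_real_derivative_iff_has_vector_derivative)
  note A = magnetic_equation_in_frame[OF eq[unfolded cov_accel_def A_def[symmetric]], folded V_def]
  show "((\<lambda>t. \<gamma> t $ 1) has_real_derivative V t $ 1) (at t)"
    "((\<lambda>t. \<gamma> t $ 2) has_real_derivative V t $ 2) (at t)"
    using d by (simp_all add: V_def to_alg_nth)
  show "((\<lambda>t. V t $ 1) has_real_derivative
       - V t $ 2 * V t $ 3 - a * V t $ 3 - c * V t $ 4 - \<rho> * V t $ 2) (at t)"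
    using d(2)[of 1] A(1) by (simp add: V_def to_alg_nth)
  show "((\<lambda>t. V t $ 2) has_real_derivative V t $ 1 * V t $ 3 + \<rho> * V t $ 1 - b * V t $ 3) (at t)"
    using d(2)[of 2] A(2) by (simp add: V_def to_alg_nth)
  show "((\<lambda>t. V t $ 4) has_real_derivative c * V t $ 1) (at t)"
    using d(2)[of 4] A(4) by (simp add: V_def to_alg_nth)
  have "((\<lambda>t. V t $ 3) has_real_derivative A$3 - (\<gamma> t $ 1 * A$2 - \<gamma> t $ 2 * A$1) / 2) (at t)"
    unfolding V_def to_alg_nth by (auto intro!: derivative_eq_intros d simp: field_simps)
  then show "((\<lambda>t. V t $ 3) has_real_derivative a * V t $ 1 + b * V t $ 2) (at t)"
    using A(3) by (simp add: V_def)
qed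

lemma zero_derivative_imp_constant_on:
  fixes f :: "real \<Rightarrow> real"
  assumes "is_interval J" "\<And>t. t \<in> J \<Longrightarrow> (f has_real_derivative 0) (at t)"
  shows "f constant_on J"
proof -
  have "\<exists>c. \<forall>x\<in>J. f x = c"
    by (rule has_field_derivative_zero_constant)
      (use assms in \<open>auto simp: is_interval_convex_1 intro: has_field_derivative_at_within\<close>)
  then show ?thesis by (auto simp: constant_on_def)
qed

section \<open>The magnetic symplectic form in the left-invariant frame\<close>

definition frame_vel :: "tvec \<Rightarrow> tvec \<Rightarrow> real^4" where
  "frame_vel x U = to_alg (fst x) (fst U)"

text \<open>The rate of change of the left-trivialised velocity along \<open>U\<close>. Together with \<open>frame_vel\<close>, the
  left-trivialised displacement of the foot point, it is a moving frame on the tangent bundle, whose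
  inverse is \<open>frame_lift\<close>.\<close>
definition frame_acc :: "tvec \<Rightarrow> tvec \<Rightarrow> real^4" where
  "frame_acc x U = to_alg (fst x) (snd U) - (1/2) *\<^sub>R bracket (fst U) (snd x)"

definition frame_lift :: "tvec \<Rightarrow> real^4 \<Rightarrow> real^4 \<Rightarrow> tvec" where
  "frame_lift x \<xi> \<nu> = (of_alg (fst x) \<xi>,
     of_alg (fst x) (\<nu> + (1/2) *\<^sub>R bracket (of_alg (fst x) \<xi>) (snd x)))"

lemma frame_lift [simp]:
  "frame_vel x (frame_lift x \<xi> \<nu>) = \<xi>" "frame_acc x (frame_lift x \<xi> \<nu>) = \<nu>"
  by (simp_all add: frame_vel_def frame_acc_def frame_lift_def)

lemma frame_eqI:
  assumes "frame_vel x U = frame_vel x U'" "frame_acc x U = frame_acc x U'"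
  shows "U = U'"
proof -
  have 1: "fst U = fst U'"
    using arg_cong[OF assms(1), of "of_alg (fst x)"] by (simp add: frame_vel_def)
  then have "to_alg (fst x) (snd U) = to_alg (fst x) (snd U')"
    using assms(2) by (simp add: frame_acc_def)
  then have "snd U = snd U'"
    by (metis of_alg_to_alg)
  with 1 show ?thesis by (rule prod_eqI)
qed

text \<open>\<open>l\<close> and \<open>m\<close> are the partial gradients of \<open>\<phi>\<close> along the left-invariant frame of the base and
  along the fibre.\<close>
definition frame_grad :: "(tvec \<Rightarrow> real) \<Rightarrow> real^4 \<Rightarrow> real^4 \<Rightarrow> tvec \<Rightarrow> bool" where
  "frame_grad \<phi> l m x \<longleftrightarrow>
     (\<phi> has_derivative (\<lambda>U. l \<bullet> frame_vel x U + m \<bullet> frame_acc x U)) (at x)"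

lemma to_alg_nth_has_derivative:
  "((\<lambda>x. to_alg (fst x) (snd x) $ i) has_derivative (\<lambda>U. frame_acc x U $ i)) (at x)"
proof -
  have fst: "((\<lambda>x::tvec. fst x $ j) has_derivative (\<lambda>U. fst U $ j)) (at x)"
    and snd: "((\<lambda>x::tvec. snd x $ j) has_derivative (\<lambda>U. snd U $ j)) (at x)" for j
    by (rule has_derivative_vec_nth has_derivative_fst has_derivative_snd has_derivative_ident)+
  have "((\<lambda>x. to_alg (fst x) (snd x) $ 3) has_derivative (\<lambda>U. frame_acc x U $ 3)) (at x)"
    unfolding to_alg_nth
    by (auto intro!: derivative_eq_intros fst snd
        simp: fun_eq_iff frame_acc_def to_alg_nth bracket_nth field_simps)
  moreover have "((\<lambda>x. to_alg (fst x) (snd x) $ i) has_derivative (\<lambda>U. frame_acc x U $ i)) (at x)"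
    if "i = 1 \<or> i = 2 \<or> i = 4" for i
    using that snd by (auto simp: frame_acc_def to_alg_nth bracket_nth)
  ultimately show ?thesis using exhaust_4[of i] by (cases "i = 3") (simp, blast)
qed

lemma frame_grad_vel: "frame_grad (\<lambda>x. to_alg (fst x) (snd x) $ i) 0 (basis4 i) x"
  using to_alg_nth_has_derivative[of i x] by (simp add: frame_grad_def inner_axis' )

lemma frame_grad_base:
  "frame_grad (\<lambda>x. fst x $ 1) (basis4 1) 0 x" "frame_grad (\<lambda>x. fst x $ 2) (basis4 2) 0 x"
  unfolding frame_grad_def
  by (rule has_derivative_eq_rhs,
      (rule has_derivative_vec_nth has_derivative_fst has_derivative_ident)+,
      simp add: fun_eq_iff inner_axis' frame_vel_def to_alg_nth)+

lemma frame_grad_const: "frame_grad (\<lambda>_. k) 0 0 x"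
  by (simp add: frame_grad_def)

lemma frame_grad_add:
  "frame_grad f l m x \<Longrightarrow> frame_grad g l' m' x \<Longrightarrow> frame_grad (\<lambda>x. f x + g x) (l + l') (m + m') x"
  unfolding frame_grad_def
  by (drule (1) has_derivative_add, erule has_derivative_eq_rhs) (simp add: fun_eq_iff inner_add_left)

lemma frame_grad_mult:
  "frame_grad f l m x \<Longrightarrow> frame_grad g l' m' x \<Longrightarrow>
    frame_grad (\<lambda>x. f x * g x) (f x *\<^sub>R l' + g x *\<^sub>R l) (f x *\<^sub>R m' + g x *\<^sub>R m) x"
  unfolding frame_grad_def
  by (drule (1) has_derivative_mult, erule has_derivative_eq_rhs)
    (simp add: fun_eq_iff inner_add_left algebra_simps)

lemma frame_grad_chain:
  assumes "frame_grad f l m x" "(h has_real_derivative d) (at (f x))"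
  shows "frame_grad (\<lambda>x. h (f x)) (d *\<^sub>R l) (d *\<^sub>R m) x"
proof -
  have "((\<lambda>x. h (f x)) has_derivative (\<lambda>U. d * (l \<bullet> frame_vel x U + m \<bullet> frame_acc x U))) (at x)"
    using has_derivative_compose[OF assms(1)[unfolded frame_grad_def] assms(2)[unfolded has_field_derivative_def]]
    by simp
  then show ?thesis by (simp add: frame_grad_def algebra_simps)
qed

lemma frame_grad_flat:
  fixes n :: nat and \<theta> :: real
  assumes "frame_grad q l m x" "frame_grad s l' m' x"
  defines "d \<equiv> 2 * flat (n + 3) \<theta> (q x) (s x) - n * flat (n + 1) \<theta> (q x) (s x)
      - flat (n + 2) (\<theta> + pi / 2) (q x) (s x) * q x"
  shows "frame_grad (\<lambda>x. flat n \<theta> (q x) (s x))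
    (flat (n + 1) (\<theta> + pi / 2) (q x) (s x) *\<^sub>R l + d *\<^sub>R l')
    (flat (n + 1) (\<theta> + pi / 2) (q x) (s x) *\<^sub>R m + d *\<^sub>R m') x"
  unfolding frame_grad_def
  by (rule has_derivative_eq_rhs[OF flat_has_derivative[OF
          assms(1)[unfolded frame_grad_def] assms(2)[unfolded frame_grad_def]]])
    (simp add: fun_eq_iff d_def algebra_simps)

text \<open>The differential of the left-invariant coframe has the single component \<open>d\<theta>\<^sup>3 = - \<theta>\<^sup>1 \<and> \<theta>\<^sup>2\<close>. In
  \<open>d\<eta> = \<Sum> dV\<^sub>i \<and> \<theta>\<^sup>i + V\<^sub>3 d\<theta>\<^sup>3\<close> its coefficient is \<open>V\<^sub>3\<close>, and this is added to the coefficient \<open>\<rho>\<close> of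
  \<open>\<theta>\<^sup>1 \<and> \<theta>\<^sup>2\<close> in the magnetic form.\<close>
lemma mag_sympl_frame:
  fixes x :: tvec
  defines "r \<equiv> to_alg (fst x) (snd x) $ 3"
  shows "mag_sympl (mag_form a b c \<rho>) x A B = frame_vel x A \<bullet> frame_acc x B - frame_acc x A \<bullet> frame_vel x B
      + mag_form a b c (\<rho> + r) (frame_vel x A) (frame_vel x B)"
proof -
  have deriv: "frechet_derivative (\<lambda>y. taut_form y B) (at x) A =
      frame_acc x A \<bullet> frame_vel x B - r * (fst A $ 1 * fst B $ 2 - fst A $ 2 * fst B $ 1) / 2" for A B
  proof -
    have base: "((\<lambda>y::tvec. to_alg (fst y) v $ i) has_derivative
        (\<lambda>U. if i = 3 then - (fst U $ 1 * v$2 - fst U $ 2 * v$1) / 2 else 0)) (at x)" for i v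
    proof -
      have fst: "((\<lambda>x::tvec. fst x $ j) has_derivative (\<lambda>U. fst U $ j)) (at x)" for j
        by (rule has_derivative_vec_nth has_derivative_fst has_derivative_ident)+
      have "((\<lambda>y::tvec. to_alg (fst y) v $ 3) has_derivative
        (\<lambda>U. - (fst U $ 1 * v$2 - fst U $ 2 * v$1) / 2)) (at x)"
        unfolding to_alg_nth by (auto intro!: derivative_eq_intros fst simp: fun_eq_iff field_simps)
      then show ?thesis
        using exhaust_4[of i] by (auto simp: to_alg_nth)
    qed
    have "((\<lambda>y. taut_form y B) has_derivative (\<lambda>A. frame_acc x A \<bullet> frame_vel x B
        - r * (fst A $ 1 * fst B $ 2 - fst A $ 2 * fst B $ 1) / 2)) (at x)"
      unfolding taut_form_def metric_def inner4
      by (rule has_derivative_eq_rhs,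
          (rule has_derivative_add has_derivative_mult base to_alg_nth_has_derivative)+)
        (simp add: fun_eq_iff frame_vel_def r_def field_simps)
    from frechet_derivative_at[OF this, symmetric] show ?thesis by simp
  qed
  have vel: "fst U $ 1 = frame_vel x U $ 1" "fst U $ 2 = frame_vel x U $ 2" for U
    by (simp_all add: frame_vel_def to_alg_nth)
  have F1: "mag_form a b c (\<rho> + r) X Y = mag_form a b c \<rho> X Y + r * (X$1 * Y$2 - X$2 * Y$1)" for X Y
    by (simp add: mag_form_nth algebra_simps)
  have F2: "r * (X$1 * Y$2 - X$2 * Y$1) = r * (X$1 * Y$2 - X$2 * Y$1) / 2 - r * (Y$1 * X$2 - Y$2 * X$1) / 2"
    for X Y :: "real^4" by (simp add: field_simps)
  show ?thesis
    unfolding mag_sympl_def ext_deriv_def deriv form_at_def frame_vel_def[symmetric] vel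
    using F1[of "frame_vel x A" "frame_vel x B"] F2[of "frame_vel x A" "frame_vel x B"]
      inner_commute[of "frame_acc x B" "frame_vel x A"] by linarith
qed

text \<open>The form is nondegenerate: testing it on fibre directions determines the base component of
  the Hamiltonian field, and then base directions determine the fibre component.\<close>
lemma ham_field_frame:
  assumes "frame_grad \<phi> l m x"
  shows "ham_field (mag_form a b c \<rho>) \<phi> x =
    frame_lift x m (lorentz (mag_form a b c (\<rho> + to_alg (fst x) (snd x) $ 3)) m - l)"
proof -
  let ?r = "to_alg (fst x) (snd x) $ 3"
  let ?F = "lorentz (mag_form a b c (\<rho> + ?r))"
  have D: "frechet_derivative \<phi> (at x) = (\<lambda>U. l \<bullet> frame_vel x U + m \<bullet> frame_acc x U)"
    using frechet_derivative_at[OF assms[unfolded frame_grad_def]] by simp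
  have F: "mag_form a b c (\<rho> + ?r) X Y = ?F X \<bullet> Y" for X Y
    by (simp add: inner4 lorentz_nth mag_form_nth algebra_simps)
  let ?X = "frame_lift x m (?F m - l)"
  have \<Omega>: "mag_sympl (mag_form a b c \<rho>) x X U = frame_vel x X \<bullet> frame_acc x U
      - frame_acc x X \<bullet> frame_vel x U + ?F (frame_vel x X) \<bullet> frame_vel x U" for X U
    by (simp only: mag_sympl_frame F)
  have ex: "mag_sympl (mag_form a b c \<rho>) x ?X U = frechet_derivative \<phi> (at x) U" for U
    by (simp add: \<Omega> D inner_diff_left)
  have "X = ?X" if X: "\<And>U. mag_sympl (mag_form a b c \<rho>) x X U = frechet_derivative \<phi> (at x) U" for X
  proof (rule frame_eqI)
    have "frame_vel x X \<bullet> \<nu> = m \<bullet> \<nu>" for \<nu>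
      using X[of "frame_lift x 0 \<nu>"] by (simp add: \<Omega> D)
    then have 1: "frame_vel x X = m" by (rule vector_eq_rdot[THEN iffD1, OF allI])
    then show "frame_vel x X = frame_vel x ?X" by simp
    have "frame_acc x X \<bullet> \<xi> = (?F m - l) \<bullet> \<xi>" for \<xi>
      using X[of "frame_lift x \<xi> 0"] 1 by (simp add: \<Omega> D inner_diff_left)
    then have "frame_acc x X = ?F m - l" by (rule vector_eq_rdot[THEN iffD1, OF allI])
    then show "frame_acc x X = frame_acc x ?X" by simp
  qed
  with ex show ?thesis
    unfolding ham_field_def by (intro the_equality) (simp_all only: simp_thms)
qed

lemma poisson_frame:
  assumes "frame_grad \<phi> l m x" "frame_grad \<psi> l' m' x"
  shows "poisson (mag_form a b c \<rho>) \<phi> \<psi> x =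
    l \<bullet> m' - m \<bullet> l' - mag_form a b c (\<rho> + to_alg (fst x) (snd x) $ 3) m m'"
  unfolding poisson_def mag_sympl_frame ham_field_frame[OF assms(1)] ham_field_frame[OF assms(2)] frame_lift
  by (simp add: inner4 lorentz_nth mag_form_nth algebra_simps)

text \<open>If \<open>b = 0\<close> then every component of the twisted form involves the first covector; hence
  functions of the first coordinate and of the last three velocities commute.\<close>
lemma poisson_eq_0_first:
  assumes "frame_grad \<phi> l m x" "frame_grad \<psi> l' m' x"
    and "l$2 = 0" "l$3 = 0" "l$4 = 0" "m$1 = 0" "l'$2 = 0" "l'$3 = 0" "l'$4 = 0" "m'$1 = 0"
  shows "poisson (mag_form a 0 c \<rho>) \<phi> \<psi> x = 0"
  unfolding poisson_frame[OF assms(1,2)] using assms(3-)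
  by (simp add: inner4 mag_form_nth)

section \<open>Independence of gradients\<close>

lemma inner_grad:
  assumes "frame_grad f l m x"
  shows "grad f x \<bullet> U = l \<bullet> frame_vel x U + m \<bullet> frame_acc x U"
proof -
  let ?D = "\<lambda>U. l \<bullet> frame_vel x U + m \<bullet> frame_acc x U"
  have D: "(f has_derivative ?D) (at x)" using assms by (simp add: frame_grad_def)
  then have lin: "linear ?D" by (rule has_derivative_linear)
  have "grad f x = (\<Sum>b\<in>Basis. ?D b *\<^sub>R b)"
    by (simp only: grad_def frechet_derivative_at[OF D, symmetric])
  then have "grad f x \<bullet> U = (\<Sum>b\<in>Basis. (U \<bullet> b) * ?D b)"
    by (simp add: inner_sum_left inner_commute[of U] mult.commute)
  also have "\<dots> = ?D (\<Sum>b\<in>Basis. (U \<bullet> b) *\<^sub>R b)"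
    by (simp only: linear_sum[OF lin] linear_scale[OF lin] real_scaleR_def)
  also have "\<dots> = ?D U" by (simp only: euclidean_representation)
  finally show ?thesis .
qed

lemma frame_grad_energy: "frame_grad energy 0 (to_alg (fst x) (snd x)) x"
proof -
  let ?V = "\<lambda>x. to_alg (fst x) (snd x)"
  have E: "energy = (\<lambda>x. 1/2 * (?V x$1 * ?V x$1 + ?V x$2 * ?V x$2 + ?V x$3 * ?V x$3 + ?V x$4 * ?V x$4))"
    by (simp add: fun_eq_iff energy_def metric_def inner4)
  have "(energy has_derivative (\<lambda>U. ?V x \<bullet> frame_acc x U)) (at x)"
    unfolding E
    by (rule has_derivative_eq_rhs,
        (rule has_derivative_mult_right has_derivative_add has_derivative_mult to_alg_nth_has_derivative)+)
      (simp add: fun_eq_iff inner4)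
  then show ?thesis by (simp add: frame_grad_def)
qed

text \<open>Since the frame is a basis, a relation among the gradients is a relation among the base parts
  and among the fibre parts with the same coefficients.\<close>
lemma indep_grads:
  assumes "frame_grad h0 l0 m0 x" "frame_grad h1 l1 m1 x" "frame_grad h2 l2 m2 x" "frame_grad h3 l3 m3 x"
    and indep: "\<And>k0 k1 k2 k3. k0 *\<^sub>R l0 + k1 *\<^sub>R l1 + k2 *\<^sub>R l2 + k3 *\<^sub>R l3 = 0 \<Longrightarrow>
      k0 *\<^sub>R m0 + k1 *\<^sub>R m1 + k2 *\<^sub>R m2 + k3 *\<^sub>R m3 = 0 \<Longrightarrow> k0 = 0 \<and> k1 = 0 \<and> k2 = 0 \<and> k3 = 0"
  shows "indep_family [grad h0 x, grad h1 x, grad h2 x, grad h3 x]"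
  unfolding indep_family_def
proof (intro allI impI)
  fix k :: "nat \<Rightarrow> real" and i
  assume "(\<Sum>i<length [grad h0 x, grad h1 x, grad h2 x, grad h3 x]. k i *\<^sub>R [grad h0 x, grad h1 x, grad h2 x, grad h3 x] ! i) = 0"
    and i: "i < length [grad h0 x, grad h1 x, grad h2 x, grad h3 x]"
  then have 0: "k 0 *\<^sub>R grad h0 x + k 1 *\<^sub>R grad h1 x + k 2 *\<^sub>R grad h2 x + k 3 *\<^sub>R grad h3 x = 0"
    by (simp add: numeral_eq_Suc add_ac)
  let ?l = "k 0 *\<^sub>R l0 + k 1 *\<^sub>R l1 + k 2 *\<^sub>R l2 + k 3 *\<^sub>R l3"
  let ?m = "k 0 *\<^sub>R m0 + k 1 *\<^sub>R m1 + k 2 *\<^sub>R m2 + k 3 *\<^sub>R m3"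
  have *: "?l \<bullet> \<xi> + ?m \<bullet> \<nu> = 0" for \<xi> \<nu>
    using arg_cong[OF 0, of "\<lambda>g. g \<bullet> frame_lift x \<xi> \<nu>"]
    by (simp add: inner_add_left inner_grad[OF assms(1)] inner_grad[OF assms(2)]
        inner_grad[OF assms(3)] inner_grad[OF assms(4)] algebra_simps)
  have "?l = 0" using *[of ?l 0] by simp
  moreover have "?m = 0" using *[of 0 ?m] by simp
  ultimately have "k 0 = 0 \<and> k 1 = 0 \<and> k 2 = 0 \<and> k 3 = 0" by (rule indep)
  moreover have "i = 0 \<or> i = 1 \<or> i = 2 \<or> i = 3" using i by auto
  ultimately show "k i = 0" by auto
qed

section \<open>Convergent power series in several variables\<close>

abbreviation multi :: "('a::euclidean_space \<Rightarrow> nat) set" where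
  "multi \<equiv> Basis \<rightarrow>\<^sub>E UNIV"

definition monom_at :: "('a::euclidean_space \<Rightarrow> nat) \<Rightarrow> 'a \<Rightarrow> real" where
  "monom_at \<alpha> z = (\<Prod>b\<in>Basis. (z \<bullet> b) ^ \<alpha> b)"

definition mdeg :: "('a::euclidean_space \<Rightarrow> nat) \<Rightarrow> nat" where
  "mdeg \<alpha> = (\<Sum>b\<in>Basis. \<alpha> b)"

definition cube :: "'a::euclidean_space \<Rightarrow> real \<Rightarrow> 'a set" where
  "cube x r = {y. \<forall>b\<in>Basis. \<bar>(y - x) \<bullet> b\<bar> \<le> r}"

lemma abs_monom_at_le: "y \<in> cube x r \<Longrightarrow> \<bar>monom_at \<alpha> (y - x)\<bar> \<le> r ^ mdeg \<alpha>"
  unfolding monom_at_def mdeg_def power_sum abs_prod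
  by (rule prod_mono) (auto simp: cube_def power_abs intro: power_mono)

text \<open>\<open>power_series_at x r M f\<close>: on the cube of radius \<open>r\<close> about \<open>x\<close>, \<open>f\<close> is a power series whose
  weighted \<open>\<ell>\<^sup>1\<close>-norm at radius \<open>r\<close> is at most \<open>M\<close>. Such series form a Banach algebra, which reduces
  compositions to estimates on \<open>M\<close>.\<close>
definition power_series_at :: "'a::euclidean_space \<Rightarrow> real \<Rightarrow> real \<Rightarrow> ('a \<Rightarrow> real) \<Rightarrow> bool" where
  "power_series_at x r M f \<longleftrightarrow> (\<exists>c.
     (\<lambda>\<alpha>. \<bar>c \<alpha>\<bar> * r ^ mdeg \<alpha>) summable_on multi \<and> (\<Sum>\<^sub>\<infinity>\<alpha>\<in>multi. \<bar>c \<alpha>\<bar> * r ^ mdeg \<alpha>) \<le> M \<and>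
     (\<forall>y\<in>cube x r. ((\<lambda>\<alpha>. c \<alpha> * monom_at \<alpha> (y - x)) has_sum f y) multi))"

lemma summable_on_abs_bound:
  fixes f :: "'i \<Rightarrow> real"
  assumes "g summable_on A" "\<And>i. i \<in> A \<Longrightarrow> \<bar>f i\<bar> \<le> g i"
  shows "f summable_on A"
proof -
  have "(\<lambda>i. norm (f i)) summable_on A"
    by (rule Infinite_Sum.abs_summable_on_comparison_test'[OF assms(1)]) (simp add: assms(2))
  then show ?thesis by (rule abs_summable_summable)
qed

text \<open>A sum of monomials over an arbitrary index set, with repetitions, may be regrouped by exponent
  because it converges absolutely. Hence sums, products and compositions can be expanded over
  whatever index set is convenient.\<close>
lemma power_series_at_family:
  fixes A :: "'i set" and e :: "'i \<Rightarrow> 'a::euclidean_space \<Rightarrow> nat"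
  assumes r: "r > 0" and e: "\<And>i. i \<in> A \<Longrightarrow> e i \<in> multi"
    and sm: "(\<lambda>i. \<bar>c i\<bar> * r ^ mdeg (e i)) summable_on A"
    and le: "(\<Sum>\<^sub>\<infinity>i\<in>A. \<bar>c i\<bar> * r ^ mdeg (e i)) \<le> M"
    and f: "\<And>y. y \<in> cube x r \<Longrightarrow> ((\<lambda>i. c i * monom_at (e i) (y - x)) has_sum f y) A"
  shows "power_series_at x r M f"
proof -
  define F where "F \<alpha> = {i \<in> A. e i = \<alpha>}" for \<alpha>
  let ?w = "\<lambda>i. \<bar>c i\<bar> * r ^ mdeg (e i)"
  have inj: "inj_on snd (Sigma multi F)" by (auto simp: inj_on_def F_def)
  have img: "snd ` Sigma multi F = A"
  proof (intro equalityI subsetI)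
    fix i assume "i \<in> A"
    then have "(e i, i) \<in> Sigma multi F" using e by (simp add: F_def)
    then show "i \<in> snd ` Sigma multi F" by force
  qed (auto simp: F_def)
  have regroup: "(g has_sum S) A \<longleftrightarrow> ((\<lambda>p. g (snd p)) has_sum S) (Sigma multi F)" for g :: "'i \<Rightarrow> real" and S
    using has_sum_reindex[OF inj, of g S] by (simp add: img o_def)
  have sub: "F \<alpha> \<subseteq> A" for \<alpha> by (auto simp: F_def)
  have wF: "?w summable_on F \<alpha>" for \<alpha>
    using summable_on_subset[OF sm sub] .
  have absF: "(\<lambda>i. \<bar>c i\<bar>) summable_on F \<alpha>" for \<alpha>
  proof -
    have "(\<lambda>i. ?w i * (1 / r ^ mdeg \<alpha>)) summable_on F \<alpha>"
      by (rule summable_on_cmult_left[OF wF])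
    then show ?thesis
      by (rule summable_on_cong[THEN iffD1, rotated]) (use r in \<open>auto simp: F_def\<close>)
  qed
  then have cF: "c summable_on F \<alpha>" for \<alpha>
    by (rule summable_on_abs_bound) auto
  define C where "C \<alpha> = (\<Sum>\<^sub>\<infinity>i\<in>F \<alpha>. c i)" for \<alpha>
  define W where "W \<alpha> = (\<Sum>\<^sub>\<infinity>i\<in>F \<alpha>. ?w i)" for \<alpha>
  have W: "(W has_sum (\<Sum>\<^sub>\<infinity>i\<in>A. ?w i)) multi"
    by (rule has_sum_SigmaD[OF regroup[THEN iffD1, OF has_sum_infsum[OF sm]]])
      (simp add: W_def has_sum_infsum[OF wF])
  have CW: "\<bar>C \<alpha>\<bar> * r ^ mdeg \<alpha> \<le> W \<alpha>" for \<alpha>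
  proof -
    have "\<bar>C \<alpha>\<bar> \<le> (\<Sum>\<^sub>\<infinity>i\<in>F \<alpha>. \<bar>c i\<bar>)"
      using norm_infsum_bound[of c "F \<alpha>"] absF by (simp add: C_def)
    then have "\<bar>C \<alpha>\<bar> * r ^ mdeg \<alpha> \<le> (\<Sum>\<^sub>\<infinity>i\<in>F \<alpha>. \<bar>c i\<bar>) * r ^ mdeg \<alpha>"
      using r by (intro mult_right_mono) auto
    also have "\<dots> = (\<Sum>\<^sub>\<infinity>i\<in>F \<alpha>. \<bar>c i\<bar> * r ^ mdeg \<alpha>)"
      by (rule infsum_cmult_left[symmetric]) (simp add: absF)
    also have "\<dots> = W \<alpha>"
      unfolding W_def by (rule infsum_cong) (auto simp: F_def)
    finally show ?thesis .
  qed
  show ?thesis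
    unfolding power_series_at_def
  proof (intro exI conjI ballI)
    show Cs: "(\<lambda>\<alpha>. \<bar>C \<alpha>\<bar> * r ^ mdeg \<alpha>) summable_on multi"
      by (rule summable_on_abs_bound[OF has_sum_imp_summable[OF W]]) (use CW r in \<open>auto simp: abs_mult\<close>)
    have "(\<Sum>\<^sub>\<infinity>\<alpha>\<in>multi. \<bar>C \<alpha>\<bar> * r ^ mdeg \<alpha>) \<le> (\<Sum>\<^sub>\<infinity>\<alpha>\<in>multi. W \<alpha>)"
      by (rule infsum_mono[OF Cs has_sum_imp_summable[OF W]]) (rule CW)
    also have "\<dots> \<le> M" using infsumI[OF W] le by simp
    finally show "(\<Sum>\<^sub>\<infinity>\<alpha>\<in>multi. \<bar>C \<alpha>\<bar> * r ^ mdeg \<alpha>) \<le> M" .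
    fix y assume y: "y \<in> cube x r"
    show "((\<lambda>\<alpha>. C \<alpha> * monom_at \<alpha> (y - x)) has_sum f y) multi"
    proof (rule has_sum_SigmaD[OF regroup[THEN iffD1, OF f[OF y]]])
      fix \<alpha>
      have "((\<lambda>i. c i * monom_at \<alpha> (y - x)) has_sum C \<alpha> * monom_at \<alpha> (y - x)) (F \<alpha>)"
        unfolding C_def by (intro has_sum_cmult_left has_sum_infsum cF)
      then show "((\<lambda>i. c (snd (\<alpha>, i)) * monom_at (e (snd (\<alpha>, i))) (y - x)) has_sum
          C \<alpha> * monom_at \<alpha> (y - x)) (F \<alpha>)"
        by (rule has_sum_cong[THEN iffD1, rotated]) (auto simp: F_def)
    qed
  qed
qed

lemma power_series_at_mono: "power_series_at x r M f \<Longrightarrow> M \<le> M' \<Longrightarrow> power_series_at x r M' f"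
  unfolding power_series_at_def by (meson order_trans)

lemma power_series_at_bound:
  assumes "power_series_at x r M f" "y \<in> cube x r"
  shows "\<bar>f y\<bar> \<le> M"
proof -
  obtain c where c: "(\<lambda>\<alpha>. \<bar>c \<alpha>\<bar> * r ^ mdeg \<alpha>) summable_on multi"
      "(\<Sum>\<^sub>\<infinity>\<alpha>\<in>multi. \<bar>c \<alpha>\<bar> * r ^ mdeg \<alpha>) \<le> M"
      "((\<lambda>\<alpha>. c \<alpha> * monom_at \<alpha> (y - x)) has_sum f y) multi"
    using assms unfolding power_series_at_def by blast
  have le: "\<bar>c \<alpha> * monom_at \<alpha> (y - x)\<bar> \<le> \<bar>c \<alpha>\<bar> * r ^ mdeg \<alpha>" for \<alpha>
    unfolding abs_mult by (intro mult_left_mono abs_monom_at_le assms(2)) simp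
  have abs: "(\<lambda>\<alpha>. \<bar>c \<alpha> * monom_at \<alpha> (y - x)\<bar>) summable_on multi"
    by (rule summable_on_abs_bound[OF c(1)]) (use le in auto)
  have "\<bar>f y\<bar> \<le> (\<Sum>\<^sub>\<infinity>\<alpha>\<in>multi. \<bar>c \<alpha> * monom_at \<alpha> (y - x)\<bar>)"
    using norm_infsum_bound[of "\<lambda>\<alpha>. c \<alpha> * monom_at \<alpha> (y - x)" multi] abs infsumI[OF c(3)] by simp
  also have "\<dots> \<le> (\<Sum>\<^sub>\<infinity>\<alpha>\<in>multi. \<bar>c \<alpha>\<bar> * r ^ mdeg \<alpha>)"
    by (rule infsum_mono[OF abs c(1)]) (rule le)
  finally show ?thesis using c(2) by simp
qed

lemma cube_self: "r \<ge> 0 \<Longrightarrow> x \<in> cube x r" by (simp add: cube_def)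

lemma power_series_at_nonneg: "power_series_at x r M f \<Longrightarrow> r \<ge> 0 \<Longrightarrow> M \<ge> 0"
  using power_series_at_bound[OF _ cube_self, of x r M f] by linarith

text \<open>Completeness of the Banach algebra.\<close>
lemma power_series_at_sums:
  fixes f :: "'i \<Rightarrow> 'a::euclidean_space \<Rightarrow> real"
  assumes r: "r > 0" and f: "\<And>i. i \<in> I \<Longrightarrow> power_series_at x r (M i) (f i)"
    and M: "M summable_on I" and g: "\<And>y. y \<in> cube x r \<Longrightarrow> ((\<lambda>i. f i y) has_sum g y) I"
  shows "power_series_at x r (infsum M I) g"
proof -
  let ?P = "\<lambda>i c. (\<lambda>\<alpha>. \<bar>c \<alpha>\<bar> * r ^ mdeg \<alpha>) summable_on multi \<and> (\<Sum>\<^sub>\<infinity>\<alpha>\<in>multi. \<bar>c \<alpha>\<bar> * r ^ mdeg \<alpha>) \<le> M i \<and>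
     (\<forall>y\<in>cube x r. ((\<lambda>\<alpha>. c \<alpha> * monom_at \<alpha> (y - x)) has_sum f i y) multi)"
  have "\<forall>i\<in>I. \<exists>c. ?P i c"
    using f unfolding power_series_at_def by (rule ballI)
  from bchoice[OF this] obtain c where P: "\<forall>i\<in>I. ?P i (c i)" by (rule exE)
  have c: "(\<lambda>\<alpha>. \<bar>c i \<alpha>\<bar> * r ^ mdeg \<alpha>) summable_on multi"
      "(\<Sum>\<^sub>\<infinity>\<alpha>\<in>multi. \<bar>c i \<alpha>\<bar> * r ^ mdeg \<alpha>) \<le> M i"
      "y \<in> cube x r \<Longrightarrow> ((\<lambda>\<alpha>. c i \<alpha> * monom_at \<alpha> (y - x)) has_sum f i y) multi" if "i \<in> I" for i y
    using bspec[OF P that] by simp_all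
  define N where "N i = (\<Sum>\<^sub>\<infinity>\<alpha>\<in>multi. \<bar>c i \<alpha>\<bar> * r ^ mdeg \<alpha>)" for i
  have w0: "\<bar>c i \<alpha>\<bar> * r ^ mdeg \<alpha> \<ge> 0" for i \<alpha> using r by simp
  have N: "((\<lambda>\<alpha>. \<bar>c i \<alpha>\<bar> * r ^ mdeg \<alpha>) has_sum N i) multi" if "i \<in> I" for i
    unfolding N_def by (rule has_sum_infsum[OF c(1)[OF that]])
  have N0: "N i \<ge> 0" for i unfolding N_def by (rule infsum_nonneg) (rule w0)
  have Ns: "N summable_on I"
    by (rule summable_on_comparison_test[OF M]) (use c(2) N0 in \<open>auto simp: N_def\<close>)
  let ?w = "\<lambda>p. \<bar>c (fst p) (snd p)\<bar> * r ^ mdeg (snd p)"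
  have ws: "?w summable_on I \<times> multi"
    by (rule summable_on_SigmaI[OF _ Ns]) (use N w0 in auto)
  have "(?w has_sum infsum N I) (I \<times> multi)"
    by (rule has_sum_SigmaI[OF _ has_sum_infsum[OF Ns] ws]) (use N in auto)
  then have "infsum ?w (I \<times> multi) = infsum N I" by (rule infsumI)
  also have "\<dots> \<le> infsum M I"
    by (rule infsum_mono[OF Ns M]) (use c(2) in \<open>auto simp: N_def\<close>)
  finally have le: "infsum ?w (I \<times> multi) \<le> infsum M I" .
  show ?thesis
  proof (rule power_series_at_family[OF r _ ws le])
    fix y assume y: "y \<in> cube x r"
    have "(\<lambda>p. c (fst p) (snd p) * monom_at (snd p) (y - x)) summable_on I \<times> multi"
      by (rule summable_on_abs_bound[OF ws])
        (auto simp: abs_mult intro!: mult_left_mono abs_monom_at_le y)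
    then show "((\<lambda>p. c (fst p) (snd p) * monom_at (snd p) (y - x)) has_sum g y) (I \<times> multi)"
      by (rule has_sum_SigmaI[OF _ g[OF y], rotated]) (use c(3)[OF _ y] in auto)
  qed auto
qed

lemma power_series_at_monom:
  assumes r: "r > 0" and \<beta>: "\<beta> \<in> multi"
  shows "power_series_at x r (\<bar>k\<bar> * r ^ mdeg \<beta>) (\<lambda>y. k * monom_at \<beta> (y - x))"
  by (rule power_series_at_family[OF r, of "{()}" "\<lambda>_. \<beta>" "\<lambda>_. k"])
    (use \<beta> in \<open>auto intro!: has_sum_finiteI\<close>)

lemma power_series_at_const:
  assumes "r > 0" shows "power_series_at (x::'a::euclidean_space) r \<bar>k\<bar> (\<lambda>_. k)"
proof -
  let ?\<beta> = "\<lambda>b\<in>(Basis :: 'a set). 0 :: nat"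
  have "mdeg ?\<beta> = 0" "monom_at ?\<beta> z = 1" for z :: 'a
    by (simp_all add: mdeg_def monom_at_def)
  then show ?thesis using power_series_at_monom[OF assms, of ?\<beta> x k] by simp
qed

lemma power_series_at_coord:
  assumes "r > 0" "b \<in> Basis" shows "power_series_at (x::'a::euclidean_space) r r (\<lambda>y. (y - x) \<bullet> b)"
proof -
  let ?\<beta> = "\<lambda>b'\<in>(Basis :: 'a set). if b' = b then 1 else 0 :: nat"
  have "mdeg ?\<beta> = 1" using assms by (simp add: mdeg_def sum.delta)
  moreover have "monom_at ?\<beta> z = z \<bullet> b" for z :: 'a
  proof -
    have "monom_at ?\<beta> z = (\<Prod>b'\<in>Basis. if b' = b then z \<bullet> b else 1)"
      unfolding monom_at_def by (rule prod.cong) auto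
    then show ?thesis using assms by (simp add: prod.delta)
  qed
  ultimately show ?thesis using power_series_at_monom[OF assms(1), of ?\<beta> x 1] assms(1) by simp
qed

lemma power_series_at_add:
  assumes r: "r > 0" and "power_series_at x r M f" "power_series_at x r N g"
  shows "power_series_at x r (M + N) (\<lambda>y. f y + g y)"
proof -
  have "power_series_at x r (\<Sum>\<^sub>\<infinity>i\<in>UNIV. if i then M else N) (\<lambda>y. f y + g y)"
    by (rule power_series_at_sums[OF r, of _ _ _ "\<lambda>i. if i then f else g"])
      (use assms in \<open>auto intro!: has_sum_finiteI simp: UNIV_bool\<close>)
  then show ?thesis by (simp add: UNIV_bool add.commute)
qed

lemma power_series_at_cmult_monom:
  assumes r: "r > 0" and f: "power_series_at x r M f" and \<beta>: "\<beta> \<in> multi"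
  shows "power_series_at x r (\<bar>k\<bar> * r ^ mdeg \<beta> * M) (\<lambda>y. k * monom_at \<beta> (y - x) * f y)"
proof -
  obtain c where c: "(\<lambda>\<alpha>. \<bar>c \<alpha>\<bar> * r ^ mdeg \<alpha>) summable_on multi"
      "(\<Sum>\<^sub>\<infinity>\<alpha>\<in>multi. \<bar>c \<alpha>\<bar> * r ^ mdeg \<alpha>) \<le> M"
      "\<And>y. y \<in> cube x r \<Longrightarrow> ((\<lambda>\<alpha>. c \<alpha> * monom_at \<alpha> (y - x)) has_sum f y) multi"
    using f unfolding power_series_at_def by blast
  let ?e = "\<lambda>\<alpha>. \<lambda>b\<in>Basis. \<alpha> b + \<beta> b"
  have deg: "mdeg (?e \<alpha>) = mdeg \<beta> + mdeg \<alpha>" for \<alpha>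
    by (simp add: mdeg_def sum.distrib add.commute)
  have mon: "monom_at (?e \<alpha>) z = monom_at \<beta> z * monom_at \<alpha> z" for \<alpha> z
    by (simp add: monom_at_def prod.distrib[symmetric] power_add mult.commute)
  have w: "\<bar>k * c \<alpha>\<bar> * r ^ mdeg (?e \<alpha>) = (\<bar>k\<bar> * r ^ mdeg \<beta>) * (\<bar>c \<alpha>\<bar> * r ^ mdeg \<alpha>)" for \<alpha>
    by (simp add: deg abs_mult power_add)
  show ?thesis
  proof (rule power_series_at_family[OF r, of multi ?e "\<lambda>\<alpha>. k * c \<alpha>"])
    show "(\<lambda>\<alpha>. \<bar>k * c \<alpha>\<bar> * r ^ mdeg (?e \<alpha>)) summable_on multi"
      unfolding w by (rule summable_on_cmult_right[OF c(1)])
    show "(\<Sum>\<^sub>\<infinity>\<alpha>\<in>multi. \<bar>k * c \<alpha>\<bar> * r ^ mdeg (?e \<alpha>)) \<le> \<bar>k\<bar> * r ^ mdeg \<beta> * M"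
      unfolding w infsum_cmult_right[OF c(1)] using c(2) r by (intro mult_left_mono) auto
    fix y assume y: "y \<in> cube x r"
    have "((\<lambda>\<alpha>. (k * monom_at \<beta> (y - x)) * (c \<alpha> * monom_at \<alpha> (y - x))) has_sum
        (k * monom_at \<beta> (y - x)) * f y) multi"
      by (rule has_sum_cmult_right[OF c(3)[OF y]])
    then show "((\<lambda>\<alpha>. k * c \<alpha> * monom_at (?e \<alpha>) (y - x)) has_sum k * monom_at \<beta> (y - x) * f y) multi"
      by (simp add: mon mult_ac)
  qed auto
qed

lemma power_series_at_mult:
  assumes r: "r > 0" and f: "power_series_at x r M f" and g: "power_series_at x r N g"
  shows "power_series_at x r (M * N) (\<lambda>y. f y * g y)"
proof -
  obtain c where c: "(\<lambda>\<alpha>. \<bar>c \<alpha>\<bar> * r ^ mdeg \<alpha>) summable_on multi"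
      "(\<Sum>\<^sub>\<infinity>\<alpha>\<in>multi. \<bar>c \<alpha>\<bar> * r ^ mdeg \<alpha>) \<le> M"
      "\<And>y. y \<in> cube x r \<Longrightarrow> ((\<lambda>\<alpha>. c \<alpha> * monom_at \<alpha> (y - x)) has_sum f y) multi"
    using f unfolding power_series_at_def by blast
  have "power_series_at x r (\<Sum>\<^sub>\<infinity>\<beta>\<in>multi. \<bar>c \<beta>\<bar> * r ^ mdeg \<beta> * N) (\<lambda>y. f y * g y)"
  proof (rule power_series_at_sums[OF r])
    show "power_series_at x r (\<bar>c \<beta>\<bar> * r ^ mdeg \<beta> * N) (\<lambda>y. c \<beta> * monom_at \<beta> (y - x) * g y)"
      if "\<beta> \<in> multi" for \<beta> by (rule power_series_at_cmult_monom[OF r g that])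
    show "(\<lambda>\<beta>. \<bar>c \<beta>\<bar> * r ^ mdeg \<beta> * N) summable_on multi"
      by (rule summable_on_cmult_left[OF c(1)])
    show "((\<lambda>\<beta>. c \<beta> * monom_at \<beta> (y - x) * g y) has_sum f y * g y) multi" if "y \<in> cube x r" for y
      by (rule has_sum_cmult_left[OF c(3)[OF that]])
  qed
  then show ?thesis
    by (rule power_series_at_mono)
      (use c(2) r power_series_at_nonneg[OF g] in \<open>simp add: infsum_cmult_left[OF c(1)] mult_right_mono\<close>)
qed

lemma power_series_at_power:
  assumes r: "r > 0" and f: "power_series_at x r M f"
  shows "power_series_at x r (M ^ n) (\<lambda>y. f y ^ n)"
proof (induction n)
  case 0
  show ?case using power_series_at_const[OF r, of x 1] by simp
next
  case (Suc n)
  show ?case using power_series_at_mult[OF r f Suc] by simp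
qed

lemma power_series_at_prod:
  assumes r: "r > 0" and "finite B" "\<And>b. b \<in> B \<Longrightarrow> power_series_at x r (M b) (f b)"
  shows "power_series_at x r (\<Prod>b\<in>B. M b) (\<lambda>y. \<Prod>b\<in>B. f b y)"
  using assms(2,3)
proof (induction B rule: finite_induct)
  case empty
  show ?case using power_series_at_const[OF r, of x 1] by simp
next
  case (insert b B)
  then show ?case using power_series_at_mult[OF r, of x "M b" "f b" "\<Prod>b\<in>B. M b" "\<lambda>y. \<Prod>b\<in>B. f b y"]
    by simp
qed

text \<open>A power series in one variable that converges absolutely at the norm of \<open>f\<close> may be applied to \<open>f\<close>,
  because the norm of \<open>f\<^sup>n\<close> is at most the \<open>n\<close>-th power of the norm of \<open>f\<close>.\<close>
lemma power_series_at_compose: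
  assumes r: "r > 0" and f: "power_series_at x r M f"
    and a: "summable (\<lambda>n. \<bar>a n\<bar> * M ^ n)" and h: "\<And>t. \<bar>t\<bar> \<le> M \<Longrightarrow> (\<lambda>n. a n * t ^ n) sums h t"
  shows "\<exists>M'. power_series_at x r M' (\<lambda>y. h (f y))"
proof -
  have M: "M \<ge> 0" using power_series_at_nonneg[OF f] r by simp
  have "power_series_at x r (\<Sum>\<^sub>\<infinity>n\<in>UNIV. \<bar>a n\<bar> * M ^ n) (\<lambda>y. h (f y))"
  proof (rule power_series_at_sums[OF r])
    show "power_series_at x r (\<bar>a n\<bar> * M ^ n) (\<lambda>y. a n * f y ^ n)" for n
      by (rule power_series_at_mult[OF r power_series_at_const[OF r] power_series_at_power[OF r f]])
    show "(\<lambda>n. \<bar>a n\<bar> * M ^ n) summable_on UNIV"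
      using a M by (intro summable_nonneg_imp_summable_on) auto
    fix y assume "y \<in> cube x r"
    then have le: "\<bar>f y\<bar> \<le> M" by (rule power_series_at_bound[OF f])
    have "summable (\<lambda>n. norm (a n * f y ^ n))"
      by (rule summable_comparison_test_ev[OF _ a])
        (use le in \<open>auto simp: abs_mult power_abs intro!: always_eventually mult_left_mono power_mono\<close>)
    then show "((\<lambda>n. a n * f y ^ n) has_sum h (f y)) UNIV"
      using h[OF le] by (rule norm_summable_imp_has_sum)
  qed
  then show ?thesis by blast
qed

text \<open>Every monomial that occurs has degree at least \<open>1\<close> and gains at least a factor \<open>r'/r\<close>. So the norm of
  \<open>f - f x\<close> becomes as small as needed for a composition.\<close>
lemma power_series_at_shrink:
  fixes x :: "'a::euclidean_space"
  assumes r: "0 < r'" "r' \<le> r" and f: "power_series_at x r M f" and "f x = 0"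
  shows "power_series_at x r' (M * (r' / r)) f"
proof -
  obtain c where c: "(\<lambda>\<alpha>. \<bar>c \<alpha>\<bar> * r ^ mdeg \<alpha>) summable_on multi"
      "(\<Sum>\<^sub>\<infinity>\<alpha>\<in>multi. \<bar>c \<alpha>\<bar> * r ^ mdeg \<alpha>) \<le> M"
      "\<And>y. y \<in> cube x r \<Longrightarrow> ((\<lambda>\<alpha>. c \<alpha> * monom_at \<alpha> (y - x)) has_sum f y) multi"
    using f unfolding power_series_at_def by blast
  let ?\<epsilon> = "\<lambda>b\<in>(Basis :: 'a set). 0 :: nat"
  have nz: "\<exists>b\<in>Basis. \<alpha> b \<noteq> 0" if \<alpha>: "\<alpha> \<in> multi" "\<alpha> \<noteq> ?\<epsilon>" for \<alpha>
  proof (rule ccontr)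
    assume "\<not> ?thesis"
    then have "\<alpha> = ?\<epsilon>" by (intro PiE_ext[OF \<alpha>(1), of ?\<epsilon>]) auto
    with \<alpha>(2) show False by simp
  qed
  have m0: "monom_at \<alpha> (0::'a) = (if \<alpha> = ?\<epsilon> then 1 else 0)" if \<alpha>: "\<alpha> \<in> multi" for \<alpha>
  proof (cases "\<alpha> = ?\<epsilon>")
    case False
    then obtain b where "b \<in> Basis" "\<alpha> b \<noteq> 0"
      using nz[OF \<alpha>] by blast
    then have "monom_at \<alpha> (0::'a) = 0" by (auto simp: monom_at_def intro!: prod_zero)
    with False show ?thesis by simp
  qed (simp add: monom_at_def)
  have "((\<lambda>\<alpha>. c \<alpha> * monom_at \<alpha> (0::'a)) has_sum c ?\<epsilon>) multi"
    by (rule has_sum_finite_neutralI[of "{?\<epsilon>}"]) (auto simp: m0)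
  moreover have "((\<lambda>\<alpha>. c \<alpha> * monom_at \<alpha> (0::'a)) has_sum 0) multi"
    using c(3)[of x] \<open>f x = 0\<close> r by (simp add: cube_self)
  ultimately have c0: "c ?\<epsilon> = 0" by (rule has_sum_unique)
  have le: "\<bar>c \<alpha>\<bar> * r' ^ mdeg \<alpha> \<le> r' / r * (\<bar>c \<alpha>\<bar> * r ^ mdeg \<alpha>)" if \<alpha>: "\<alpha> \<in> multi" for \<alpha>
  proof (cases "\<alpha> = ?\<epsilon>")
    case False
    then obtain b where b: "b \<in> Basis" "\<alpha> b \<noteq> 0"
      using nz[OF \<alpha>] by blast
    then have "mdeg \<alpha> \<noteq> 0" by (auto simp: mdeg_def)
    then have "(r' / r) ^ mdeg \<alpha> \<le> (r' / r) ^ 1"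
      using r by (intro power_decreasing) auto
    then have "r' ^ mdeg \<alpha> \<le> r' / r * r ^ mdeg \<alpha>"
      using r by (simp add: power_divide field_simps)
    from mult_left_mono[OF this, of "\<bar>c \<alpha>\<bar>"] show ?thesis by (simp add: mult_ac)
  qed (use c0 in simp)
  have s: "(\<lambda>\<alpha>. \<bar>c \<alpha>\<bar> * r' ^ mdeg \<alpha>) summable_on multi"
    by (rule summable_on_abs_bound[OF summable_on_cmult_right[OF c(1), of "r' / r"]])
      (use le r in \<open>auto simp: abs_mult\<close>)
  show ?thesis
    unfolding power_series_at_def
  proof (intro exI conjI ballI)
    show "(\<lambda>\<alpha>. \<bar>c \<alpha>\<bar> * r' ^ mdeg \<alpha>) summable_on multi" by (rule s)
    have "(\<Sum>\<^sub>\<infinity>\<alpha>\<in>multi. \<bar>c \<alpha>\<bar> * r' ^ mdeg \<alpha>) \<le> (\<Sum>\<^sub>\<infinity>\<alpha>\<in>multi. r' / r * (\<bar>c \<alpha>\<bar> * r ^ mdeg \<alpha>))"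
      by (rule infsum_mono[OF s summable_on_cmult_right[OF c(1)]]) (rule le)
    also have "\<dots> = r' / r * (\<Sum>\<^sub>\<infinity>\<alpha>\<in>multi. \<bar>c \<alpha>\<bar> * r ^ mdeg \<alpha>)"
      by (rule infsum_cmult_right[OF c(1)])
    also have "\<dots> \<le> r' / r * M" using r c(2) by (intro mult_left_mono) auto
    finally show "(\<Sum>\<^sub>\<infinity>\<alpha>\<in>multi. \<bar>c \<alpha>\<bar> * r' ^ mdeg \<alpha>) \<le> M * (r' / r)" by (simp add: mult.commute)
    fix y assume "y \<in> cube x r'"
    then have "y \<in> cube x r" using r by (force simp: cube_def)
    then show "((\<lambda>\<alpha>. c \<alpha> * monom_at \<alpha> (y - x)) has_sum f y) multi" by (rule c(3))
  qed
qed

lemma power_series_at_smaller_radius: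
  assumes r: "0 < r'" "r' \<le> r" and f: "power_series_at x r M f"
  shows "power_series_at x r' M f"
proof -
  obtain c where c: "(\<lambda>\<alpha>. \<bar>c \<alpha>\<bar> * r ^ mdeg \<alpha>) summable_on multi"
      "(\<Sum>\<^sub>\<infinity>\<alpha>\<in>multi. \<bar>c \<alpha>\<bar> * r ^ mdeg \<alpha>) \<le> M"
      "\<And>y. y \<in> cube x r \<Longrightarrow> ((\<lambda>\<alpha>. c \<alpha> * monom_at \<alpha> (y - x)) has_sum f y) multi"
    using f unfolding power_series_at_def by blast
  have le: "\<bar>c \<alpha>\<bar> * r' ^ mdeg \<alpha> \<le> \<bar>c \<alpha>\<bar> * r ^ mdeg \<alpha>" for \<alpha>
    using r by (intro mult_left_mono power_mono) auto
  have s: "(\<lambda>\<alpha>. \<bar>c \<alpha>\<bar> * r' ^ mdeg \<alpha>) summable_on multi"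
    by (rule summable_on_abs_bound[OF c(1)]) (use le r in \<open>auto simp: abs_mult\<close>)
  have "(\<Sum>\<^sub>\<infinity>\<alpha>\<in>multi. \<bar>c \<alpha>\<bar> * r' ^ mdeg \<alpha>) \<le> (\<Sum>\<^sub>\<infinity>\<alpha>\<in>multi. \<bar>c \<alpha>\<bar> * r ^ mdeg \<alpha>)"
    by (rule infsum_mono[OF s c(1)]) (rule le)
  moreover have "y \<in> cube x r" if "y \<in> cube x r'" for y
    using that r by (force simp: cube_def)
  ultimately show ?thesis
    unfolding power_series_at_def using s c(2,3) by (intro exI[of _ c]) auto
qed

section \<open>Analytic functions\<close>

definition analytic_at :: "('a::euclidean_space \<Rightarrow> real) \<Rightarrow> 'a \<Rightarrow> bool" where
  "analytic_at f x \<longleftrightarrow> (\<exists>r>0. \<exists>M. power_series_at x r M f)"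

lemma ball_subset_cube: "ball x r \<subseteq> cube x r"
proof
  fix y assume "y \<in> ball x r"
  then have "norm (y - x) \<le> r" by (simp add: dist_norm norm_minus_commute)
  then show "y \<in> cube x r"
    using Basis_le_norm[of _ "y - x"] by (force simp: cube_def)
qed

lemma real_analytic_onI:
  assumes "\<And>x. x \<in> S \<Longrightarrow> analytic_at f x"
  shows "real_analytic_on f S"
  unfolding real_analytic_on_def
proof
  fix x assume "x \<in> S"
  then obtain r M c where r: "r > 0" and
    c: "\<And>y. y \<in> cube x r \<Longrightarrow> ((\<lambda>\<alpha>. c \<alpha> * monom_at \<alpha> (y - x)) has_sum f y) multi"
    using assms unfolding analytic_at_def power_series_at_def by blast
  have "(\<lambda>\<alpha>. c \<alpha> * monom_at \<alpha> (y - x)) summable_on multi \<and>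
      f y = (\<Sum>\<^sub>\<infinity>\<alpha>\<in>multi. c \<alpha> * monom_at \<alpha> (y - x))" if "y \<in> ball x r" for y
    using c[of y] that ball_subset_cube[of x r] by (auto simp: has_sum_iff)
  then show "\<exists>r>0. \<exists>coef. \<forall>y\<in>ball x r.
        (\<lambda>\<alpha>. coef \<alpha> * (\<Prod>b\<in>Basis. ((y - x) \<bullet> b) ^ \<alpha> b)) summable_on multi \<and>
        (y \<in> S \<longrightarrow> f y = (\<Sum>\<^sub>\<infinity>\<alpha>\<in>multi. coef \<alpha> * (\<Prod>b\<in>Basis. ((y - x) \<bullet> b) ^ \<alpha> b)))"
    unfolding monom_at_def using r by blast
qed

lemma analytic_at_const: "analytic_at (\<lambda>_. k) x"
  unfolding analytic_at_def using power_series_at_const[of 1 x k] by (intro exI[of _ 1]) auto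

lemma analytic_at_common_radius:
  assumes "analytic_at f x" "analytic_at g x"
  obtains r M N where "r > 0" "power_series_at x r M f" "power_series_at x r N g"
proof -
  obtain r M s N where "r > 0" "power_series_at x r M f" "s > 0" "power_series_at x s N g"
    using assms unfolding analytic_at_def by blast
  then show thesis
    using that[of "min r s" M N] power_series_at_smaller_radius[of "min r s" r x M f]
      power_series_at_smaller_radius[of "min r s" s x N g] by simp
qed

lemma analytic_at_add: "analytic_at f x \<Longrightarrow> analytic_at g x \<Longrightarrow> analytic_at (\<lambda>y. f y + g y) x"
  using analytic_at_common_radius[of f x g] power_series_at_add unfolding analytic_at_def by metis

lemma analytic_at_mult: "analytic_at f x \<Longrightarrow> analytic_at g x \<Longrightarrow> analytic_at (\<lambda>y. f y * g y) x"
  using analytic_at_common_radius[of f x g] power_series_at_mult unfolding analytic_at_def by metis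

lemma analytic_at_minus: "analytic_at f x \<Longrightarrow> analytic_at (\<lambda>y. - f y) x"
  using analytic_at_mult[OF analytic_at_const[of "-1" x], of f] by simp

lemma analytic_at_diff: "analytic_at f x \<Longrightarrow> analytic_at g x \<Longrightarrow> analytic_at (\<lambda>y. f y - g y) x"
  using analytic_at_add[of f x "\<lambda>y. - g y"] analytic_at_minus[of g x] by simp

lemma analytic_at_power: "analytic_at f x \<Longrightarrow> analytic_at (\<lambda>y. f y ^ n) x"
  by (induction n) (auto intro: analytic_at_const analytic_at_mult)

lemma analytic_at_sum:
  "finite B \<Longrightarrow> (\<And>b. b \<in> B \<Longrightarrow> analytic_at (f b) x) \<Longrightarrow> analytic_at (\<lambda>y. \<Sum>b\<in>B. f b y) x"
  by (induction B rule: finite_induct) (auto intro: analytic_at_const analytic_at_add)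

lemma analytic_at_linear:
  fixes f :: "'a::euclidean_space \<Rightarrow> real"
  assumes "bounded_linear f" shows "analytic_at f x"
proof -
  have coord: "analytic_at (\<lambda>y. (y - x) \<bullet> b) x" if "b \<in> Basis" for b
    unfolding analytic_at_def using power_series_at_coord[OF _ that, of 1 x] by (intro exI[of _ 1]) auto
  interpret bounded_linear f by fact
  have "f y = f x + (\<Sum>b\<in>Basis. ((y - x) \<bullet> b) * f b)" for y
  proof -
    have "f y = f x + f (y - x)" by (simp add: diff)
    also have "f (y - x) = f (\<Sum>b\<in>Basis. ((y - x) \<bullet> b) *\<^sub>R b)" by (simp only: euclidean_representation)
    finally show ?thesis by (simp add: sum scaleR)
  qed
  then have "f = (\<lambda>y. f x + (\<Sum>b\<in>Basis. ((y - x) \<bullet> b) * f b))" by (rule ext)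
  moreover have "analytic_at (\<lambda>y. f x + (\<Sum>b\<in>Basis. ((y - x) \<bullet> b) * f b)) x"
    by (intro analytic_at_add analytic_at_const analytic_at_sum finite_Basis analytic_at_mult coord)
  ultimately show ?thesis by simp
qed

lemma power_series_at_small_bound:
  assumes "analytic_at f x" "f x = 0" "\<delta> > 0"
  shows "\<exists>\<rho>>0. \<forall>r. 0 < r \<and> r \<le> \<rho> \<longrightarrow> power_series_at x r \<delta> f"
proof -
  obtain R M where R: "R > 0" and f: "power_series_at x R M f"
    using assms(1) unfolding analytic_at_def by blast
  have M: "M \<ge> 0" using power_series_at_nonneg[OF f] R by simp
  show ?thesis
  proof (intro exI[of _ "min R (R * \<delta> / (M + 1))"] conjI allI impI)
    show "min R (R * \<delta> / (M + 1)) > 0" using R M assms(3) by simp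
    fix r assume r: "0 < r \<and> r \<le> min R (R * \<delta> / (M + 1))"
    then have "r * (M + 1) \<le> R * \<delta>" using M by (simp add: pos_le_divide_eq)
    then have "M * (r / R) \<le> \<delta>" using r R by (simp add: field_simps)
    moreover have "power_series_at x r (M * (r / R)) f"
      using r by (intro power_series_at_shrink f assms(2)) auto
    ultimately show "power_series_at x r \<delta> f" by (rule power_series_at_mono[rotated])
  qed
qed

lemma analytic_at_compose:
  assumes f: "analytic_at f x" and "R > 0"
    and h: "\<And>t. \<bar>t\<bar> < R \<Longrightarrow> (\<lambda>n. a n * t ^ n) sums h (f x + t)"
  shows "analytic_at (\<lambda>y. h (f y)) x"
proof -
  have "analytic_at (\<lambda>y. f y - f x) x"
    by (intro analytic_at_diff f analytic_at_const)
  then obtain r where r: "r > 0" and g: "power_series_at x r (R / 2) (\<lambda>y. f y - f x)"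
    using power_series_at_small_bound[of "\<lambda>y. f y - f x" x "R / 2"] \<open>R > 0\<close> by auto
  \<comment> \<open>convergence at \<open>3R/4\<close> implies absolute convergence at \<open>R/2\<close>\<close>
  have "summable (\<lambda>n. a n * (3 * R / 4) ^ n)"
    using h[of "3 * R / 4"] \<open>R > 0\<close> by (auto simp: sums_iff)
  then have "summable (\<lambda>n. norm (a n * (R / 2) ^ n))"
    by (rule powser_insidea) (use \<open>R > 0\<close> in simp)
  then have "summable (\<lambda>n. \<bar>a n\<bar> * (R / 2) ^ n)"
    using \<open>R > 0\<close> by (simp add: abs_mult)
  from power_series_at_compose[OF r g this, of "\<lambda>t. h (f x + t)"] h \<open>R > 0\<close> r
  show ?thesis unfolding analytic_at_def by auto
qed

lemma analytic_at_sin: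
  assumes "analytic_at f x" shows "analytic_at (\<lambda>y. sin (f y)) x"
proof (rule analytic_at_compose[OF assms, of 1])
  fix t :: real
  have "(\<lambda>n. sin (f x) * (cos_coeff n * t ^ n) + cos (f x) * (sin_coeff n * t ^ n)) sums
      (sin (f x) * cos t + cos (f x) * sin t)"
    using sin_converges[of t] cos_converges[of t] by (intro sums_add sums_mult) simp_all
  then show "(\<lambda>n. (sin (f x) * cos_coeff n + cos (f x) * sin_coeff n) * t ^ n) sums sin (f x + t)"
    by (simp add: sin_add algebra_simps)
qed simp

lemma analytic_at_exp:
  assumes "analytic_at f x" shows "analytic_at (\<lambda>y. exp (f y)) x"
proof (rule analytic_at_compose[OF assms, of 1])
  fix t :: real
  show "(\<lambda>n. (exp (f x) / fact n) * t ^ n) sums exp (f x + t)"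
    using sums_mult[OF exp_converges[of t], of "exp (f x)"] by (simp add: exp_add field_simps)
qed simp

lemma analytic_at_inverse:
  assumes "analytic_at f x" "f x \<noteq> 0" shows "analytic_at (\<lambda>y. inverse (f y)) x"
proof (rule analytic_at_compose[OF assms(1), of "\<bar>f x\<bar>"])
  fix t :: real assume t: "\<bar>t\<bar> < \<bar>f x\<bar>"
  then have "norm (- (t / f x)) < 1" by simp
  from sums_mult[OF geometric_sums[OF this], of "inverse (f x)"]
  have "(\<lambda>n. inverse (f x) * (- (t / f x)) ^ n) sums (inverse (f x) * (1 / (1 - - (t / f x))))" .
  moreover have "inverse (f x) * (1 / (1 - - (t / f x))) = inverse (f x + t)"
    using assms(2) t by (simp add: field_simps)
  moreover have "(\<lambda>n. inverse (f x) * (- (t / f x)) ^ n) = (\<lambda>n. (inverse (f x) * (- 1 / f x) ^ n) * t ^ n)"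
    by (simp add: fun_eq_iff power_mult_distrib[symmetric])
  ultimately show "(\<lambda>n. (inverse (f x) * (- 1 / f x) ^ n) * t ^ n) sums inverse (f x + t)" by simp
qed (use assms(2) in simp)

text \<open>Where \<open>s\<close> does not vanish, only exponential, sine and reciprocal of analytic functions
  are involved.\<close>
lemma analytic_at_flat:
  assumes "analytic_at q x" "analytic_at s x" "s x \<noteq> 0"
  shows "analytic_at (\<lambda>y. exp (- 1 / (s y)^2) * sin (q y / s y)) x"
proof -
  have "analytic_at (\<lambda>y. exp (- ((inverse (s y))^2)) * sin (q y * inverse (s y))) x"
    by (intro analytic_at_mult analytic_at_exp analytic_at_minus analytic_at_power analytic_at_inverse
        analytic_at_sin assms)
  then show ?thesis by (simp add: power_inverse divide_inverse)
qed

text \<open>Restricting a convergent power series to an analytic curve: insert the series of the coordinates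
  of the curve, whose norms are small on a short interval.\<close>
lemma real_analytic_on_curve:
  fixes f :: "'a::euclidean_space \<Rightarrow> real" and \<gamma> :: "real \<Rightarrow> 'a"
  assumes f: "real_analytic_on f S" and \<gamma>: "\<And>t. \<gamma> t \<in> S"
    and an: "\<And>b. b \<in> Basis \<Longrightarrow> analytic_at (\<lambda>t. \<gamma> t \<bullet> b) t0"
  shows "analytic_at (\<lambda>t. f (\<gamma> t)) t0"
proof -
  let ?x = "\<gamma> t0"
  have "\<exists>r>0. \<exists>coef. \<forall>y\<in>ball ?x r. (\<lambda>\<alpha>. coef \<alpha> * monom_at \<alpha> (y - ?x)) summable_on multi \<and>
      (y \<in> S \<longrightarrow> f y = (\<Sum>\<^sub>\<infinity>\<alpha>\<in>multi. coef \<alpha> * monom_at \<alpha> (y - ?x)))"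
    using f \<gamma>[of t0] unfolding real_analytic_on_def monom_at_def by (rule bspec)
  then obtain r c where r: "r > 0" and
    c': "\<forall>y\<in>ball ?x r. (\<lambda>\<alpha>. c \<alpha> * monom_at \<alpha> (y - ?x)) summable_on multi \<and>
      (y \<in> S \<longrightarrow> f y = (\<Sum>\<^sub>\<infinity>\<alpha>\<in>multi. c \<alpha> * monom_at \<alpha> (y - ?x)))"
    by (elim exE conjE)
  have c: "(\<lambda>\<alpha>. c \<alpha> * monom_at \<alpha> (y - ?x)) summable_on multi"
      "y \<in> S \<Longrightarrow> f y = (\<Sum>\<^sub>\<infinity>\<alpha>\<in>multi. c \<alpha> * monom_at \<alpha> (y - ?x))" if "y \<in> ball ?x r" for y
    using bspec[OF c' that] by simp_all
  \<comment> \<open>small enough for the cube of radius \<open>\<delta>\<close> to lie in the ball of radius \<open>r\<close>\<close>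
  define \<delta> where "\<delta> = r / (DIM('a) + 1)"
  have \<delta>: "\<delta> > 0" using r by (simp add: \<delta>_def)
  have in_ball: "y \<in> ball ?x r" if "y \<in> cube ?x \<delta>" for y
  proof -
    have "norm (y - ?x) \<le> (\<Sum>b\<in>Basis. \<bar>(y - ?x) \<bullet> b\<bar>)" by (rule norm_le_l1)
    also have "\<dots> \<le> (\<Sum>b\<in>(Basis::'a set). \<delta>)"
      using that by (intro sum_mono) (auto simp: cube_def)
    also have "\<dots> < r" using r by (simp add: \<delta>_def field_simps)
    finally show ?thesis by (simp add: dist_norm norm_minus_commute)
  qed
  have abs: "(\<lambda>\<alpha>. \<bar>c \<alpha>\<bar> * \<delta> ^ mdeg \<alpha>) summable_on multi"
  proof -
    \<comment> \<open>at a corner of the cube every monomial takes the value \<open>\<delta>\<close> to its degree\<close>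
    let ?y = "?x + (\<Sum>b\<in>Basis. \<delta> *\<^sub>R b)"
    have coord: "(?y - ?x) \<bullet> b = \<delta>" if "b \<in> Basis" for b
      using inner_sum_left_Basis[OF that, of "\<lambda>_. \<delta>"] by simp
    then have "?y \<in> cube ?x \<delta>" using \<delta> by (simp add: cube_def)
    then have "(\<lambda>\<alpha>. c \<alpha> * monom_at \<alpha> (?y - ?x)) summable_on multi" by (intro c(1) in_ball)
    moreover have "monom_at \<alpha> (?y - ?x) = \<delta> ^ mdeg \<alpha>" for \<alpha>
      unfolding monom_at_def mdeg_def power_sum using coord by (intro prod.cong) auto
    ultimately have "(\<lambda>\<alpha>. c \<alpha> * \<delta> ^ mdeg \<alpha>) summable_on multi" by simp
    then have "(\<lambda>\<alpha>. norm (c \<alpha> * \<delta> ^ mdeg \<alpha>)) summable_on multi"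
      by (rule summable_on_iff_abs_summable_on_real[THEN iffD1])
    then show ?thesis using \<delta> by (simp add: abs_mult)
  qed
  define d where "d b t = \<gamma> t \<bullet> b - ?x \<bullet> b" for b t
  have "\<forall>b\<in>Basis. \<exists>\<rho>>0. \<forall>s. 0 < s \<and> s \<le> \<rho> \<longrightarrow> power_series_at t0 s \<delta> (d b)"
  proof
    fix b :: 'a assume "b \<in> Basis"
    then have "analytic_at (d b) t0"
      unfolding d_def[abs_def] by (intro analytic_at_diff an analytic_at_const)
    then show "\<exists>\<rho>>0. \<forall>s. 0 < s \<and> s \<le> \<rho> \<longrightarrow> power_series_at t0 s \<delta> (d b)"
      by (rule power_series_at_small_bound) (use \<delta> in \<open>simp_all add: d_def\<close>)
  qed
  from bchoice[OF this] obtain \<rho> where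
    \<rho>: "\<forall>b\<in>Basis. \<rho> b > 0 \<and> (\<forall>s. 0 < s \<and> s \<le> \<rho> b \<longrightarrow> power_series_at t0 s \<delta> (d b))" by (rule exE)
  define s where "s = Min (\<rho> ` Basis)"
  have s: "s > 0" using \<rho> by (simp add: s_def)
  have ds: "power_series_at t0 s \<delta> (d b)" if "b \<in> Basis" for b
    using bspec[OF \<rho> that] s that by (auto simp: s_def)
  have "power_series_at t0 s (\<Sum>\<^sub>\<infinity>\<alpha>\<in>multi. \<bar>c \<alpha>\<bar> * \<delta> ^ mdeg \<alpha>) (\<lambda>t. f (\<gamma> t))"
  proof (rule power_series_at_sums[OF s _ abs])
    fix \<alpha> :: "'a \<Rightarrow> nat"
    have "power_series_at t0 s (\<Prod>b\<in>Basis. \<delta> ^ \<alpha> b) (\<lambda>t. \<Prod>b\<in>Basis. d b t ^ \<alpha> b)"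
      by (intro power_series_at_prod s finite_Basis power_series_at_power ds)
    then have "power_series_at t0 s (\<delta> ^ mdeg \<alpha>) (\<lambda>t. monom_at \<alpha> (\<gamma> t - ?x))"
      by (simp add: monom_at_def mdeg_def power_sum d_def inner_diff_left)
    then show "power_series_at t0 s (\<bar>c \<alpha>\<bar> * \<delta> ^ mdeg \<alpha>) (\<lambda>t. c \<alpha> * monom_at \<alpha> (\<gamma> t - ?x))"
      by (intro power_series_at_mult power_series_at_const s)
  next
    fix t assume t: "t \<in> cube t0 s"
    have "\<gamma> t \<in> cube ?x \<delta>"
      using power_series_at_bound[OF ds t] by (auto simp: cube_def d_def inner_diff_left)
    then have "\<gamma> t \<in> ball ?x r" by (rule in_ball)
    from c[OF this] \<gamma>[of t]
    show "((\<lambda>\<alpha>. c \<alpha> * monom_at \<alpha> (\<gamma> t - ?x)) has_sum f (\<gamma> t)) multi"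
      by (auto simp: has_sum_iff)
  qed
  then show ?thesis using s unfolding analytic_at_def by blast
qed

text \<open>The coefficients vanish one after the other: if those below \<open>n\<close> do, then \<open>G\<close> divided by
  \<open>(t - t0)\<^sup>n\<close> tends to the \<open>n\<close>-th coefficient, and to \<open>0\<close> by flatness of order \<open>n + 1\<close>.\<close>
lemma analytic_flat_imp_zero:
  fixes G :: "real \<Rightarrow> real"
  assumes an: "analytic_at G t0" and fl: "\<And>n. \<exists>C. \<forall>t. \<bar>G t\<bar> \<le> C * \<bar>t - t0\<bar> ^ n"
  obtains r where "r > 0" "\<And>t. \<bar>t - t0\<bar> \<le> r \<Longrightarrow> G t = 0"
proof -
  from an obtain r M where r: "r > 0" and G: "power_series_at t0 r M G"
    unfolding analytic_at_def by (elim exE conjE)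
  from G obtain c where
    c: "\<forall>y\<in>cube t0 r. ((\<lambda>\<alpha>. c \<alpha> * monom_at \<alpha> (y - t0)) has_sum G y) multi"
    unfolding power_series_at_def by (elim exE conjE)
  define a where "a n = c (\<lambda>b\<in>{1}. n)" for n :: nat
  have bij: "bij_betw (\<lambda>n. \<lambda>b\<in>{1}. n) UNIV (multi :: (real \<Rightarrow> nat) set)"
    by (rule bij_betwI[where g = "\<lambda>\<alpha>. \<alpha> 1"]) (auto simp: fun_eq_iff PiE_iff extensional_def)
  have a: "(\<lambda>n. a n * t ^ n) sums G (t0 + t)" if "\<bar>t\<bar> \<le> r" for t
  proof -
    have "t0 + t \<in> cube t0 r" using that by (simp add: cube_def)
    from has_sum_reindex_bij_betw[OF bij, THEN iffD2, OF bspec[OF c this]]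
    have "((\<lambda>n. a n * t ^ n) has_sum G (t0 + t)) UNIV"
      by (simp add: a_def monom_at_def)
    then show ?thesis by (rule has_sum_imp_sums)
  qed
  have "a n = 0" for n
  proof (induction n rule: less_induct)
    case (less n)
    define H where "H t = (if t = 0 then a n else G (t0 + t) / t ^ n)" for t
    have "(\<lambda>k. a (k + n) * t ^ k) sums H t" if "norm t < r" for t
    proof (cases "t = 0")
      case True
      then show ?thesis using powser_sums_zero[of "\<lambda>k. a (k + n)"] by (simp add: H_def)
    next
      case False
      have "(\<lambda>k. a (k + n) * t ^ (k + n)) sums G (t0 + t)"
        using sums_iff_shift[of "\<lambda>k. a k * t ^ k" n "G (t0 + t)"] a[of t] that less by simp
      from sums_mult[OF this, of "1 / t ^ n"] show ?thesis
        using False by (simp add: H_def power_add field_simps)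
    qed
    then have lim: "(H \<longlongrightarrow> a (0 + n)) (at 0)" by (rule powser_limit_0[OF r])
    obtain C where C: "\<And>t. \<bar>G t\<bar> \<le> C * \<bar>t - t0\<bar> ^ Suc n" using fl[of "Suc n"] by blast
    have "(H \<longlongrightarrow> 0) (at 0)"
    proof (rule Lim_null_comparison)
      show "\<forall>\<^sub>F t in at 0. norm (H t) \<le> C * \<bar>t\<bar>"
        unfolding eventually_at_filter
      proof (intro always_eventually allI impI)
        fix t :: real assume "t \<noteq> 0"
        have "\<bar>G (t0 + t)\<bar> / \<bar>t\<bar> ^ n \<le> (C * \<bar>t\<bar> ^ Suc n) / \<bar>t\<bar> ^ n"
          using C[of "t0 + t"] by (intro divide_right_mono) auto
        then show "norm (H t) \<le> C * \<bar>t\<bar>" using \<open>t \<noteq> 0\<close> by (simp add: H_def power_abs)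
      qed
      show "((\<lambda>t. C * \<bar>t\<bar>) \<longlongrightarrow> 0) (at 0)" by (auto intro!: tendsto_eq_intros)
    qed
    with lim show "a n = 0" using tendsto_unique[of "at (0::real)" H "a n" 0] by simp
  qed
  then have "G t = 0" if "\<bar>t - t0\<bar> \<le> r" for t
    using a[OF that] sums_unique[of "\<lambda>_. 0 :: real"] by (simp add: sums_iff)
  with r that show thesis by blast
qed

section \<open>The first integrals in the left-invariant frame\<close>

abbreviation vel :: "4 \<Rightarrow> tvec \<Rightarrow> real" where
  "vel i x \<equiv> to_alg (fst x) (snd x) $ i"

abbreviation pos :: "4 \<Rightarrow> tvec \<Rightarrow> real" where
  "pos i x \<equiv> fst x $ i"

lemma I_fun_eq:
  "I_fun (mag_form a b c \<rho>) 1 x = vel 1 x + pos 2 x * vel 3 x + \<rho> * pos 2 x + a * pos 3 x + c * pos 4 x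
     - pos 2 x * (a * pos 1 x + b * pos 2 x) / 2"
  "I_fun (mag_form a b c \<rho>) 2 x = vel 2 x - pos 1 x * vel 3 x - \<rho> * pos 1 x + b * pos 3 x
     + pos 1 x * (a * pos 1 x + b * pos 2 x) / 2"
  "I_fun (mag_form a b c \<rho>) 3 x = vel 3 x - a * pos 1 x - b * pos 2 x"
  "I_fun (mag_form a b c \<rho>) 4 x = vel 4 x - c * pos 1 x"
  by (simp_all add: I_fun_def Let_def inner4 lorentz_nth bracket_nth axis_def field_simps)

text \<open>For \<open>a \<noteq> 0\<close> the terms of \<open>I\<^sub>2\<close> that contain the first position coordinate cancel against those of the
  square. In the same way \<open>g2\<close> loses all position coordinates.\<close>
lemma f2_eq:
  "a \<noteq> 0 \<Longrightarrow> f2 a c \<rho> x = vel 2 x - (vel 3 x + \<rho>)^2 / (2 * a)"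
  "f2 0 c \<rho> x = flat 0 0 (pi * (vel 2 x - pos 1 x * (vel 3 x + \<rho>))) (vel 3 x + \<rho>)"
  by (simp_all add: f2_def Let_def I_fun_eq flat_def field_simps power2_eq_square)

lemma f3_eq: "f3 a c \<rho> x = (if a \<noteq> 0 then sin (pi / a * vel 3 x - pi * pos 1 x) else vel 3 x)"
  by (simp add: f3_def I_fun_eq right_diff_distrib diff_divide_distrib)

lemma f4_eq: "f4 a c \<rho> x = (if c \<noteq> 0 then sin (pi / c * vel 4 x - pi * pos 1 x) else vel 4 x)"
  by (simp add: f4_def I_fun_eq right_diff_distrib diff_divide_distrib)

lemma g2_eq: "g2 a b \<rho> x = b * vel 1 x - a * vel 2 x + (vel 3 x + \<rho>)^2 / 2"
  by (simp add: g2_def I_fun_eq field_simps power2_eq_square)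

lemma g3_eq: "g3 a b \<rho> x = sin (2 * pi * (vel 3 x - a * pos 1 x - b * pos 2 x))"
  by (simp add: g3_def I_fun_eq)

lemma g4_eq: "g4 a b \<rho> x = vel 4 x"
  by (simp add: g4_def I_fun_eq)

subsection \<open>Smoothness and analyticity\<close>

lemma bounded_linear_tvec:
  "bounded_linear (\<lambda>x::tvec. pos i x)" "bounded_linear (\<lambda>x::tvec. snd x $ i)"
  by (rule bounded_linear_compose[OF bounded_linear_vec_nth bounded_linear_fst]
      bounded_linear_compose[OF bounded_linear_vec_nth bounded_linear_snd])+

lemmas elementary_coord = bounded_linear_tvec[THEN elementary.linear]
lemmas analytic_at_coord = bounded_linear_tvec[THEN analytic_at_linear]

text \<open>Only the third component of \<open>to_alg\<close> is not one of the standard coordinates; in either case it is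
  a polynomial in them.\<close>
lemma vel_cases: "vel i = (\<lambda>x. snd x $ i) \<or>
    vel i = (\<lambda>x. snd x $ 3 - (1 / 2) * (pos 1 x * snd x $ 2 - pos 2 x * snd x $ 1))"
  using exhaust_4[of i] by (auto simp: to_alg_nth fun_eq_iff)

lemma elementary_vel: "elementary (vel i)"
proof -
  have "elementary (\<lambda>x::tvec. snd x $ 3 - (1 / 2) * (pos 1 x * snd x $ 2 - pos 2 x * snd x $ 1))"
    by (intro elementary_intros elementary_coord)
  then show ?thesis using vel_cases[of i] elementary_coord(2)[of i] by (elim disjE) (simp_all only:)
qed

lemma analytic_at_vel: "analytic_at (vel i) x"
proof -
  have "analytic_at (\<lambda>x::tvec. snd x $ 3 - (1 / 2) * (pos 1 x * snd x $ 2 - pos 2 x * snd x $ 1)) x"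
    by (intro analytic_at_diff analytic_at_mult analytic_at_const analytic_at_coord)
  then show ?thesis using vel_cases[of i] analytic_at_coord(2)[of i x] by (elim disjE) (simp_all only:)
qed

lemmas elementary_tvec = elementary_intros elementary_coord(1) elementary_vel
lemmas analytic_at_tvec = analytic_at_diff analytic_at_add analytic_at_mult analytic_at_power
  analytic_at_sin analytic_at_const analytic_at_coord(1) analytic_at_vel

lemma elementary_integrals:
  "elementary (f2 a c \<rho>)" "elementary (f3 a c \<rho>)" "elementary (f4 a c \<rho>)"
  "elementary (g2 a b \<rho>)" "elementary (g3 a b \<rho>)" "elementary (g4 a b \<rho>)"
proof -
  have "elementary (\<lambda>x. vel 2 x - 1 / (2 * a) * (vel 3 x + \<rho>)^2)"
    "elementary (\<lambda>x. flat 0 0 (pi * (vel 2 x - pos 1 x * (vel 3 x + \<rho>))) (vel 3 x + \<rho>))"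
    by (intro elementary_tvec)+
  moreover have "f2 a c \<rho> = (if a = 0
      then (\<lambda>x. flat 0 0 (pi * (vel 2 x - pos 1 x * (vel 3 x + \<rho>))) (vel 3 x + \<rho>))
      else (\<lambda>x. vel 2 x - 1 / (2 * a) * (vel 3 x + \<rho>)^2))"
    by (rule ext) (simp add: f2_eq)
  ultimately show "elementary (f2 a c \<rho>)" by simp
  have "elementary (\<lambda>x. sin (pi / k * vel i x - pi * pos 1 x))" for i k
    by (intro elementary_tvec)
  then show "elementary (f3 a c \<rho>)" "elementary (f4 a c \<rho>)"
    unfolding f3_eq[abs_def] f4_eq[abs_def]
    by (cases "a = 0"; cases "c = 0"; simp add: elementary_vel)+
  have "elementary (\<lambda>x. b * vel 1 x - a * vel 2 x + (1 / 2) * (vel 3 x + \<rho>)^2)"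
    by (intro elementary_tvec)
  then show "elementary (g2 a b \<rho>)" by (simp add: g2_eq[abs_def])
  show "elementary (g3 a b \<rho>)" unfolding g3_eq[abs_def] by (intro elementary_tvec)
  show "elementary (g4 a b \<rho>)" unfolding g4_eq[abs_def] by (intro elementary_tvec)
qed

lemma analytic_integrals:
  "a \<noteq> 0 \<or> vel 3 x + \<rho> \<noteq> 0 \<Longrightarrow> analytic_at (f2 a c \<rho>) x"
  "analytic_at (f3 a c \<rho>) x" "analytic_at (f4 a c \<rho>) x"
  "analytic_at (g2 a b \<rho>) x" "analytic_at (g3 a b \<rho>) x" "analytic_at (g4 a b \<rho>) x"
proof -
  show "analytic_at (f2 a c \<rho>) x" if "a \<noteq> 0 \<or> vel 3 x + \<rho> \<noteq> 0"
  proof (cases "a = 0")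
    case False
    have "f2 a c \<rho> = (\<lambda>x. vel 2 x - 1 / (2 * a) * (vel 3 x + \<rho>)^2)"
      by (rule ext) (simp add: f2_eq False)
    moreover have "analytic_at (\<lambda>x. vel 2 x - 1 / (2 * a) * (vel 3 x + \<rho>)^2) x"
      by (intro analytic_at_tvec)
    ultimately show ?thesis by simp
  next
    case True
    \<comment> \<open>With \<open>1/0 = 0\<close> the formula is correct also where \<open>s = 0\<close>, since then \<open>sin\<close> vanishes.\<close>
    have "f2 a c \<rho> = (\<lambda>x. exp (- 1 / (vel 3 x + \<rho>)^2) *
        sin (pi * (vel 2 x - pos 1 x * (vel 3 x + \<rho>)) / (vel 3 x + \<rho>)))"
      by (rule ext) (simp add: f2_eq True flat_def)
    moreover have "analytic_at (\<lambda>x. exp (- 1 / (vel 3 x + \<rho>)^2) *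
        sin (pi * (vel 2 x - pos 1 x * (vel 3 x + \<rho>)) / (vel 3 x + \<rho>))) x"
      using that True by (intro analytic_at_flat analytic_at_tvec) auto
    ultimately show ?thesis by simp
  qed
  have "analytic_at (\<lambda>x. sin (pi / k * vel i x - pi * pos 1 x)) x" for i k
    by (intro analytic_at_tvec)
  then show "analytic_at (f3 a c \<rho>) x" "analytic_at (f4 a c \<rho>) x"
    unfolding f3_eq[abs_def] f4_eq[abs_def]
    by (cases "a = 0"; cases "c = 0"; simp add: analytic_at_vel)+
  have "analytic_at (\<lambda>x. b * vel 1 x - a * vel 2 x + (1 / 2) * (vel 3 x + \<rho>)^2) x"
    by (intro analytic_at_tvec)
  then show "analytic_at (g2 a b \<rho>) x" by (simp add: g2_eq[abs_def])
  show "analytic_at (g3 a b \<rho>) x" unfolding g3_eq[abs_def] by (intro analytic_at_tvec)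
  show "analytic_at (g4 a b \<rho>) x" unfolding g4_eq[abs_def] by (intro analytic_at_tvec)
qed

subsection \<open>Conservation\<close>

definition conserved :: "(real^4 \<Rightarrow> real^4 \<Rightarrow> real) \<Rightarrow> (tvec \<Rightarrow> real) \<Rightarrow> bool" where
  "conserved \<omega> f \<longleftrightarrow>
     (\<forall>J \<gamma>. magnetic_geodesic \<omega> J \<gamma> \<longrightarrow> (\<lambda>t. f (\<gamma> t, velocity \<gamma> t)) constant_on J)"

lemma conservedI:
  assumes "\<And>J \<gamma> t. magnetic_geodesic \<omega> J \<gamma> \<Longrightarrow> t \<in> J \<Longrightarrow>
    ((\<lambda>t. f (\<gamma> t, velocity \<gamma> t)) has_real_derivative 0) (at t)"
  shows "conserved \<omega> f"
  unfolding conserved_def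
  using assms by (intro allI impI zero_derivative_imp_constant_on) (auto simp: magnetic_geodesic_def)

lemma conserved_compose:
  assumes "conserved \<omega> f" shows "conserved \<omega> (\<lambda>x. h (f x))"
  unfolding conserved_def
proof (intro allI impI)
  fix J \<gamma> assume "magnetic_geodesic \<omega> J \<gamma>"
  then obtain k where "\<forall>t\<in>J. f (\<gamma> t, velocity \<gamma> t) = k"
    using assms unfolding conserved_def constant_on_def by blast
  then show "(\<lambda>t. h (f (\<gamma> t, velocity \<gamma> t))) constant_on J"
    unfolding constant_on_def by (intro exI[of _ "h k"]) simp
qed

lemma conserved_compose2:
  assumes "conserved \<omega> f" "conserved \<omega> g" shows "conserved \<omega> (\<lambda>x. h (f x) (g x))"
  unfolding conserved_def
proof (intro allI impI)
  fix J \<gamma> assume J: "magnetic_geodesic \<omega> J \<gamma>"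
  obtain k where "\<forall>t\<in>J. f (\<gamma> t, velocity \<gamma> t) = k"
    using J assms(1) unfolding conserved_def constant_on_def by blast
  moreover obtain l where "\<forall>t\<in>J. g (\<gamma> t, velocity \<gamma> t) = l"
    using J assms(2) unfolding conserved_def constant_on_def by blast
  ultimately show "(\<lambda>t. h (f (\<gamma> t, velocity \<gamma> t)) (g (\<gamma> t, velocity \<gamma> t))) constant_on J"
    unfolding constant_on_def by (intro exI[of _ "h k l"]) simp
qed

lemma conserved_linear_integrals:
  "conserved (mag_form a b c \<rho>) (\<lambda>x. vel 3 x - a * pos 1 x - b * pos 2 x)"
  "conserved (mag_form a b c \<rho>) (\<lambda>x. vel 4 x - c * pos 1 x)"
proof -
  show "conserved (mag_form a b c \<rho>) (\<lambda>x. vel 3 x - a * pos 1 x - b * pos 2 x)"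
  proof (rule conservedI)
    fix J \<gamma> t assume "magnetic_geodesic (mag_form a b c \<rho>) J \<gamma>" "t \<in> J"
    note d = magnetic_geodesic_derivatives[OF this]
    show "((\<lambda>t. vel 3 (\<gamma> t, velocity \<gamma> t) - a * pos 1 (\<gamma> t, velocity \<gamma> t)
        - b * pos 2 (\<gamma> t, velocity \<gamma> t)) has_real_derivative 0) (at t)"
      unfolding fst_conv snd_conv
      by (rule DERIV_cong, (rule DERIV_diff DERIV_cmult d)+) simp
  qed
  show "conserved (mag_form a b c \<rho>) (\<lambda>x. vel 4 x - c * pos 1 x)"
  proof (rule conservedI)
    fix J \<gamma> t assume "magnetic_geodesic (mag_form a b c \<rho>) J \<gamma>" "t \<in> J"
    note d = magnetic_geodesic_derivatives[OF this]
    show "((\<lambda>t. vel 4 (\<gamma> t, velocity \<gamma> t) - c * pos 1 (\<gamma> t, velocity \<gamma> t))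
        has_real_derivative 0) (at t)"
      unfolding fst_conv snd_conv
      by (rule DERIV_cong, (rule DERIV_diff DERIV_cmult d)+) simp
  qed
qed

lemma conserved_f:
  "conserved (mag_form a 0 c \<rho>) (f2 a c \<rho>)" "conserved (mag_form a 0 c \<rho>) (f3 a c \<rho>)"
  "conserved (mag_form a 0 c \<rho>) (f4 a c \<rho>)"
proof -
  let ?\<omega> = "mag_form a 0 c \<rho>"
  have 3: "conserved ?\<omega> (\<lambda>x. vel 3 x - a * pos 1 x)"
    using conserved_linear_integrals(1)[of a 0 c \<rho>] by simp
  have 4: "conserved ?\<omega> (\<lambda>x. vel 4 x - c * pos 1 x)"
    by (rule conserved_linear_integrals)
  show "conserved ?\<omega> (f2 a c \<rho>)"
  proof (cases "a = 0")
    case False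
    have "conserved ?\<omega> (\<lambda>x. vel 2 x - (vel 3 x + \<rho>)^2 / (2 * a))"
    proof (rule conservedI)
      fix J \<gamma> t assume "magnetic_geodesic ?\<omega> J \<gamma>" "t \<in> J"
      note d = magnetic_geodesic_derivatives[OF this]
      show "((\<lambda>t. vel 2 (\<gamma> t, velocity \<gamma> t) - (vel 3 (\<gamma> t, velocity \<gamma> t) + \<rho>)^2 / (2 * a))
          has_real_derivative 0) (at t)"
        unfolding fst_conv snd_conv power2_eq_square
        by (rule DERIV_cong, (rule DERIV_diff DERIV_add DERIV_cdivide DERIV_mult DERIV_const d)+)
          (use False in \<open>simp add: field_simps\<close>)
    qed
    then show ?thesis by (simp add: f2_eq(1)[OF False, abs_def])
  next
    case True
    have "conserved ?\<omega> (\<lambda>x. vel 2 x - pos 1 x * (vel 3 x + \<rho>))"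
    proof (rule conservedI)
      fix J \<gamma> t assume "magnetic_geodesic ?\<omega> J \<gamma>" "t \<in> J"
      note d = magnetic_geodesic_derivatives[OF this]
      show "((\<lambda>t. vel 2 (\<gamma> t, velocity \<gamma> t) - pos 1 (\<gamma> t, velocity \<gamma> t) * (vel 3 (\<gamma> t, velocity \<gamma> t) + \<rho>))
          has_real_derivative 0) (at t)"
        unfolding fst_conv snd_conv
        by (rule DERIV_cong, (rule DERIV_diff DERIV_add DERIV_mult DERIV_const d)+)
          (simp add: True algebra_simps)
    qed
    from conserved_compose2[OF this 3, of "\<lambda>q v. flat 0 0 (pi * q) (v + \<rho>)"]
    show ?thesis using True by (simp add: f2_eq(2)[abs_def])
  qed
  show "conserved ?\<omega> (f3 a c \<rho>)"
    using conserved_compose[OF 3, of "\<lambda>v. if a \<noteq> 0 then sin (pi / a * v) else v"]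
    by (cases "a = 0") (simp_all add: f3_eq[abs_def] right_diff_distrib diff_divide_distrib)
  show "conserved ?\<omega> (f4 a c \<rho>)"
    using conserved_compose[OF 4, of "\<lambda>v. if c \<noteq> 0 then sin (pi / c * v) else v"]
    by (cases "c = 0") (simp_all add: f4_eq[abs_def] right_diff_distrib diff_divide_distrib)
qed

lemma conserved_g:
  "conserved (mag_form a b 0 \<rho>) (g2 a b \<rho>)" "conserved (mag_form a b 0 \<rho>) (g3 a b \<rho>)"
  "conserved (mag_form a b 0 \<rho>) (g4 a b \<rho>)"
proof -
  show "conserved (mag_form a b 0 \<rho>) (g2 a b \<rho>)"
    unfolding g2_eq[abs_def]
  proof (rule conservedI)
    fix J \<gamma> t assume "magnetic_geodesic (mag_form a b 0 \<rho>) J \<gamma>" "t \<in> J"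
    note d = magnetic_geodesic_derivatives[OF this]
    show "((\<lambda>t. b * vel 1 (\<gamma> t, velocity \<gamma> t) - a * vel 2 (\<gamma> t, velocity \<gamma> t)
        + (vel 3 (\<gamma> t, velocity \<gamma> t) + \<rho>)^2 / 2) has_real_derivative 0) (at t)"
      unfolding fst_conv snd_conv power2_eq_square
      by (rule DERIV_cong,
          (rule DERIV_diff DERIV_add DERIV_cmult DERIV_cdivide DERIV_mult DERIV_const d)+)
        (simp add: field_simps)
  qed
  show "conserved (mag_form a b 0 \<rho>) (g3 a b \<rho>)"
    using conserved_compose[OF conserved_linear_integrals(1)[of a b 0 \<rho>], of "\<lambda>v. sin (2 * pi * v)"]
    by (simp add: g3_eq[abs_def])
  show "conserved (mag_form a b 0 \<rho>) (g4 a b \<rho>)"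
    using conserved_linear_integrals(2)[of a b 0 \<rho>] by (simp add: g4_eq[abs_def])
qed

subsection \<open>Gradients and Poisson brackets\<close>

lemma frame_grad_cong: "frame_grad f l m x \<Longrightarrow> f = f' \<Longrightarrow> l = l' \<Longrightarrow> m = m' \<Longrightarrow> frame_grad f' l' m' x"
  by simp

lemma frame_grad_diff:
  "frame_grad f l m x \<Longrightarrow> frame_grad g l' m' x \<Longrightarrow> frame_grad (\<lambda>x. f x - g x) (l - l') (m - m') x"
  unfolding frame_grad_def
  by (drule (1) has_derivative_diff, erule has_derivative_eq_rhs) (simp add: fun_eq_iff inner_diff_left)

lemma frame_grad_cmult: "frame_grad f l m x \<Longrightarrow> frame_grad (\<lambda>x. k * f x) (k *\<^sub>R l) (k *\<^sub>R m) x"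
  using frame_grad_mult[OF frame_grad_const[of k x]] by simp

lemma frame_grad_sin:
  "frame_grad f l m x \<Longrightarrow> frame_grad (\<lambda>x. sin (f x)) (cos (f x) *\<^sub>R l) (cos (f x) *\<^sub>R m) x"
  by (rule frame_grad_chain[OF _ DERIV_sin])

lemmas frame_grad_rules = frame_grad_diff frame_grad_add frame_grad_sin frame_grad_cmult
  frame_grad_mult frame_grad_const frame_grad_vel frame_grad_base

lemma frame_grad_f2:
  assumes "a \<noteq> 0"
  shows "frame_grad (f2 a c \<rho>) 0 (basis4 2 - ((vel 3 x + \<rho>) / a) *\<^sub>R basis4 3) x"
proof (rule frame_grad_cong)
  show "frame_grad (\<lambda>x. vel 2 x - 1 / (2 * a) * ((vel 3 x + \<rho>) * (vel 3 x + \<rho>)))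
     (0 - (1 / (2 * a)) *\<^sub>R ((vel 3 x + \<rho>) *\<^sub>R (0 + 0) + (vel 3 x + \<rho>) *\<^sub>R (0 + 0)))
     (basis4 2 - (1 / (2 * a)) *\<^sub>R ((vel 3 x + \<rho>) *\<^sub>R (basis4 3 + 0) + (vel 3 x + \<rho>) *\<^sub>R (basis4 3 + 0))) x"
    by (intro frame_grad_rules)
qed (use assms in \<open>auto simp: f2_eq fun_eq_iff power2_eq_square vec4_eq_iff field_simps\<close>)

text \<open>The factor \<open>flat 1 (\<pi>/2)\<close> is
  \<open>exp (-1/s\<^sup>2) cos (q/s) / s\<close>, the partial derivative of the flat function in \<open>q\<close>.\<close>
lemma frame_grad_f2_flat:
  fixes x :: tvec and \<rho> :: real
  defines "q \<equiv> pi * (vel 2 x - pos 1 x * (vel 3 x + \<rho>))" and "s \<equiv> vel 3 x + \<rho>"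
  shows "\<exists>d. frame_grad (f2 0 c \<rho>) (- (pi * s * flat 1 (pi / 2) q s) *\<^sub>R basis4 1)
    ((pi * flat 1 (pi / 2) q s) *\<^sub>R basis4 2 + d *\<^sub>R basis4 3) x"
proof -
  have s: "frame_grad (\<lambda>x. vel 3 x + \<rho>) 0 (basis4 3) x"
    by (rule frame_grad_cong[OF _ refl], rule frame_grad_add[OF frame_grad_vel frame_grad_const]) auto
  have q: "frame_grad (\<lambda>x. pi * (vel 2 x - pos 1 x * (vel 3 x + \<rho>)))
      (- (pi * s) *\<^sub>R basis4 1) (pi *\<^sub>R basis4 2 - (pi * pos 1 x) *\<^sub>R basis4 3) x"
    by (rule frame_grad_cong[OF _ refl], rule frame_grad_cmult[OF frame_grad_diff[OF frame_grad_vel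
            frame_grad_mult[OF frame_grad_base(1) s]]])
      (auto simp: s_def vec4_eq_iff algebra_simps)
  show ?thesis
    by (rule exI, rule frame_grad_cong, rule frame_grad_flat[OF q s, of 0 0])
      (auto simp: f2_eq(2) fun_eq_iff vec4_eq_iff q_def s_def axis_def)
qed

lemma frame_grad_sin_affine:
  fixes x :: tvec and k :: real and i :: 4
  defines "r \<equiv> cos (k * vel i x - pi * pos 1 x)"
  shows "frame_grad (\<lambda>x. sin (k * vel i x - pi * pos 1 x)) (- (pi * r) *\<^sub>R basis4 1) ((k * r) *\<^sub>R basis4 i) x"
  by (rule frame_grad_cong[OF _ refl], rule frame_grad_sin[OF frame_grad_diff[OF
          frame_grad_cmult[OF frame_grad_vel] frame_grad_cmult[OF frame_grad_base(1)]]])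
    (auto simp: r_def)

lemma frame_grad_f3:
  "frame_grad (f3 a c \<rho>) (if a = 0 then 0 else - (pi * cos (pi / a * vel 3 x - pi * pos 1 x)) *\<^sub>R basis4 1)
    (if a = 0 then basis4 3 else (pi / a * cos (pi / a * vel 3 x - pi * pos 1 x)) *\<^sub>R basis4 3) x"
  using frame_grad_vel[of 3 x] frame_grad_sin_affine[of "pi / a" 3 x]
  by (cases "a = 0") (simp_all add: f3_eq[abs_def])

lemma frame_grad_f4:
  "frame_grad (f4 a c \<rho>) (if c = 0 then 0 else - (pi * cos (pi / c * vel 4 x - pi * pos 1 x)) *\<^sub>R basis4 1)
    (if c = 0 then basis4 4 else (pi / c * cos (pi / c * vel 4 x - pi * pos 1 x)) *\<^sub>R basis4 4) x"
  using frame_grad_vel[of 4 x] frame_grad_sin_affine[of "pi / c" 4 x]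
  by (cases "c = 0") (simp_all add: f4_eq[abs_def])

lemma frame_grad_g2:
  "frame_grad (g2 a b \<rho>) 0 (b *\<^sub>R basis4 1 - a *\<^sub>R basis4 2 + (vel 3 x + \<rho>) *\<^sub>R basis4 3) x"
proof (rule frame_grad_cong)
  show "frame_grad (\<lambda>x. b * vel 1 x - a * vel 2 x + 1 / 2 * ((vel 3 x + \<rho>) * (vel 3 x + \<rho>)))
     (b *\<^sub>R 0 - a *\<^sub>R 0 + (1 / 2) *\<^sub>R ((vel 3 x + \<rho>) *\<^sub>R (0 + 0) + (vel 3 x + \<rho>) *\<^sub>R (0 + 0)))
     (b *\<^sub>R basis4 1 - a *\<^sub>R basis4 2
       + (1 / 2) *\<^sub>R ((vel 3 x + \<rho>) *\<^sub>R (basis4 3 + 0) + (vel 3 x + \<rho>) *\<^sub>R (basis4 3 + 0))) x"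
    by (intro frame_grad_rules)
qed (auto simp: g2_eq fun_eq_iff power2_eq_square vec4_eq_iff field_simps)

lemma frame_grad_g3:
  fixes x :: tvec and a b :: real
  defines "k \<equiv> 2 * pi * cos (2 * pi * (vel 3 x - a * pos 1 x - b * pos 2 x))"
  shows "frame_grad (g3 a b \<rho>) (- (k * a) *\<^sub>R basis4 1 - (k * b) *\<^sub>R basis4 2) (k *\<^sub>R basis4 3) x"
  unfolding g3_eq[abs_def]
  by (rule frame_grad_cong[OF _ refl], rule frame_grad_sin[OF frame_grad_cmult[OF frame_grad_diff[OF
      frame_grad_diff[OF frame_grad_vel frame_grad_cmult[OF frame_grad_base(1)]]
      frame_grad_cmult[OF frame_grad_base(2)]]]])
    (auto simp: k_def algebra_simps)

lemma frame_grad_g4: "frame_grad (g4 a b \<rho>) 0 (basis4 4) x"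
  using frame_grad_vel[of 4 x] by (simp add: g4_eq[abs_def])

lemma frame_grad_f_shape:
  assumes "f \<in> {f2 a c \<rho>, f3 a c \<rho>, f4 a c \<rho>}"
  shows "\<exists>l m. frame_grad f l m x \<and> l$2 = 0 \<and> l$3 = 0 \<and> l$4 = 0 \<and> m$1 = 0"
proof -
  obtain l m where "frame_grad (f2 a c \<rho>) l m x" "l$2 = 0" "l$3 = 0" "l$4 = 0" "m$1 = 0"
  proof (cases "a = 0")
    case True
    obtain d where d: "frame_grad (f2 0 c \<rho>)
      (- (pi * (vel 3 x + \<rho>) * flat 1 (pi / 2) (pi * (vel 2 x - pos 1 x * (vel 3 x + \<rho>))) (vel 3 x + \<rho>)) *\<^sub>R basis4 1)
      ((pi * flat 1 (pi / 2) (pi * (vel 2 x - pos 1 x * (vel 3 x + \<rho>))) (vel 3 x + \<rho>)) *\<^sub>R basis4 2 + d *\<^sub>R basis4 3) x"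
      using frame_grad_f2_flat[of c \<rho> x] by (rule exE)
    from True d show thesis by (intro that) (auto simp: axis_def)
  next
    case False
    show thesis by (rule that[OF frame_grad_f2[OF False]]) (auto simp: axis_def)
  qed
  then have 2: "\<exists>l m. frame_grad (f2 a c \<rho>) l m x \<and> l$2 = 0 \<and> l$3 = 0 \<and> l$4 = 0 \<and> m$1 = 0"
    by blast
  have 3: "\<exists>l m. frame_grad (f3 a c \<rho>) l m x \<and> l$2 = 0 \<and> l$3 = 0 \<and> l$4 = 0 \<and> m$1 = 0"
    by (intro exI conjI, rule frame_grad_f3) (auto simp: axis_def)
  have 4: "\<exists>l m. frame_grad (f4 a c \<rho>) l m x \<and> l$2 = 0 \<and> l$3 = 0 \<and> l$4 = 0 \<and> m$1 = 0"
    by (intro exI conjI, rule frame_grad_f4) (auto simp: axis_def)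
  show ?thesis using assms 2 3 4 by (elim insertE emptyE) (simp_all only:)
qed

text \<open>All three functions are built from \<open>pos 1\<close> and \<open>vel 2\<close>, \<open>vel 3\<close>, \<open>vel 4\<close> only.\<close>
lemma poisson_f:
  assumes "\<phi> \<in> {f2 a c \<rho>, f3 a c \<rho>, f4 a c \<rho>}" "\<psi> \<in> {f2 a c \<rho>, f3 a c \<rho>, f4 a c \<rho>}"
  shows "poisson (mag_form a 0 c \<rho>) \<phi> \<psi> x = 0"
proof -
  obtain l m where 1: "frame_grad \<phi> l m x" "l$2 = 0" "l$3 = 0" "l$4 = 0" "m$1 = 0"
    using frame_grad_f_shape[OF assms(1)] by blast
  obtain l' m' where 2: "frame_grad \<psi> l' m' x" "l'$2 = 0" "l'$3 = 0" "l'$4 = 0" "m'$1 = 0"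
    using frame_grad_f_shape[OF assms(2)] by blast
  show ?thesis by (rule poisson_eq_0_first[OF 1(1) 2(1)]) (use 1 2 in auto)
qed

text \<open>The one bracket that does not vanish term by term is that of \<open>g2\<close> and \<open>g3\<close>: both \<open>m \<bullet> l'\<close> and the
  twisted form produce multiples of \<open>ab - ba\<close>.\<close>
lemma poisson_g:
  assumes "\<phi> \<in> {g2 a b \<rho>, g3 a b \<rho>, g4 a b \<rho>}" "\<psi> \<in> {g2 a b \<rho>, g3 a b \<rho>, g4 a b \<rho>}"
  shows "poisson (mag_form a b 0 \<rho>) \<phi> \<psi> x = 0"
proof -
  note g = frame_grad_g2[of a b \<rho> x] frame_grad_g3[of a b \<rho> x] frame_grad_g4[of a b \<rho> x]
  show ?thesis
    using assms
    by (elim insertE emptyE; simp only:)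
      (simp_all add: poisson_frame[OF g(1) g(1)] poisson_frame[OF g(1) g(2)] poisson_frame[OF g(1) g(3)]
        poisson_frame[OF g(2) g(1)] poisson_frame[OF g(2) g(2)] poisson_frame[OF g(2) g(3)]
        poisson_frame[OF g(3) g(1)] poisson_frame[OF g(3) g(2)] poisson_frame[OF g(3) g(3)]
        inner4 mag_form_nth axis_def)
qed

section \<open>Density\<close>

text \<open>Base point and left-trivialised velocity may be perturbed independently.\<close>
lemma frame_nbhd:
  assumes "open U" "x \<in> U"
  shows "\<exists>e>0. \<forall>W V. dist W (fst x) < e \<longrightarrow> dist V (to_alg (fst x) (snd x)) < e \<longrightarrow> (W, of_alg W V) \<in> U"
proof -
  let ?\<Phi> = "\<lambda>z::tvec. (fst z, of_alg (fst z) (snd z))"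
  have "continuous_on UNIV ?\<Phi>"
    unfolding of_alg_def bracket_def by (intro continuous_intros)
  then have "open (?\<Phi> -` U)" by (intro open_vimage assms(1))
  moreover have "(fst x, to_alg (fst x) (snd x)) \<in> ?\<Phi> -` U" using assms(2) by simp
  ultimately obtain A B where AB: "open A" "open B" "fst x \<in> A" "to_alg (fst x) (snd x) \<in> B"
    "A \<times> B \<subseteq> ?\<Phi> -` U"
    by (elim open_prod_elim) auto
  obtain d where d: "d > 0" "ball (fst x) d \<subseteq> A" using AB(1,3) by (rule openE)
  obtain e where e: "e > 0" "ball (to_alg (fst x) (snd x)) e \<subseteq> B" using AB(2,4) by (rule openE)
  show ?thesis
  proof (intro exI[of _ "min d e"] conjI allI impI)
    show "min d e > 0" using d e by simp
    fix W V assume "dist W (fst x) < min d e" "dist V (to_alg (fst x) (snd x)) < min d e"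
    then have "W \<in> A" "V \<in> B" using d e by (auto simp: dist_commute subset_iff)
    then have "(W, V) \<in> ?\<Phi> -` U" using AB(5) by blast
    then show "(W, of_alg W V) \<in> U" by simp
  qed
qed

definition rotate_plane :: "4 \<Rightarrow> 4 \<Rightarrow> real \<Rightarrow> real^4 \<Rightarrow> real^4" where
  "rotate_plane i j t V = (\<chi> k. if k = i then V$i * cos t + V$j * sin t
     else if k = j then V$j * cos t - V$i * sin t else V$k)"

lemma norm_rotate_plane:
  assumes "i \<noteq> j" shows "norm (rotate_plane i j t V) = norm V"
proof -
  have split: "X \<bullet> X = X$i * X$i + X$j * X$j + (\<Sum>k\<in>UNIV - {i, j}. X$k * X$k)" for X :: "real^4"
    using sum.subset_diff[of "{i, j}" UNIV "\<lambda>k. X$k * X$k"] assms by (simp add: inner_vec_def)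
  have "(V$i * cos t + V$j * sin t) * (V$i * cos t + V$j * sin t)
      + (V$j * cos t - V$i * sin t) * (V$j * cos t - V$i * sin t)
    = (V$i * V$i + V$j * V$j) * ((sin t)^2 + (cos t)^2)"
    by algebra
  then have "rotate_plane i j t V \<bullet> rotate_plane i j t V = V \<bullet> V"
    unfolding split using assms by (simp add: rotate_plane_def)
  then show ?thesis by (simp add: norm_eq_sqrt_inner)
qed

lemma rotate_plane_near:
  assumes "e > 0"
  shows "\<exists>t. 0 < t \<and> t < 1 \<and> dist (rotate_plane i j t V) V < e \<and> dist (rotate_plane i j (- t) V) V < e"
proof -
  have c: "continuous_on UNIV (\<lambda>t. if k = i then V$i * cos t + V$j * sin t
      else if k = j then V$j * cos t - V$i * sin t else V$k)" for k
    by (cases "k = i"; cases "k = j") (auto intro!: continuous_intros)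
  have "continuous_on UNIV (\<lambda>t. dist (rotate_plane i j t V) V)"
    unfolding rotate_plane_def
    by (intro continuous_on_dist continuous_on_vec_lambda c continuous_on_const)
  then have "isCont (\<lambda>t. dist (rotate_plane i j t V) V) 0"
    by (simp add: continuous_on_eq_continuous_at)
  moreover have "rotate_plane i j 0 V = V" by (simp add: rotate_plane_def vec_eq_iff)
  ultimately obtain d where d: "d > 0" "\<And>t. \<bar>t\<bar> < d \<Longrightarrow> dist (rotate_plane i j t V) V < e"
    using assms unfolding continuous_at_eps_delta by (auto simp: dist_real_def)
  show ?thesis
    using d by (intro exI[of _ "min (d / 2) (1 / 2)"]) auto
qed

lemma sin_cos_small:
  fixes t :: real
  assumes "0 < t" "t < 1" shows "sin t \<noteq> 0" "cos t \<noteq> 1"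
proof -
  show "sin t \<noteq> 0" using sin_gt_zero_02[of t] assms by simp
  show "cos t \<noteq> 1"
  proof
    assume "cos t = 1"
    then have "(sin t)^2 = 0" using sin_cos_squared_add[of t] by simp
    with \<open>sin t \<noteq> 0\<close> show False by simp
  qed
qed

text \<open>If the coordinate \<open>i\<close> of \<open>V\<close> has the forbidden value, rotate in a plane spanned by \<open>e\<^sub>i\<close> and another
  \<open>e\<^sub>j\<close> in which \<open>V\<close> has a nonzero projection. The rotations by \<open>t\<close> and by \<open>-t\<close> cannot both preserve
  coordinate \<open>i\<close>.\<close>
lemma sphere_avoid:
  fixes V :: "real^4"
  assumes "e > 0" "V \<noteq> 0"
  shows "\<exists>V'. dist V' V < e \<and> norm V' = norm V \<and> V'$i \<noteq> k"
proof (cases "V$i = k")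
  case False
  then show ?thesis using assms by (intro exI[of _ V]) auto
next
  case True
  obtain j where j: "j \<noteq> i" "V$i \<noteq> 0 \<or> V$j \<noteq> 0"
  proof (cases "V$i = 0")
    case True
    then show ?thesis using that assms(2) by (metis vec_eq_iff zero_index)
  next
    case False
    then show ?thesis using that[of "if i = 1 then 2 else 1"] by simp
  qed
  obtain t where t: "0 < t" "t < 1" "dist (rotate_plane i j t V) V < e" "dist (rotate_plane i j (- t) V) V < e"
    using rotate_plane_near[OF assms(1)] by blast
  have "rotate_plane i j t V $ i \<noteq> k \<or> rotate_plane i j (- t) V $ i \<noteq> k"
  proof (rule ccontr)
    assume "\<not> ?thesis"
    then have "V$i * cos t + V$j * sin t = V$i" "V$i * cos t - V$j * sin t = V$i"
      using True by (simp_all add: rotate_plane_def)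
    then have "V$j * sin t = 0" "V$i * (cos t - 1) = 0" by (simp_all add: algebra_simps)
    then show False using j(2) sin_cos_small[OF t(1,2)] by simp
  qed
  then show ?thesis using t norm_rotate_plane[OF j(1)[symmetric]] by metis
qed

text \<open>The second move is chosen shorter than the distance gained by the first one.\<close>
lemma sphere_avoid2:
  fixes V :: "real^4"
  assumes "e > 0" "V \<noteq> 0"
  shows "\<exists>V'. dist V' V < e \<and> norm V' = norm V \<and> V'$i \<noteq> k \<and> V'$j \<noteq> l"
proof -
  obtain V1 where V1: "dist V1 V < e / 2" "norm V1 = norm V" "V1$i \<noteq> k"
    using sphere_avoid[of "e / 2" V] assms by auto
  define d where "d = min (e / 2) \<bar>V1$i - k\<bar>"
  have "V1 \<noteq> 0" using V1(2) assms(2) by auto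
  moreover have "d > 0" using assms(1) V1(3) by (simp add: d_def)
  ultimately obtain V2 where V2: "dist V2 V1 < d" "norm V2 = norm V1" "V2$j \<noteq> l"
    using sphere_avoid[of d V1] by auto
  have "\<bar>V2$i - V1$i\<bar> < \<bar>V1$i - k\<bar>"
    using component_le_norm_cart[of "V2 - V1" i] V2(1) by (simp add: d_def dist_norm)
  then have "V2$i \<noteq> k" by auto
  moreover have "dist V2 V < e"
    using dist_triangle[of V2 V V1] V1(1) V2(1) by (simp add: d_def)
  ultimately show ?thesis using V1 V2 by auto
qed

text \<open>Once \<open>V\<^sub>3 \<noteq> 0\<close>, the values after the rotations by \<open>t\<close> and by \<open>-t\<close> in the plane of \<open>e\<^sub>2\<close> and \<open>e\<^sub>3\<close>
  differ by \<open>2 b V\<^sub>3 sin t\<close>, so one of them is nonzero.\<close>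
lemma sphere_avoid_linear:
  fixes V :: "real^4"
  assumes "e > 0" "V \<noteq> 0" "b \<noteq> 0"
  shows "\<exists>V'. dist V' V < e \<and> norm V' = norm V \<and> a * V'$1 + b * V'$2 \<noteq> 0"
proof -
  obtain V1 where V1: "dist V1 V < e / 2" "norm V1 = norm V" "V1$3 \<noteq> 0"
    using sphere_avoid[of "e / 2" V] assms by auto
  obtain t where t: "0 < t" "t < 1" "dist (rotate_plane 2 3 t V1) V1 < e / 2"
      "dist (rotate_plane 2 3 (- t) V1) V1 < e / 2"
    using rotate_plane_near[of "e / 2" 2 3 V1] assms(1) by auto
  define P where "P V' \<longleftrightarrow> a * V'$1 + b * V'$2 \<noteq> 0" for V' :: "real^4"
  have or: "P (rotate_plane 2 3 t V1) \<or> P (rotate_plane 2 3 (- t) V1)"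
  proof (rule ccontr)
    assume "\<not> ?thesis"
    then have "a * V1$1 + b * (V1$2 * cos t + V1$3 * sin t) = 0"
      "a * V1$1 + b * (V1$2 * cos t - V1$3 * sin t) = 0"
      by (simp_all add: P_def rotate_plane_def)
    then have "b * (V1$3 * sin t) = 0" unfolding distrib_left right_diff_distrib by linarith
    then show False using assms(3) V1(3) sin_cos_small[OF t(1,2)] by simp
  qed
  obtain V' where V': "P V'" "dist V' V1 < e / 2" "norm V' = norm V1"
  proof (cases "P (rotate_plane 2 3 t V1)")
    case True
    show ?thesis by (rule that[OF True t(3)]) (simp add: norm_rotate_plane)
  next
    case False
    with or have "P (rotate_plane 2 3 (- t) V1)" by simp
    then show ?thesis by (rule that[OF _ t(4)]) (simp add: norm_rotate_plane)
  qed
  have "dist V' V < e" using dist_triangle[of V' V V1] V1(1) V'(2) by simp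
  then show ?thesis using V1(2) V' by (auto simp: P_def)
qed

lemma nonzero_near:
  fixes V :: "real^4"
  assumes "e > 0" shows "\<exists>V'. dist V' V < e \<and> V' \<noteq> 0"
proof (cases "V = 0")
  case True
  then show ?thesis using assms by (intro exI[of _ "(e / 2) *\<^sub>R basis4 1"]) auto
qed (use assms in \<open>auto intro: exI[of _ V]\<close>)

lemma countable_cos_zeros:
  assumes "k \<noteq> 0" shows "countable {w :: real. cos (r - k * w) = 0}"
proof -
  have "{w. cos (r - k * w) = 0} \<subseteq> (\<lambda>n::int. (r - of_int n * (pi / 2)) / k) ` UNIV"
    using assms by (auto simp: cos_zero_iff_int image_iff field_simps)
  then show ?thesis by (rule countable_subset) simp
qed

lemma avoid_cos_zeros:
  fixes e k w0 r s :: real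
  assumes "e > 0" "k \<noteq> 0"
  shows "\<exists>w. \<bar>w - w0\<bar> < e \<and> cos (r - k * w) \<noteq> 0 \<and> cos (s - k * w) \<noteq> 0"
proof -
  let ?C = "{w. cos (r - k * w) = 0} \<union> {w. cos (s - k * w) = 0}"
  have "countable ?C" using countable_cos_zeros[OF assms(2)] by simp
  moreover have "uncountable {w0 - e<..<w0 + e}"
    using assms(1) by (simp add: uncountable_open_interval)
  ultimately have "\<not> {w0 - e<..<w0 + e} \<subseteq> ?C" using countable_subset by blast
  then obtain w where "w \<in> {w0 - e<..<w0 + e}" "w \<notin> ?C" by blast
  then show ?thesis by (intro exI[of _ w]) auto
qed

section \<open>Independence of the first integrals\<close>

text \<open>\<open>f2\<close>, \<open>f3\<close>, \<open>f4\<close> are insensitive to \<open>V\<^sub>1\<close> while the energy is not, so its coefficient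
  vanishes; then the directions \<open>V\<^sub>2\<close>, \<open>V\<^sub>4\<close> and \<open>V\<^sub>3\<close> kill the others in turn.\<close>
lemma indep_f:
  fixes x :: tvec
  assumes "a \<noteq> 0" "vel 1 x \<noteq> 0" "cos (pi / a * vel 3 x - pi * pos 1 x) \<noteq> 0"
    "c \<noteq> 0 \<longrightarrow> cos (pi / c * vel 4 x - pi * pos 1 x) \<noteq> 0"
  shows "indep_family [grad energy x, grad (f2 a c \<rho>) x, grad (f3 a c \<rho>) x, grad (f4 a c \<rho>) x]"
proof (rule indep_grads[OF frame_grad_energy frame_grad_f2[OF assms(1)] frame_grad_f3 frame_grad_f4])
qed (use assms in \<open>auto simp: vec4_eq_iff axis_def split: if_splits\<close>)

lemma indep_f_flat:
  fixes x :: tvec and \<rho> :: real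
  defines "s \<equiv> vel 3 x + \<rho>"
  assumes "vel 1 x \<noteq> 0" "s \<noteq> 0" "cos (pi * vel 2 x / s - pi * pos 1 x) \<noteq> 0"
    "c \<noteq> 0 \<longrightarrow> cos (pi / c * vel 4 x - pi * pos 1 x) \<noteq> 0"
  shows "indep_family [grad energy x, grad (f2 0 c \<rho>) x, grad (f3 0 c \<rho>) x, grad (f4 0 c \<rho>) x]"
proof -
  let ?q = "pi * (vel 2 x - pos 1 x * s)"
  have "?q / s = pi * vel 2 x / s - pi * pos 1 x"
    using assms(3) by (simp add: field_simps)
  then have nz: "flat 1 (pi / 2) ?q s \<noteq> 0"
    using assms(3,4) by (simp add: flat_def sin_add)
  obtain d where f2: "frame_grad (f2 0 c \<rho>) (- (pi * s * flat 1 (pi / 2) ?q s) *\<^sub>R basis4 1)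
    ((pi * flat 1 (pi / 2) ?q s) *\<^sub>R basis4 2 + d *\<^sub>R basis4 3) x"
    using frame_grad_f2_flat[of c \<rho> x] unfolding s_def by blast
  show ?thesis
    by (rule indep_grads[OF frame_grad_energy f2 frame_grad_f3 frame_grad_f4])
      (use assms nz in \<open>auto simp: vec4_eq_iff axis_def split: if_splits\<close>)
qed

text \<open>Only \<open>g3\<close> depends on the position, so its coefficient vanishes. The directions \<open>V\<^sub>1\<close>, \<open>V\<^sub>2\<close> then see the
  energy and \<open>g2\<close> through a \<open>2\<times>2\<close> matrix with determinant \<open>- (a V\<^sub>1 + b V\<^sub>2)\<close>.\<close>
lemma indep_g:
  fixes x :: tvec
  assumes "b \<noteq> 0" "a * vel 1 x + b * vel 2 x \<noteq> 0" "cos (2 * pi * (vel 3 x - a * pos 1 x - b * pos 2 x)) \<noteq> 0"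
  shows "indep_family [grad energy x, grad (g2 a b \<rho>) x, grad (g3 a b \<rho>) x, grad (g4 a b \<rho>) x]"
proof (rule indep_grads[OF frame_grad_energy frame_grad_g2 frame_grad_g3 frame_grad_g4])
  let ?k = "2 * pi * cos (2 * pi * (vel 3 x - a * pos 1 x - b * pos 2 x))"
  fix k0 k1 k2 k3
  assume l: "k0 *\<^sub>R 0 + k1 *\<^sub>R 0 + k2 *\<^sub>R (- (?k * a) *\<^sub>R basis4 1 - (?k * b) *\<^sub>R basis4 2) + k3 *\<^sub>R 0 = 0"
    and m: "k0 *\<^sub>R to_alg (fst x) (snd x) + k1 *\<^sub>R (b *\<^sub>R basis4 1 - a *\<^sub>R basis4 2 + (vel 3 x + \<rho>) *\<^sub>R basis4 3)
      + k2 *\<^sub>R (?k *\<^sub>R basis4 3) + k3 *\<^sub>R basis4 4 = 0"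
  have "k2 = 0" using arg_cong[OF l, of "\<lambda>v. v $ 2"] assms by (simp add: axis_def)
  have 1: "k0 * vel 1 x + k1 * b = 0" and 2: "k0 * vel 2 x - k1 * a = 0" and 4: "k0 * vel 4 x + k3 = 0"
    using arg_cong[OF m, of "\<lambda>v. v $ 1"] arg_cong[OF m, of "\<lambda>v. v $ 2"] arg_cong[OF m, of "\<lambda>v. v $ 4"]
    by (simp_all add: axis_def)
  have "k0 * (a * vel 1 x + b * vel 2 x) = a * (k0 * vel 1 x + k1 * b) + b * (k0 * vel 2 x - k1 * a)"
    by (simp add: algebra_simps)
  then have "k0 = 0" using 1 2 assms(2) by simp
  with 1 4 \<open>k2 = 0\<close> assms(1) show "k0 = 0 \<and> k1 = 0 \<and> k2 = 0 \<and> k3 = 0" by simp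
qed

lemma pos_vel_of_alg: "pos i (W, of_alg W V) = W$i" "vel i (W, of_alg W V) = V$i"
  by simp_all

lemma dense_indep_f:
  fixes x :: tvec
  assumes "a \<noteq> 0" "open U" "x \<in> U"
  shows "\<exists>y\<in>U. indep_family [grad energy y, grad (f2 a c \<rho>) y, grad (f3 a c \<rho>) y, grad (f4 a c \<rho>) y]"
proof -
  obtain e where e: "e > 0" and
    near: "\<And>W V. dist W (fst x) < e \<Longrightarrow> dist V (to_alg (fst x) (snd x)) < e \<Longrightarrow> (W, of_alg W V) \<in> U"
    using frame_nbhd[OF assms(2,3)] by blast
  obtain V0 where V0: "dist V0 (to_alg (fst x) (snd x)) < e / 2" "V0 \<noteq> 0"
    using nonzero_near[of "e / 2"] e by auto
  obtain V where V: "dist V V0 < e / 2" "V$1 \<noteq> 0"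
    using sphere_avoid[of "e / 2" V0 1 0] V0 e by auto
  obtain w where w: "\<bar>w - fst x $ 1\<bar> < e" "cos (pi / a * V$3 - pi * w) \<noteq> 0" "cos (pi / c * V$4 - pi * w) \<noteq> 0"
    using avoid_cos_zeros[of e pi "fst x $ 1"] e by auto
  define W where "W = fst x + (w - fst x $ 1) *\<^sub>R basis4 1"
  have "(W, of_alg W V) \<in> U"
  proof (rule near)
    show "dist W (fst x) < e" using w(1) by (simp add: W_def dist_norm)
    show "dist V (to_alg (fst x) (snd x)) < e"
      using dist_triangle[of V "to_alg (fst x) (snd x)" V0] V(1) V0(1) by simp
  qed
  moreover have "W$1 = w" by (simp add: W_def)
  ultimately show ?thesis
    using assms(1) V(2) w by (intro bexI[of _ "(W, of_alg W V)"] indep_f) (simp_all only: pos_vel_of_alg simp_thms)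
qed

lemma dense_indep_f_flat:
  fixes x :: tvec
  assumes "energy x \<noteq> 0" "open U" "x \<in> U"
  shows "\<exists>y\<in>U. energy y = energy x \<and>
    indep_family [grad energy y, grad (f2 0 c \<rho>) y, grad (f3 0 c \<rho>) y, grad (f4 0 c \<rho>) y]"
proof -
  let ?V = "to_alg (fst x) (snd x)"
  obtain e where e: "e > 0" and
    near: "\<And>W V. dist W (fst x) < e \<Longrightarrow> dist V ?V < e \<Longrightarrow> (W, of_alg W V) \<in> U"
    using frame_nbhd[OF assms(2,3)] by blast
  have "?V \<noteq> 0" using assms(1) by (auto simp: energy_def metric_def)
  then obtain V where V: "dist V ?V < e" "norm V = norm ?V" "V$1 \<noteq> 0" "V$3 \<noteq> - \<rho>"
    using sphere_avoid2[of e ?V 1 0 3 "- \<rho>"] e by auto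
  obtain w where w: "\<bar>w - fst x $ 1\<bar> < e" "cos (pi * V$2 / (V$3 + \<rho>) - pi * w) \<noteq> 0"
      "cos (pi / c * V$4 - pi * w) \<noteq> 0"
    using avoid_cos_zeros[of e pi "fst x $ 1"] e by auto
  define W where "W = fst x + (w - fst x $ 1) *\<^sub>R basis4 1"
  have "(W, of_alg W V) \<in> U"
    by (rule near) (use w(1) V(1) in \<open>simp_all add: W_def dist_norm\<close>)
  moreover have "energy (W, of_alg W V) = energy x"
    using V(2) by (simp add: energy_of_alg) (simp add: energy_def metric_def norm_eq_sqrt_inner)
  moreover have "W$1 = w" by (simp add: W_def)
  moreover from this have "indep_family (map (\<lambda>f. grad f (W, of_alg W V)) [energy, f2 0 c \<rho>, f3 0 c \<rho>, f4 0 c \<rho>])"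
    unfolding list.map
    by (intro indep_f_flat; unfold pos_vel_of_alg) (use V w in \<open>auto simp: eq_neg_iff_add_eq_0\<close>)
  ultimately show ?thesis
    by (intro bexI[of _ "(W, of_alg W V)"]) simp_all
qed

text \<open>One statement serves the whole tangent bundle and the positive energy levels: the energy is
  kept unless it is zero, when the velocity must first be made nonzero.\<close>
lemma dense_indep_g:
  fixes x :: tvec
  assumes "b \<noteq> 0" "open U" "x \<in> U"
  shows "\<exists>y\<in>U. (energy x \<noteq> 0 \<longrightarrow> energy y = energy x) \<and>
    indep_family [grad energy y, grad (g2 a b \<rho>) y, grad (g3 a b \<rho>) y, grad (g4 a b \<rho>) y]"
proof -
  let ?V = "to_alg (fst x) (snd x)"
  obtain e where e: "e > 0" and
    near: "\<And>W V. dist W (fst x) < e \<Longrightarrow> dist V ?V < e \<Longrightarrow> (W, of_alg W V) \<in> U"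
    using frame_nbhd[OF assms(2,3)] by blast
  obtain V0 where V0: "dist V0 ?V < e / 2" "V0 \<noteq> 0" "energy x \<noteq> 0 \<Longrightarrow> V0 = ?V"
  proof (cases "energy x = 0")
    case True
    then show ?thesis using that nonzero_near[of "e / 2" ?V] e by auto
  next
    case False
    then have "?V \<noteq> 0" by (auto simp: energy_def metric_def)
    then show ?thesis using that[of ?V] e by simp
  qed
  obtain V where V: "dist V V0 < e / 2" "norm V = norm V0" "a * V$1 + b * V$2 \<noteq> 0"
    using sphere_avoid_linear[of "e / 2" V0 b a] V0 e assms(1) by auto
  obtain w where w: "\<bar>w - fst x $ 2\<bar> < e" "cos (2 * pi * (V$3 - a * fst x $ 1) - 2 * pi * b * w) \<noteq> 0"
    using avoid_cos_zeros[of e "2 * pi * b" "fst x $ 2"] e assms(1) by auto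
  define W where "W = fst x + (w - fst x $ 2) *\<^sub>R basis4 2"
  have in_U: "(W, of_alg W V) \<in> U"
  proof (rule near)
    show "dist W (fst x) < e" using w(1) by (simp add: W_def dist_norm)
    show "dist V ?V < e" using dist_triangle[of V ?V V0] V(1) V0(1) by simp
  qed
  have lev: "energy (W, of_alg W V) = energy x" if "energy x \<noteq> 0"
    using V(2) V0(3)[OF that] by (simp add: energy_of_alg) (simp add: energy_def metric_def norm_eq_sqrt_inner)
  have "W$2 = w" "W$1 = fst x $ 1" by (simp_all add: W_def axis_def)
  from this have "cos (2 * pi * (V$3 - a * W$1 - b * W$2)) \<noteq> 0"
    using w(2) by (simp add: algebra_simps)
  from this have "indep_family (map (\<lambda>f. grad f (W, of_alg W V)) [energy, g2 a b \<rho>, g3 a b \<rho>, g4 a b \<rho>])"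
    unfolding list.map
    using indep_g[of b a "(W, of_alg W V)" \<rho>, unfolded pos_vel_of_alg] V(3) assms(1) by simp
  with in_U lev show ?thesis
    by (intro bexI[of _ "(W, of_alg W V)"]) simp_all
qed

section \<open>Invariance under the lattice\<close>

lemma vel_ltrans: "vel i (ltrans g x) = vel i x"
  by (simp only: to_alg_ltrans)

lemma pos_ltrans: "pos 1 (ltrans g x) = g$1 + pos 1 x" "pos 2 (ltrans g x) = g$2 + pos 2 x"
  by (rule fst_ltrans_nth)+

lemma sin_minus_2pi_int: "sin (r - 2 * pi * of_int n) = sin (r :: real)"
  by (simp add: sin_diff)

lemma invariant_f:
  assumes "\<And>g. g \<in> \<Gamma> \<Longrightarrow> \<exists>n::int. g$1 = 2 * of_int n" "f \<in> {f2 a c \<rho>, f3 a c \<rho>, f4 a c \<rho>}"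
  shows "invariant \<Gamma> f"
  unfolding invariant_def
proof (intro ballI allI)
  fix g x assume "g \<in> \<Gamma>"
  then obtain n :: int where n: "g$1 = 2 * of_int n" using assms(1) by blast
  \<comment> \<open>every \<open>sin\<close> contains \<open>pos 1\<close> with the factor \<open>\<pi>\<close>, and \<open>g\<close> shifts it by an even integer\<close>
  have per: "sin (r - pi * (2 * of_int n + p)) = sin (r - pi * p)" for r p :: real
    using sin_minus_2pi_int[of "r - pi * p" n] by (simp add: algebra_simps)
  have "flat 0 0 (pi * (v - (2 * of_int n + p) * s)) s = flat 0 0 (pi * (v - p * s)) s" for v p s
  proof (cases "s = 0")
    case False
    then have "pi * (v - q * s) / s = pi * v / s - pi * q" for q
      by (simp add: field_simps)
    then show ?thesis using per[of "pi * v / s" p] by (simp add: flat_def)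
  qed (simp add: flat_def)
  then have "f2 a c \<rho> (ltrans g x) = f2 a c \<rho> x"
    by (cases "a = 0") (simp_all add: f2_eq vel_ltrans pos_ltrans n)
  moreover have "f3 a c \<rho> (ltrans g x) = f3 a c \<rho> x" "f4 a c \<rho> (ltrans g x) = f4 a c \<rho> x"
    by (simp_all add: f3_eq f4_eq vel_ltrans pos_ltrans n per)
  ultimately show "f (ltrans g x) = f x" using assms(2) by auto
qed

lemma invariant_g:
  assumes "\<And>g. g \<in> \<Gamma> \<Longrightarrow> \<exists>n::int. a * g$1 + b * g$2 = of_int n" "g \<in> {g2 a b \<rho>, g3 a b \<rho>, g4 a b \<rho>}"
  shows "invariant \<Gamma> g"
  unfolding invariant_def
proof (intro ballI allI)
  fix \<eta> x assume "\<eta> \<in> \<Gamma>"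
  then obtain n :: int where n: "a * \<eta>$1 + b * \<eta>$2 = of_int n" using assms(1) by blast
  have "2 * pi * (vel 3 x - a * (\<eta>$1 + pos 1 x) - b * (\<eta>$2 + pos 2 x))
      = 2 * pi * (vel 3 x - a * pos 1 x - b * pos 2 x) - 2 * pi * (a * \<eta>$1 + b * \<eta>$2)"
    by (simp add: algebra_simps)
  then have "g3 a b \<rho> (ltrans \<eta> x) = g3 a b \<rho> x"
    by (simp add: g3_eq vel_ltrans pos_ltrans n sin_minus_2pi_int)
  moreover have "g2 a b \<rho> (ltrans \<eta> x) = g2 a b \<rho> x" "g4 a b \<rho> (ltrans \<eta> x) = g4 a b \<rho> x"
    by (simp_all add: g2_eq g4_eq vel_ltrans)
  ultimately show "g (ltrans \<eta> x) = g x" using assms(2) by auto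
qed

section \<open>Failure of analyticity\<close>

lemma abs_sin_diff_le: "\<bar>sin x - sin y\<bar> \<le> \<bar>x - y\<bar>" for x y :: real
proof -
  have "\<bar>sin x - sin y\<bar> = 2 * \<bar>sin ((x - y) / 2)\<bar> * \<bar>cos ((x + y) / 2)\<bar>"
    by (simp add: sin_diff_sin abs_mult)
  also have "\<dots> \<le> 2 * \<bar>(x - y) / 2\<bar> * 1"
    by (intro mult_mono abs_sin_x_le_abs_x) auto
  finally show ?thesis by simp
qed

text \<open>At the position \<open>e\<^sub>1/2\<close> and for \<open>V\<^sub>2 = 0\<close> the sine in \<open>f2\<close> has the argument \<open>- \<pi>/2\<close>. Let \<open>V\<close> run through
  the circle of radius \<open>R = sqrt (2 h)\<close> in the plane of \<open>e\<^sub>1\<close> and \<open>e\<^sub>3\<close>. As \<open>\<bar>\<rho>\<bar> \<le> R\<close>, the function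
  \<open>s = R sin t + \<rho>\<close> has a zero there, where \<open>f2 = - exp (-1/s\<^sup>2)\<close> is flat. An analytic function would
  vanish nearby, but the sine is not locally constant.\<close>
lemma not_analytic_f2:
  assumes "h > 0" "sqrt (2 * h) \<ge> \<bar>\<rho>\<bar>"
  shows "\<not> real_analytic_on (f2 0 c \<rho>) {x. energy x = h}"
proof
  assume an: "real_analytic_on (f2 0 c \<rho>) {x. energy x = h}"
  define R where "R = sqrt (2 * h)"
  have R: "R > 0" "R * R = 2 * h" using assms(1) by (simp_all add: R_def)
  define t0 where "t0 = arcsin (- \<rho> / R)"
  have t0: "R * sin t0 = - \<rho>"
  proof -
    have "\<bar>- \<rho> / R\<bar> \<le> 1" using assms(2) R(1) by (simp add: R_def[symmetric])
    then have "sin t0 = - \<rho> / R" unfolding t0_def by (intro sin_arcsin) linarith+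
    then show ?thesis using R(1) by simp
  qed
  define \<gamma> :: "real \<Rightarrow> tvec" where
    "\<gamma> t = ((1/2) *\<^sub>R basis4 1, (R * cos t) *\<^sub>R basis4 1 + (R * sin t) *\<^sub>R basis4 3)" for t
  have comp: "vel 1 (\<gamma> t) = R * cos t" "vel 2 (\<gamma> t) = 0" "vel 3 (\<gamma> t) = R * sin t" "vel 4 (\<gamma> t) = 0"
    "pos 1 (\<gamma> t) = 1/2" for t
    by (simp_all add: \<gamma>_def to_alg_nth axis_def)
  have "energy (\<gamma> t) = h" for t
  proof -
    have "energy (\<gamma> t) = 1/2 * ((R * R) * ((cos t)^2 + (sin t)^2))"
      unfolding energy_def metric_def inner4 comp by algebra
    then show ?thesis using R(2) by simp
  qed
  moreover have "analytic_at (\<lambda>t. \<gamma> t \<bullet> b) t0" for b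
  proof -
    have lin: "analytic_at (\<lambda>t::real. t) t0" by (rule analytic_at_linear[OF bounded_linear_ident])
    have "analytic_at (\<lambda>t. (1/2) *\<^sub>R basis4 1 \<bullet> fst b + (R * sin (t + pi / 2)) * (basis4 1 \<bullet> snd b)
        + (R * sin t) * (basis4 3 \<bullet> snd b)) t0"
      by (intro analytic_at_add analytic_at_mult analytic_at_const analytic_at_sin lin)
    then show ?thesis
      by (simp add: \<gamma>_def inner_prod_def inner_add_left sin_add add.assoc)
  qed
  ultimately have an': "analytic_at (\<lambda>t. f2 0 c \<rho> (\<gamma> t)) t0"
    by (intro real_analytic_on_curve[OF an]) auto
  define s where "s t = R * sin t + \<rho>" for t
  have G: "f2 0 c \<rho> (\<gamma> t) = (if s t = 0 then 0 else - exp (- 1 / (s t)^2))" for t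
    by (simp add: f2_eq comp flat_def s_def[symmetric])
  have s_le: "\<bar>s t\<bar> \<le> R * \<bar>t - t0\<bar>" for t
  proof -
    have "s t = R * (sin t - sin t0)" using t0 by (simp add: s_def algebra_simps)
    then show ?thesis using R(1) abs_sin_diff_le[of t t0] by (simp add: abs_mult)
  qed
  have "\<exists>C. \<forall>t. \<bar>f2 0 c \<rho> (\<gamma> t)\<bar> \<le> C * \<bar>t - t0\<bar> ^ n" for n
  proof (intro exI allI)
    fix t
    have "\<bar>f2 0 c \<rho> (\<gamma> t)\<bar> \<le> fact n * \<bar>s t\<bar> ^ n"
      unfolding G using exp_inverse_square_le[of "s t" n] by auto
    also have "\<dots> \<le> fact n * (R * \<bar>t - t0\<bar>) ^ n"
      by (intro mult_left_mono power_mono s_le) auto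
    finally show "\<bar>f2 0 c \<rho> (\<gamma> t)\<bar> \<le> (fact n * R ^ n) * \<bar>t - t0\<bar> ^ n"
      by (simp add: power_mult_distrib)
  qed
  from analytic_flat_imp_zero[OF an' this] obtain r where
    r: "r > 0" "\<And>t. \<bar>t - t0\<bar> \<le> r \<Longrightarrow> f2 0 c \<rho> (\<gamma> t) = 0" by blast
  define \<tau> where "\<tau> = min r (1 / 2)"
  have \<tau>: "0 < \<tau>" "\<tau> < 1" "\<tau> \<le> r" using r(1) by (auto simp: \<tau>_def)
  have zero: "sin t = sin t0" if "\<bar>t - t0\<bar> \<le> r" for t
  proof -
    have "s t = 0" using r(2)[OF that] unfolding G by (simp split: if_splits)
    then have "R * sin t = R * sin t0" using t0 by (simp add: s_def)
    then show ?thesis using R(1) by simp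
  qed
  have "sin (t0 + \<tau>) = sin t0" "sin (t0 - \<tau>) = sin t0" using \<tau> by (auto intro: zero)
  then have "cos t0 * sin \<tau> = 0" "sin t0 * (cos \<tau> - 1) = 0"
    by (simp_all add: sin_add sin_diff algebra_simps)
  then show False using sin_cos_small[OF \<tau>(1,2)] sin_cos_squared_add[of t0] by simp
qed

section \<open>Complete integrability\<close>

lemma completely_integrable_byI:
  fixes \<phi> \<xi> \<psi> :: "tvec \<Rightarrow> real"
  assumes \<Gamma>: "0 \<in> \<Gamma>" and inv: "\<forall>f\<in>{\<phi>, \<xi>, \<psi>}. invariant \<Gamma> f"
    and el: "\<forall>f\<in>{\<phi>, \<xi>, \<psi>}. elementary f" and con: "\<forall>f\<in>{\<phi>, \<xi>, \<psi>}. conserved \<omega> f"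
    and poi: "\<forall>f\<in>{\<phi>, \<xi>, \<psi>}. \<forall>g\<in>{\<phi>, \<xi>, \<psi>}. \<forall>x. poisson \<omega> f g x = 0"
    and S: "S \<subseteq> TM \<Gamma>"
    and dense: "\<And>x U. covproj \<Gamma> x \<in> S \<Longrightarrow> open U \<Longrightarrow> x \<in> U \<Longrightarrow>
      \<exists>y\<in>U. covproj \<Gamma> y \<in> S \<and> indep_family [grad energy y, grad \<phi> y, grad \<xi> y, grad \<psi> y]"
  shows "completely_integrable_by \<Gamma> \<omega> S (map (descend \<Gamma>) [\<phi>, \<xi>, \<psi>])"
proof -
  have lift: "descend \<Gamma> f \<circ> covproj \<Gamma> = f" if "f \<in> {\<phi>, \<xi>, \<psi>}" for f
    using descend_covproj[OF \<Gamma>] inv that by blast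
  have "first_integral \<Gamma> \<omega> (descend \<Gamma> f)" if f: "f \<in> {\<phi>, \<xi>, \<psi>}" for f
  proof -
    have "elementary f" "conserved \<omega> f" using el con f by blast+
    moreover have "descend \<Gamma> f (covproj \<Gamma> x) = f x" for x
      using lift[OF f] by (metis comp_apply)
    ultimately show ?thesis
      unfolding first_integral_def lift[OF f] conserved_def by (simp add: smooth_elementary)
  qed
  moreover have "S \<subseteq> TM_topology \<Gamma> closure_of (S \<inter> covproj \<Gamma> `
      {x. indep_family [grad energy x, grad \<phi> x, grad \<xi> x, grad \<psi> x]})"
    by (rule dense_in_quotient[OF S]) (use dense in blast)
  ultimately show ?thesis
    unfolding completely_integrable_by_def
    using poi by (simp add: lift descend_covproj[OF \<Gamma> invariant_energy])
qed

lemma analytic_at_levelI: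
  assumes "0 \<in> \<Gamma>" "invariant \<Gamma> f" "\<And>x. covproj \<Gamma> x \<in> S \<Longrightarrow> analytic_at f x"
  shows "analytic_at_level \<Gamma> S (descend \<Gamma> f)"
  unfolding analytic_at_level_def descend_covproj[OF assms(1,2)]
  by (rule real_analytic_onI, rule assms(3)) simp

lemma in_energy_level: "0 \<in> \<Gamma> \<Longrightarrow> covproj \<Gamma> x \<in> energy_level \<Gamma> h \<longleftrightarrow> energy x = h"
  using covproj_vimage_energy_level[of \<Gamma> h] by auto

lemma energy_level_subset: "energy_level \<Gamma> h \<subseteq> TM \<Gamma>"
  by (auto simp: energy_level_def)

lemma integrability_b_eq_0:
  fixes a c \<rho> :: real
  defines "\<Gamma> \<equiv> int_span4 (2 *\<^sub>R basis4 1) (basis4 2) (basis4 3) (basis4 4)"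
    and "fs \<equiv> [f2 a c \<rho>, f3 a c \<rho>, f4 a c \<rho>]"
  shows "lattice_in_N \<Gamma>" "\<forall>f\<in>set fs. invariant \<Gamma> f"
    "a \<noteq> 0 \<Longrightarrow> completely_integrable_by \<Gamma> (mag_form a 0 c \<rho>) (TM \<Gamma>) (map (descend \<Gamma>) fs)"
    "a \<noteq> 0 \<Longrightarrow> \<forall>\<Psi>\<in>set (map (descend \<Gamma>) fs). analytic_at_level \<Gamma> (TM \<Gamma>) \<Psi>"
    "a = 0 \<Longrightarrow> h > 0 \<Longrightarrow>
      completely_integrable_by \<Gamma> (mag_form a 0 c \<rho>) (energy_level \<Gamma> h) (map (descend \<Gamma>) fs)"
    "a = 0 \<Longrightarrow> h > 0 \<Longrightarrow>
      (\<forall>\<Psi>\<in>set (map (descend \<Gamma>) fs). analytic_at_level \<Gamma> (energy_level \<Gamma> h) \<Psi>) \<longleftrightarrow> sqrt (2 * h) < \<bar>\<rho>\<bar>"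
proof -
  have \<Gamma>: "\<Gamma> = int_span4 (2 *\<^sub>R basis4 1) (1 *\<^sub>R basis4 2) (1 *\<^sub>R basis4 3) (basis4 4)"
    by (simp add: \<Gamma>_def)
  show lat: "lattice_in_N \<Gamma>"
    unfolding \<Gamma> by (rule lattice_axis) simp_all
  then have 0: "0 \<in> \<Gamma>" by (rule lattice_in_N_zero)
  have "\<exists>n::int. g$1 = 2 * of_int n" if "g \<in> \<Gamma>" for g
    using that unfolding \<Gamma> int_span4_axis_iff by (auto simp: mult.commute)
  then have inv: "invariant \<Gamma> f" if "f \<in> {f2 a c \<rho>, f3 a c \<rho>, f4 a c \<rho>}" for f
    using that by (rule invariant_f)
  then show "\<forall>f\<in>set fs. invariant \<Gamma> f" by (simp add: fs_def)
  have CI: "completely_integrable_by \<Gamma> (mag_form a 0 c \<rho>) S (map (descend \<Gamma>) fs)"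
    if "S \<subseteq> TM \<Gamma>" and "\<And>x U. covproj \<Gamma> x \<in> S \<Longrightarrow> open U \<Longrightarrow> x \<in> U \<Longrightarrow> \<exists>y\<in>U. covproj \<Gamma> y \<in> S \<and>
      indep_family [grad energy y, grad (f2 a c \<rho>) y, grad (f3 a c \<rho>) y, grad (f4 a c \<rho>) y]" for S
    unfolding fs_def
    by (rule completely_integrable_byI[OF 0])
      (use that inv elementary_integrals conserved_f poisson_f in \<open>auto\<close>)
  show "completely_integrable_by \<Gamma> (mag_form a 0 c \<rho>) (TM \<Gamma>) (map (descend \<Gamma>) fs)" if "a \<noteq> 0"
  proof (rule CI)
    fix x :: tvec and U assume "open U" "x \<in> U"
    from dense_indep_f[OF that this] show "\<exists>y\<in>U. covproj \<Gamma> y \<in> TM \<Gamma> \<and>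
      indep_family [grad energy y, grad (f2 a c \<rho>) y, grad (f3 a c \<rho>) y, grad (f4 a c \<rho>) y]"
      by (auto simp: TM_def)
  qed simp
  show "\<forall>\<Psi>\<in>set (map (descend \<Gamma>) fs). analytic_at_level \<Gamma> (TM \<Gamma>) \<Psi>" if "a \<noteq> 0"
    using that inv analytic_integrals by (auto simp: fs_def intro!: analytic_at_levelI[OF 0])
  assume a: "a = 0" and h: "h > 0"
  show "completely_integrable_by \<Gamma> (mag_form a 0 c \<rho>) (energy_level \<Gamma> h) (map (descend \<Gamma>) fs)"
  proof (rule CI[OF energy_level_subset])
    fix x :: tvec and U assume x: "covproj \<Gamma> x \<in> energy_level \<Gamma> h" and U: "open U" "x \<in> U"
    have "energy x = h" using x by (simp add: in_energy_level[OF 0])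
    then show "\<exists>y\<in>U. covproj \<Gamma> y \<in> energy_level \<Gamma> h \<and>
      indep_family [grad energy y, grad (f2 a c \<rho>) y, grad (f3 a c \<rho>) y, grad (f4 a c \<rho>) y]"
      using dense_indep_f_flat[OF _ U] h unfolding a by (simp add: in_energy_level[OF 0])
  qed
  show "(\<forall>\<Psi>\<in>set (map (descend \<Gamma>) fs). analytic_at_level \<Gamma> (energy_level \<Gamma> h) \<Psi>) \<longleftrightarrow> sqrt (2 * h) < \<bar>\<rho>\<bar>"
  proof
    assume lt: "sqrt (2 * h) < \<bar>\<rho>\<bar>"
    have "vel 3 x + \<rho> \<noteq> 0" if "energy x = h" for x
    proof
      assume "vel 3 x + \<rho> = 0"
      then have "\<bar>\<rho>\<bar> = \<bar>vel 3 x\<bar>" by simp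
      also have "\<dots> \<le> norm (to_alg (fst x) (snd x))" by (rule component_le_norm_cart)
      also have "\<dots> = sqrt (2 * h)"
        using that by (simp add: norm_eq_sqrt_inner energy_def metric_def)
      finally show False using lt by simp
    qed
    then show "\<forall>\<Psi>\<in>set (map (descend \<Gamma>) fs). analytic_at_level \<Gamma> (energy_level \<Gamma> h) \<Psi>"
      using inv analytic_integrals
      by (auto simp: fs_def in_energy_level[OF 0] intro!: analytic_at_levelI[OF 0])
  next
    assume "\<forall>\<Psi>\<in>set (map (descend \<Gamma>) fs). analytic_at_level \<Gamma> (energy_level \<Gamma> h) \<Psi>"
    then have "analytic_at_level \<Gamma> (energy_level \<Gamma> h) (descend \<Gamma> (f2 0 c \<rho>))" by (simp add: fs_def a)
    then have "real_analytic_on (f2 0 c \<rho>) {x. energy x = h}"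
      using inv a by (simp add: analytic_at_level_def descend_covproj[OF 0] covproj_vimage_energy_level[OF 0])
    then show "sqrt (2 * h) < \<bar>\<rho>\<bar>" using not_analytic_f2[OF h, of \<rho> c] by linarith
  qed
qed

lemma integrability_c_eq_0:
  fixes a b \<rho> :: real
  defines "\<Gamma> \<equiv> (if a = 0
      then int_span4 (2 *\<^sub>R basis4 1) ((1/b) *\<^sub>R basis4 2) ((1/b) *\<^sub>R basis4 3) (basis4 4)
      else int_span4 ((2/a) *\<^sub>R basis4 1) ((1/b) *\<^sub>R basis4 2) ((1/(a*b)) *\<^sub>R basis4 3) (basis4 4))"
    and "gs \<equiv> [g2 a b \<rho>, g3 a b \<rho>, g4 a b \<rho>]"
  assumes b: "b \<noteq> 0"
  shows "lattice_in_N \<Gamma>" "\<forall>g\<in>set gs. invariant \<Gamma> g"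
    "completely_integrable_by \<Gamma> (mag_form a b 0 \<rho>) (TM \<Gamma>) (map (descend \<Gamma>) gs)"
    "h > 0 \<Longrightarrow> completely_integrable_by \<Gamma> (mag_form a b 0 \<rho>) (energy_level \<Gamma> h) (map (descend \<Gamma>) gs)"
    "\<forall>\<Psi>\<in>set (map (descend \<Gamma>) gs). analytic_at_level \<Gamma> S \<Psi>"
proof -
  define \<alpha> \<gamma> where "\<alpha> = (if a = 0 then 2 else 2 / a)" and "\<gamma> = (if a = 0 then 1 / b else 1 / (a * b))"
  have \<Gamma>: "\<Gamma> = int_span4 (\<alpha> *\<^sub>R basis4 1) ((1 / b) *\<^sub>R basis4 2) (\<gamma> *\<^sub>R basis4 3) (basis4 4)"
    by (simp add: \<Gamma>_def \<alpha>_def \<gamma>_def)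
  show lat: "lattice_in_N \<Gamma>"
    unfolding \<Gamma> by (rule lattice_axis) (use b in \<open>simp_all add: \<alpha>_def \<gamma>_def\<close>)
  then have 0: "0 \<in> \<Gamma>" by (rule lattice_in_N_zero)
  have "\<exists>n::int. a * g$1 + b * g$2 = of_int n" if g: "g \<in> \<Gamma>" for g
  proof -
    obtain k l :: int where "g$1 = of_int k * \<alpha>" "g$2 = of_int l * (1 / b)"
      using g unfolding \<Gamma> int_span4_axis_iff by blast
    then have "a * g$1 + b * g$2 = of_int (if a = 0 then l else 2 * k + l)"
      using b by (simp add: \<alpha>_def)
    then show ?thesis by blast
  qed
  then have inv: "invariant \<Gamma> g" if "g \<in> {g2 a b \<rho>, g3 a b \<rho>, g4 a b \<rho>}" for g
    using that by (rule invariant_g)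
  then show "\<forall>g\<in>set gs. invariant \<Gamma> g" by (simp add: gs_def)
  have CI: "completely_integrable_by \<Gamma> (mag_form a b 0 \<rho>) S (map (descend \<Gamma>) gs)"
    if "S \<subseteq> TM \<Gamma>" and "\<And>x U. covproj \<Gamma> x \<in> S \<Longrightarrow> open U \<Longrightarrow> x \<in> U \<Longrightarrow> \<exists>y\<in>U. covproj \<Gamma> y \<in> S \<and>
      indep_family [grad energy y, grad (g2 a b \<rho>) y, grad (g3 a b \<rho>) y, grad (g4 a b \<rho>) y]" for S
    unfolding gs_def
    by (rule completely_integrable_byI[OF 0])
      (use that inv elementary_integrals conserved_g poisson_g in \<open>auto\<close>)
  show "completely_integrable_by \<Gamma> (mag_form a b 0 \<rho>) (TM \<Gamma>) (map (descend \<Gamma>) gs)"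
  proof (rule CI)
    fix x :: tvec and U assume "open U" "x \<in> U"
    from dense_indep_g[OF b this] show "\<exists>y\<in>U. covproj \<Gamma> y \<in> TM \<Gamma> \<and>
      indep_family [grad energy y, grad (g2 a b \<rho>) y, grad (g3 a b \<rho>) y, grad (g4 a b \<rho>) y]"
      by (auto simp: TM_def)
  qed simp
  show "completely_integrable_by \<Gamma> (mag_form a b 0 \<rho>) (energy_level \<Gamma> h) (map (descend \<Gamma>) gs)" if h: "h > 0"
  proof (rule CI[OF energy_level_subset])
    fix x :: tvec and U assume x: "covproj \<Gamma> x \<in> energy_level \<Gamma> h" and U: "open U" "x \<in> U"
    have "energy x = h" using x by (simp add: in_energy_level[OF 0])
    then show "\<exists>y\<in>U. covproj \<Gamma> y \<in> energy_level \<Gamma> h \<and>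
      indep_family [grad energy y, grad (g2 a b \<rho>) y, grad (g3 a b \<rho>) y, grad (g4 a b \<rho>) y]"
      using dense_indep_g[OF b U] h by (auto simp: in_energy_level[OF 0])
  qed
  show "\<forall>\<Psi>\<in>set (map (descend \<Gamma>) gs). analytic_at_level \<Gamma> S \<Psi>"
    using inv analytic_integrals by (auto simp: gs_def intro!: analytic_at_levelI[OF 0])
qed

text \<open>The Pfaffian of the matrix is \<open>\<plusminus> b c\<close>; if it is nonzero then the linear system
  given by the matrix has only the trivial solution, and the rank is \<open>4\<close>.\<close>
lemma mag_form_rank_2:
  assumes "form_rank (mag_form a b c \<rho>) = 2" shows "b * c = 0"
proof (rule ccontr)
  assume bc: "b * c \<noteq> 0"
  let ?A = "\<chi> i j. mag_form a b c \<rho> (basis4 i) (basis4 j)"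
  have A: "(?A *v v)$1 = \<rho> * v$2 + a * v$3 + c * v$4" "(?A *v v)$2 = b * v$3 - \<rho> * v$1"
    "(?A *v v)$3 = - a * v$1 - b * v$2" "(?A *v v)$4 = - c * v$1" for v
    by (simp_all add: matrix_vector_mult_def sum_4 mag_form_nth axis_def)
  have "inj ((*v) ?A)"
  proof (rule matrix_vector_mul_linear[THEN linear_injective_0, THEN iffD2], intro allI impI)
    fix v assume "?A *v v = 0"
    then have "(?A *v v) $ i = 0" for i by simp
    from this[of 1] this[of 2] this[of 3] this[of 4] show "v = 0"
      unfolding A vec4_eq_iff using bc by auto
  qed
  then have "rank ?A = 4" by (simp add: full_rank_injective[symmetric])
  then show False using assms by (simp add: form_rank_def)
qed

lemma inv_d_eq: "inv_d (\<lambda>X. \<rho> * X$3) = mag_form 0 0 0 (- \<rho>)"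
  by (simp add: fun_eq_iff inv_d_def mag_form_nth bracket_nth)

lemma inv_closed_mag_form: "inv_closed (mag_form 0 0 0 \<rho>)"
  by (simp add: inv_closed_def mag_form_nth bracket_nth)

theorem theorem5p1:
  fixes a b c \<rho> :: real
  shows
    "(inv_closed (mag_form a b c \<rho>) \<and> form_rank (mag_form a b c \<rho>) = 2 \<longrightarrow>
        b * c = 0 \<and>
        (b = 0 \<longrightarrow>
          (let \<omega> = mag_form a b c \<rho>;
               \<Gamma> = int_span4 (2 *\<^sub>R basis4 1) (basis4 2) (basis4 3) (basis4 4);
               fs = [f2 a c \<rho>, f3 a c \<rho>, f4 a c \<rho>];
               \<Psi>s = map (descend \<Gamma>) fs
           in lattice_in_N \<Gamma> \<and> (\<forall>f\<in>set fs. invariant \<Gamma> f) \<and>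
              (a \<noteq> 0 \<longrightarrow>
                 completely_integrable_by \<Gamma> \<omega> (TM \<Gamma>) \<Psi>s \<and>
                 (\<forall>\<Psi>\<in>set \<Psi>s. analytic_at_level \<Gamma> (TM \<Gamma>) \<Psi>)) \<and>
              (a = 0 \<longrightarrow>
                 (\<forall>h>0. sqrt (2 * h) < \<bar>\<rho>\<bar> \<longrightarrow>
                    completely_integrable_by \<Gamma> \<omega> (energy_level \<Gamma> h) \<Psi>s \<and>
                    (\<forall>\<Psi>\<in>set \<Psi>s. analytic_at_level \<Gamma> (energy_level \<Gamma> h) \<Psi>)) \<and>
                 (\<forall>h>0. sqrt (2 * h) \<ge> \<bar>\<rho>\<bar> \<longrightarrow>
                    completely_integrable_by \<Gamma> \<omega> (energy_level \<Gamma> h) \<Psi>s \<and>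
                    \<not> (\<forall>\<Psi>\<in>set \<Psi>s. analytic_at_level \<Gamma> (energy_level \<Gamma> h) \<Psi>))))) \<and>
        (c = 0 \<and> b \<noteq> 0 \<longrightarrow>
          (let \<omega> = mag_form a b c \<rho>;
               \<Gamma> = (if a = 0
                     then int_span4 (2 *\<^sub>R basis4 1) ((1/b) *\<^sub>R basis4 2) ((1/b) *\<^sub>R basis4 3) (basis4 4)
                     else int_span4 ((2/a) *\<^sub>R basis4 1) ((1/b) *\<^sub>R basis4 2)
                            ((1/(a*b)) *\<^sub>R basis4 3) (basis4 4));
               gs = [g2 a b \<rho>, g3 a b \<rho>, g4 a b \<rho>];
               \<Psi>s = map (descend \<Gamma>) gs
           in lattice_in_N \<Gamma> \<and> (\<forall>g\<in>set gs. invariant \<Gamma> g) \<and>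
              completely_integrable_by \<Gamma> \<omega> (TM \<Gamma>) \<Psi>s \<and>
              (\<forall>\<Psi>\<in>set \<Psi>s. analytic_at_level \<Gamma> (TM \<Gamma>) \<Psi>) \<and>
              (\<forall>h>0. completely_integrable_by \<Gamma> \<omega> (energy_level \<Gamma> h) \<Psi>s \<and>
                 (\<forall>\<Psi>\<in>set \<Psi>s. analytic_at_level \<Gamma> (energy_level \<Gamma> h) \<Psi>))))) \<and>
     (form_rank (inv_d (\<lambda>X. \<rho> * X$3)) = 2 \<longrightarrow>
        (let \<omega> = inv_d (\<lambda>X. \<rho> * X$3);
             \<Gamma> = int_span4 (2 *\<^sub>R basis4 1) (basis4 2) (basis4 3) (basis4 4);
             fs = [f2 0 0 (- \<rho>), f3 0 0 (- \<rho>), f4 0 0 (- \<rho>)];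
             \<Psi>s = map (descend \<Gamma>) fs
         in inv_closed \<omega> \<and> \<omega> = mag_form 0 0 0 (- \<rho>) \<and>
            lattice_in_N \<Gamma> \<and> (\<forall>f\<in>set fs. invariant \<Gamma> f) \<and>
            (\<forall>h>0. sqrt (2 * h) < \<bar>\<rho>\<bar> \<longrightarrow>
               completely_integrable_by \<Gamma> \<omega> (energy_level \<Gamma> h) \<Psi>s \<and>
               (\<forall>\<Psi>\<in>set \<Psi>s. analytic_at_level \<Gamma> (energy_level \<Gamma> h) \<Psi>)) \<and>
            (\<forall>h>0. sqrt (2 * h) \<ge> \<bar>\<rho>\<bar> \<longrightarrow>
               completely_integrable_by \<Gamma> \<omega> (energy_level \<Gamma> h) \<Psi>s \<and>
               \<not> (\<forall>\<Psi>\<in>set \<Psi>s. analytic_at_level \<Gamma> (energy_level \<Gamma> h) \<Psi>))))"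
proof (intro conjI impI, goal_cases)
  case 1
  then show ?case using mag_form_rank_2 by blast
next
  case 2
  show ?case
    unfolding Let_def \<open>b = 0\<close>
  proof (intro conjI allI impI)
    fix h :: real assume "a = 0" "h > 0" "sqrt (2 * h) \<ge> \<bar>\<rho>\<bar>"
    then show "\<not> (\<forall>\<Psi>\<in>set (map (descend (int_span4 (2 *\<^sub>R basis4 1) (basis4 2) (basis4 3) (basis4 4)))
        [f2 a c \<rho>, f3 a c \<rho>, f4 a c \<rho>]).
        analytic_at_level (int_span4 (2 *\<^sub>R basis4 1) (basis4 2) (basis4 3) (basis4 4))
          (energy_level (int_span4 (2 *\<^sub>R basis4 1) (basis4 2) (basis4 3) (basis4 4)) h) \<Psi>)"
      unfolding integrability_b_eq_0(6)[OF \<open>a = 0\<close> \<open>h > 0\<close>] by simp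
  qed (rule integrability_b_eq_0(1-5) integrability_b_eq_0(6)[THEN iffD2] | assumption)+
next
  case 3
  then have c: "c = 0" and b: "b \<noteq> 0" by simp_all
  show ?case
    unfolding Let_def c by (intro conjI allI impI integrability_c_eq_0 b)
next
  case 4
  show ?case
    unfolding Let_def inv_d_eq
  proof (intro conjI allI impI)
    fix h :: real assume "h > 0" "sqrt (2 * h) \<ge> \<bar>\<rho>\<bar>"
    then show "\<not> (\<forall>\<Psi>\<in>set (map (descend (int_span4 (2 *\<^sub>R basis4 1) (basis4 2) (basis4 3) (basis4 4)))
        [f2 0 0 (- \<rho>), f3 0 0 (- \<rho>), f4 0 0 (- \<rho>)]).
        analytic_at_level (int_span4 (2 *\<^sub>R basis4 1) (basis4 2) (basis4 3) (basis4 4))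
          (energy_level (int_span4 (2 *\<^sub>R basis4 1) (basis4 2) (basis4 3) (basis4 4)) h) \<Psi>)"
      unfolding integrability_b_eq_0(6)[OF refl \<open>h > 0\<close>] by simp
  qed (rule inv_closed_mag_form refl integrability_b_eq_0(1-5)
        integrability_b_eq_0(6)[where \<rho> = "- \<rho>", unfolded abs_minus_cancel, THEN iffD2] | assumption)+
qed

end
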